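(* Let $G$ and $H$ be countable discrete groups. Suppose $G$ has the approximation property (AP). Then $G\times H$ has the invariant translation approximation property (ITAP) if and only if $H$ has the ITAP.
   Context: For a countable discrete group $G$, choose a proper length function $l\colon G\to[0,\infty)$ (i.e. $l(g)=0$ iff $g=e$, $l(g^{-1})=l(g)$, $l(gh)\le l(g)+l(h)$, and $\{g: l(g)\le R\}$ is finite for all $R$), and let $|G|$ be the metric space $G$ with metric $d(g,h)=l(gh^{-1})$; this has bounded geometry, and $G$ acts on it isometrically by right translations. Uniform Roe algebra: for $R,M>0$ let $A_{R,M}(|G|)$ be the set of complex $G\times G$-matrices $a$ with $a(s,t)=0$ whenever $d(s,t)>R$ and $|a(s,t)|\le M$ for all $s,t$. These act as bounded operators on $\ell^2(G)$ by $(a\xi)(s)=\sum_t a(s,t)\xi(t)$. $C^*_u(|G|)=C^*_u|G|\subseteq B(\ell^2(G))$ is the norm closure of $\bigcup_{R,M}A_{R,M}(|G|)$ (independent of the choice of $l$). $G$ acts on $C^*_u|G|$ by conjugation with the right regular representation, i.e. by right translation of both matrix indices; $(C^*_u|G|)^G$ denotes the fixed points. $C^*_\lambda(G)\subseteq B(\ell^2(G))$ is the reduced group $C^*$-algebra, the norm closed span of the left regular representation $\lambda(G)$. ITAP: $G$ has the invariant translation approximation property if $C^*_\lambda(G)=(C^*_u|G|)^G$. AP (Haagerup–Kraus): $G$ has the approximation property if the constant function $1$ lies in the $\sigma(M_0A(G),Q(G))$-closure of the Fourier algebra $A(G)$ in $M_0A(G)$, where $M_0A(G)$ is the space of completely bounded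 Fourier multipliers of $G$ (with the completely bounded multiplier norm) and $Q(G)$ is its standard predual, i.e. the completion of $\ell^1(G)$ in the norm $\|f\|_Q=\sup\{|\sum_g f(g)u(g)|: u\in M_0A(G),\ \|u\|_{M_0A(G)}\le 1\}$. *)

theory Defs
  imports "HOL-Analysis.Analysis" "HOL-Algebra.Group"
begin

section \<open>The Hilbert space \<open>\<ell>\<^sup>2\<close>\<close>

typedef 'a ell2 = "{f :: 'a \<Rightarrow> complex. (\<lambda>s. (cmod (f s))\<^sup>2) summable_on UNIV}"
  morphisms coord Abs_ell2
  by (rule exI[of _ "\<lambda>_. 0"]) simp

setup_lifting type_definition_ell2

lemma ell2_eqI: "(\<And>s. coord x s = coord y s) \<Longrightarrow> x = y"
  by (metis coord_inject ext)

lemma square_summable_add: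
  fixes f g :: "'a \<Rightarrow> complex"
  assumes "(\<lambda>s. (cmod (f s))\<^sup>2) summable_on S" "(\<lambda>s. (cmod (g s))\<^sup>2) summable_on S"
  shows "(\<lambda>s. (cmod (f s + g s))\<^sup>2) summable_on S"
proof (rule summable_on_comparison_test)
  show "(\<lambda>s. 2 * (cmod (f s))\<^sup>2 + 2 * (cmod (g s))\<^sup>2) summable_on S"
    by (intro summable_on_add summable_on_cmult_right assms)
  show "(cmod (f s + g s))\<^sup>2 \<le> 2 * (cmod (f s))\<^sup>2 + 2 * (cmod (g s))\<^sup>2" for s
  proof -
    have "(cmod (f s + g s))\<^sup>2 \<le> (cmod (f s) + cmod (g s))\<^sup>2"
      by (intro power_mono norm_triangle_ineq) auto
    also have "\<dots> \<le> 2 * (cmod (f s))\<^sup>2 + 2 * (cmod (g s))\<^sup>2"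
      using zero_le_power2[of "cmod (f s) - cmod (g s)"]
      unfolding power2_sum power2_diff by linarith
    finally show ?thesis .
  qed
qed auto

lemma square_summable_mult:
  fixes f g :: "'a \<Rightarrow> complex"
  assumes "(\<lambda>s. (cmod (f s))\<^sup>2) summable_on S" "(\<lambda>s. (cmod (g s))\<^sup>2) summable_on S"
  shows "(\<lambda>s. cmod (f s * g s)) summable_on S"
proof (rule summable_on_comparison_test)
  show "(\<lambda>s. (cmod (f s))\<^sup>2 + (cmod (g s))\<^sup>2) summable_on S"
    by (intro summable_on_add assms)
  show "cmod (f s * g s) \<le> (cmod (f s))\<^sup>2 + (cmod (g s))\<^sup>2" for s
  proof -
    have "0 \<le> cmod (f s) * cmod (g s)" by simp
    thus ?thesis
      using sum_squares_bound[of "cmod (f s)" "cmod (g s)"] unfolding norm_mult by linarith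
  qed
qed auto

lift_definition scaleC_ell2 :: "complex \<Rightarrow> 'a ell2 \<Rightarrow> 'a ell2" is "\<lambda>c f s. c * f s"
  by (simp add: norm_mult power_mult_distrib summable_on_cmult_right)

lift_definition cinner_ell2 :: "'a ell2 \<Rightarrow> 'a ell2 \<Rightarrow> complex"
  is "\<lambda>f g. \<Sum>\<^sub>\<infinity>s. f s * cnj (g s)" .

instantiation ell2 :: (type) real_vector
begin

lift_definition zero_ell2 :: "'a ell2" is "\<lambda>_. 0" by simp

lift_definition plus_ell2 :: "'a ell2 \<Rightarrow> 'a ell2 \<Rightarrow> 'a ell2" is "\<lambda>f g s. f s + g s"
  by (simp add: square_summable_add)

lift_definition uminus_ell2 :: "'a ell2 \<Rightarrow> 'a ell2" is "\<lambda>f s. - f s" by simp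

lift_definition minus_ell2 :: "'a ell2 \<Rightarrow> 'a ell2 \<Rightarrow> 'a ell2" is "\<lambda>f g s. f s - g s"
  subgoal for f g using square_summable_add[of f UNIV "\<lambda>s. - g s"] by simp
  done

lift_definition scaleR_ell2 :: "real \<Rightarrow> 'a ell2 \<Rightarrow> 'a ell2" is "\<lambda>r f s. r *\<^sub>R f s"
  by (simp add: power_mult_distrib summable_on_cmult_right)

instance
  by standard (transfer; simp add: algebra_simps)+

end

instantiation ell2 :: (type) real_inner
begin

definition inner_ell2 :: "'a ell2 \<Rightarrow> 'a ell2 \<Rightarrow> real" where
  "inner_ell2 x y = Re (cinner_ell2 x y)"

definition norm_ell2 :: "'a ell2 \<Rightarrow> real" where
  "norm_ell2 x = sqrt (\<Sum>\<^sub>\<infinity>s. (cmod (coord x s))\<^sup>2)"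

definition sgn_ell2 :: "'a ell2 \<Rightarrow> 'a ell2" where
  "sgn_ell2 x = x /\<^sub>R norm x"

definition dist_ell2 :: "'a ell2 \<Rightarrow> 'a ell2 \<Rightarrow> real" where
  "dist_ell2 x y = norm (x - y)"

definition uniformity_ell2 :: "('a ell2 \<times> 'a ell2) filter" where
  "uniformity_ell2 = (INF e\<in>{0<..}. principal {(x, y). dist x y < e})"

definition open_ell2 :: "'a ell2 set \<Rightarrow> bool" where
  "open_ell2 U = (\<forall>x\<in>U. \<forall>\<^sub>F (x', y) in uniformity. x' = x \<longrightarrow> y \<in> U)"

lemma coord_summable: "(\<lambda>s. (cmod (coord x s))\<^sup>2) summable_on UNIV"
  using coord[of x] by simp

lemma cinner_ell2_summable: "(\<lambda>s. coord x s * cnj (coord y s)) summable_on UNIV"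
  by (rule abs_summable_summable, rule square_summable_mult) (auto simp: coord_summable)

lemma inner_ell2_self: "inner x x = (\<Sum>\<^sub>\<infinity>s. (cmod (coord x s))\<^sup>2)" for x :: "'a ell2"
proof -
  have "inner x x = (\<Sum>\<^sub>\<infinity>s. Re (coord x s * cnj (coord x s)))"
    unfolding inner_ell2_def cinner_ell2.rep_eq
    by (rule infsum_Re[symmetric], rule cinner_ell2_summable)
  thus ?thesis by (simp add: complex_norm_square[symmetric] flip: of_real_power)
qed

instance
proof
  fix x y z :: "'a ell2" and r :: real
  show "sgn x = x /\<^sub>R norm x" by (rule sgn_ell2_def)
  show "dist x y = norm (x - y)" by (rule dist_ell2_def)
  show "uniformity = (INF e\<in>{0<..}. principal {(x, y :: 'a ell2). dist x y < e})"
    by (rule uniformity_ell2_def)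
  show "open U = (\<forall>x\<in>U. \<forall>\<^sub>F (x', y) in uniformity. x' = x \<longrightarrow> y \<in> U)" for U :: "'a ell2 set"
    by (rule open_ell2_def)
  have "cinner_ell2 y x = cnj (cinner_ell2 x y)"
    by (simp add: cinner_ell2.rep_eq mult.commute flip: infsum_cnj)
  thus "inner x y = inner y x" by (simp add: inner_ell2_def)
  have "cinner_ell2 (x + y) z = cinner_ell2 x z + cinner_ell2 y z"
    by (simp add: cinner_ell2.rep_eq plus_ell2.rep_eq distrib_right infsum_add
        cinner_ell2_summable)
  thus "inner (x + y) z = inner x z + inner y z" by (simp add: inner_ell2_def)
  have "cinner_ell2 (r *\<^sub>R x) y = r * cinner_ell2 x y"
    by (simp add: cinner_ell2.rep_eq scaleR_ell2.rep_eq scaleR_conv_of_real mult.assoc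
        infsum_cmult_right')
  thus "inner (r *\<^sub>R x) y = r * inner x y" by (simp add: inner_ell2_def)
  show "0 \<le> inner x x" by (simp add: inner_ell2_self infsum_nonneg)
  show "inner x x = 0 \<longleftrightarrow> x = 0"
  proof
    assume "inner x x = 0"
    hence "(cmod (coord x s))\<^sup>2 = 0" for s
      using nonneg_infsum_le_0D[OF _ coord_summable, of x s] by (simp add: inner_ell2_self)
    thus "x = 0" by (intro ell2_eqI) (simp add: zero_ell2.rep_eq)
  qed (simp add: inner_ell2_self zero_ell2.rep_eq)
  show "norm x = sqrt (inner x x)" by (simp add: norm_ell2_def inner_ell2_self)
qed

end

text \<open>
  \<open>\<ell>\<^sup>2(G)\<close> is realised as the closed subspace of \<open>\<ell>\<^sup>2('a)\<close> of vectors supported on the carrier, and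
  \<open>B(\<ell>\<^sup>2(G))\<close> as the corner of the bounded operators on \<open>\<ell>\<^sup>2('a)\<close> which vanish on its orthogonal
  complement and map into it; this identification is isometric.  The type
  \<^typ>\<open>'a ell2 \<Rightarrow>\<^sub>L 'a ell2\<close> is that of bounded real-linear operators, but all the operator algebras
  below are closures of sets of complex-linear operators, hence consist of complex-linear ones.
\<close>

definition ell2_on :: "('a, 'm) monoid_scheme \<Rightarrow> 'a ell2 set" where
  "ell2_on G = {\<xi>. \<forall>s. s \<notin> carrier G \<longrightarrow> coord \<xi> s = 0}"

lemma bounded_linear_scaleC_ell2: "bounded_linear (scaleC_ell2 c)"
proof (rule bounded_linear_intro[where K = "cmod c"])
  fix x y :: "'a ell2" and r :: real
  show "scaleC_ell2 c (x + y) = scaleC_ell2 c x + scaleC_ell2 c y"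
    "scaleC_ell2 c (r *\<^sub>R x) = r *\<^sub>R scaleC_ell2 c x"
    by (transfer; simp add: algebra_simps)+
  have "norm (scaleC_ell2 c x) = cmod c * norm x"
    by (simp add: norm_ell2_def scaleC_ell2.rep_eq norm_mult power_mult_distrib
        infsum_cmult_right' real_sqrt_mult)
  thus "norm (scaleC_ell2 c x) \<le> norm x * cmod c" by simp
qed

lift_definition scalar_op :: "complex \<Rightarrow> 'a ell2 \<Rightarrow>\<^sub>L 'a ell2" is scaleC_ell2
  by (rule bounded_linear_scaleC_ell2)

section \<open>Regular representations\<close>

definition pull_ell2 :: "'a set \<Rightarrow> ('a \<Rightarrow> 'a) \<Rightarrow> 'a ell2 \<Rightarrow> 'a ell2" where
  "pull_ell2 S \<phi> \<xi> = Abs_ell2 (\<lambda>s. if s \<in> S then coord \<xi> (\<phi> s) else 0)"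

definition left_reg :: "('a, 'm) monoid_scheme \<Rightarrow> 'a \<Rightarrow> 'a ell2 \<Rightarrow>\<^sub>L 'a ell2" where
  "left_reg G g = Blinfun (pull_ell2 (carrier G) (\<lambda>s. inv\<^bsub>G\<^esub> g \<otimes>\<^bsub>G\<^esub> s))"

definition right_reg :: "('a, 'm) monoid_scheme \<Rightarrow> 'a \<Rightarrow> 'a ell2 \<Rightarrow>\<^sub>L 'a ell2" where
  "right_reg G g = Blinfun (pull_ell2 (carrier G) (\<lambda>s. s \<otimes>\<^bsub>G\<^esub> g))"

lemma pull_ell2_aux:
  assumes "inj_on \<phi> S"
  shows "(\<lambda>s. (cmod (if s \<in> S then coord \<xi> (\<phi> s) else 0))\<^sup>2) summable_on UNIV"
    and "(\<Sum>\<^sub>\<infinity>s. (cmod (if s \<in> S then coord \<xi> (\<phi> s) else 0))\<^sup>2) \<le> (\<Sum>\<^sub>\<infinity>s. (cmod (coord \<xi> s))\<^sup>2)"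
proof -
  let ?n = "\<lambda>s. (cmod (coord \<xi> s))\<^sup>2"
  let ?f = "\<lambda>s. (cmod (if s \<in> S then coord \<xi> (\<phi> s) else 0))\<^sup>2"
  have sub: "?n summable_on \<phi> ` S"
    by (rule summable_on_subset_banach[OF coord_summable]) simp
  have "?f summable_on UNIV \<longleftrightarrow> (?n \<circ> \<phi>) summable_on S"
    by (rule summable_on_cong_neutral) auto
  thus "?f summable_on UNIV" using sub summable_on_reindex[OF assms] by blast
  have "infsum ?f UNIV = infsum (?n \<circ> \<phi>) S"
    by (rule infsum_cong_neutral) auto
  also have "\<dots> = infsum ?n (\<phi> ` S)"
    using infsum_reindex[OF assms, of ?n] by simp
  also have "\<dots> \<le> infsum ?n UNIV"
    by (rule infsum_mono2[OF sub coord_summable]) auto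
  finally show "infsum ?f UNIV \<le> infsum ?n UNIV" .
qed

lemma coord_pull_ell2:
  assumes "inj_on \<phi> S"
  shows "coord (pull_ell2 S \<phi> \<xi>) s = (if s \<in> S then coord \<xi> (\<phi> s) else 0)"
  unfolding pull_ell2_def using pull_ell2_aux(1)[OF assms, of \<xi>] by (subst Abs_ell2_inverse) auto

lemma bounded_linear_pull_ell2:
  assumes "inj_on \<phi> S"
  shows "bounded_linear (pull_ell2 S \<phi>)"
proof (rule bounded_linear_intro[where K = 1])
  fix x y :: "'a ell2" and r :: real
  show "pull_ell2 S \<phi> (x + y) = pull_ell2 S \<phi> x + pull_ell2 S \<phi> y"
    "pull_ell2 S \<phi> (r *\<^sub>R x) = r *\<^sub>R pull_ell2 S \<phi> x"
    by (auto intro!: ell2_eqI simp: coord_pull_ell2[OF assms] plus_ell2.rep_eq scaleR_ell2.rep_eq)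
  show "norm (pull_ell2 S \<phi> x) \<le> norm x * 1"
    using pull_ell2_aux(2)[OF assms, of x] by (simp add: norm_ell2_def coord_pull_ell2[OF assms])
qed

lemma left_reg_apply:
  assumes "group G" "g \<in> carrier G"
  shows "coord (left_reg G g \<xi>) s = (if s \<in> carrier G then coord \<xi> (inv\<^bsub>G\<^esub> g \<otimes>\<^bsub>G\<^esub> s) else 0)"
proof -
  interpret group G by fact
  have "inj_on (\<lambda>s. inv\<^bsub>G\<^esub> g \<otimes>\<^bsub>G\<^esub> s) (carrier G)"
    using assms(2) by (intro inj_onI) simp
  thus ?thesis
    by (simp add: left_reg_def bounded_linear_Blinfun_apply bounded_linear_pull_ell2 coord_pull_ell2)
qed

lemma right_reg_apply:
  assumes "group G" "g \<in> carrier G"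
  shows "coord (right_reg G g \<xi>) s = (if s \<in> carrier G then coord \<xi> (s \<otimes>\<^bsub>G\<^esub> g) else 0)"
proof -
  interpret group G by fact
  have "inj_on (\<lambda>s. s \<otimes>\<^bsub>G\<^esub> g) (carrier G)"
    using assms(2) by (intro inj_onI) simp
  thus ?thesis
    by (simp add: right_reg_def bounded_linear_Blinfun_apply bounded_linear_pull_ell2 coord_pull_ell2)
qed

definition group_algebra_ops :: "('a, 'm) monoid_scheme \<Rightarrow> ('a ell2 \<Rightarrow>\<^sub>L 'a ell2) set" where
  "group_algebra_ops G =
     {\<Sum>g\<in>F. scalar_op (c g) o\<^sub>L left_reg G g | F c. finite F \<and> F \<subseteq> carrier G}"

definition reduced_Cstar :: "('a, 'm) monoid_scheme \<Rightarrow> ('a ell2 \<Rightarrow>\<^sub>L 'a ell2) set" where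
  "reduced_Cstar G = closure (group_algebra_ops G)"

section \<open>Uniform Roe algebra and the ITAP\<close>

definition proper_length_function :: "('a, 'm) monoid_scheme \<Rightarrow> ('a \<Rightarrow> real) \<Rightarrow> bool" where
  "proper_length_function G l \<longleftrightarrow>
     (\<forall>g\<in>carrier G. 0 \<le> l g \<and> (l g = 0 \<longleftrightarrow> g = \<one>\<^bsub>G\<^esub>) \<and> l (inv\<^bsub>G\<^esub> g) = l g) \<and>
     (\<forall>g\<in>carrier G. \<forall>h\<in>carrier G. l (g \<otimes>\<^bsub>G\<^esub> h) \<le> l g + l h) \<and>
     (\<forall>R. finite {g \<in> carrier G. l g \<le> R})"

definition banded_matrices ::
  "('a, 'm) monoid_scheme \<Rightarrow> ('a \<Rightarrow> real) \<Rightarrow> real \<Rightarrow> real \<Rightarrow> ('a \<Rightarrow> 'a \<Rightarrow> complex) set" where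
  "banded_matrices G l R M =
     {a. (\<forall>s t. a s t \<noteq> 0 \<longrightarrow> s \<in> carrier G \<and> t \<in> carrier G) \<and>
         (\<forall>s\<in>carrier G. \<forall>t\<in>carrier G. l (s \<otimes>\<^bsub>G\<^esub> inv\<^bsub>G\<^esub> t) > R \<longrightarrow> a s t = 0) \<and>
         (\<forall>s t. cmod (a s t) \<le> M)}"

definition uniform_roe ::
  "('a, 'm) monoid_scheme \<Rightarrow> ('a \<Rightarrow> real) \<Rightarrow> ('a ell2 \<Rightarrow>\<^sub>L 'a ell2) set" where
  "uniform_roe G l =
     closure {T. \<exists>R>0. \<exists>M>0. \<exists>a\<in>banded_matrices G l R M.
                   \<forall>\<xi> s. coord (blinfun_apply T \<xi>) s = (\<Sum>\<^sub>\<infinity>t\<in>carrier G. a s t * coord \<xi> t)}"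

definition uniform_roe_fixed ::
  "('a, 'm) monoid_scheme \<Rightarrow> ('a \<Rightarrow> real) \<Rightarrow> ('a ell2 \<Rightarrow>\<^sub>L 'a ell2) set" where
  "uniform_roe_fixed G l =
     {T \<in> uniform_roe G l.
        \<forall>g\<in>carrier G. right_reg G g o\<^sub>L T o\<^sub>L right_reg G (inv\<^bsub>G\<^esub> g) = T}"

lemma uniform_roe_independent:
  assumes "group G" "proper_length_function G l" "proper_length_function G l'"
  shows "uniform_roe G l = uniform_roe G l'"
proof -
  interpret group G by fact
  have *: "\<exists>R'>0. banded_matrices G l R M \<subseteq> banded_matrices G l' R' M"
    if "proper_length_function G l" for l l' :: "'a \<Rightarrow> real" and R M
  proof -
    let ?B = "{g \<in> carrier G. l g \<le> R}"
    define R' where "R' = Max (insert 1 (l' ` ?B))"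
    have "finite ?B" using that unfolding proper_length_function_def by blast
    hence fin: "finite (insert 1 (l' ` ?B))" by blast
    have "R' \<ge> 1" unfolding R'_def by (rule Max_ge[OF fin]) blast
    have "l' g \<le> R'" if "g \<in> ?B" for g
      unfolding R'_def by (rule Max_ge[OF fin]) (use that in blast)
    hence bound: "l' (s \<otimes>\<^bsub>G\<^esub> inv\<^bsub>G\<^esub> t) \<le> R'"
      if "s \<in> carrier G" "t \<in> carrier G" "l (s \<otimes>\<^bsub>G\<^esub> inv\<^bsub>G\<^esub> t) \<le> R" for s t
      using that by simp
    have "banded_matrices G l R M \<subseteq> banded_matrices G l' R' M"
    proof
      fix a assume a: "a \<in> banded_matrices G l R M"
      have "a s t = 0" if "s \<in> carrier G" "t \<in> carrier G" "l' (s \<otimes>\<^bsub>G\<^esub> inv\<^bsub>G\<^esub> t) > R'" for s t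
      proof -
        have "l (s \<otimes>\<^bsub>G\<^esub> inv\<^bsub>G\<^esub> t) > R" using bound[OF that(1,2)] that(3) by linarith
        thus ?thesis using a that(1,2) unfolding banded_matrices_def by blast
      qed
      thus "a \<in> banded_matrices G l' R' M" using a unfolding banded_matrices_def by blast
    qed
    thus ?thesis using \<open>R' \<ge> 1\<close> by (intro exI[of _ R'] conjI) linarith+
  qed
  define ops where "ops l = {T. \<exists>R>0. \<exists>M>0. \<exists>a\<in>banded_matrices G l R M.
      \<forall>\<xi> s. coord (blinfun_apply T \<xi>) s = (\<Sum>\<^sub>\<infinity>t\<in>carrier G. a s t * coord \<xi> t)}" for l
  have "ops l \<subseteq> ops l'" if l: "proper_length_function G l" for l l'
  proof
    fix T assume "T \<in> ops l"
    then obtain R M a where "M > 0" and a: "a \<in> banded_matrices G l R M"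
      and T: "\<forall>\<xi> s. coord (blinfun_apply T \<xi>) s = (\<Sum>\<^sub>\<infinity>t\<in>carrier G. a s t * coord \<xi> t)"
      unfolding ops_def by blast
    obtain R' where "R' > 0" "banded_matrices G l R M \<subseteq> banded_matrices G l' R' M"
      using *[OF l] by blast
    with \<open>M > 0\<close> a T show "T \<in> ops l'" unfolding ops_def by blast
  qed
  hence "ops l = ops l'" using assms(2,3) by blast
  thus ?thesis by (simp add: uniform_roe_def ops_def)
qed

lemma proper_length_function_exists:
  assumes "group G" "countable (carrier G)"
  shows "\<exists>l. proper_length_function G l"
proof -
  interpret group G by fact
  define e where "e = to_nat_on (carrier G)"
  define w where "w g = Suc (min (e g) (e (inv\<^bsub>G\<^esub> g)))" for g
  define mul where "mul = (\<lambda>xs. foldr (\<otimes>\<^bsub>G\<^esub>) xs \<one>\<^bsub>G\<^esub>)"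
  define W where "W = (\<lambda>xs. sum_list (map w xs))"
  define l where "l g = (LEAST n. \<exists>xs. set xs \<subseteq> carrier G \<and> mul xs = g \<and> W xs = n)" for g
  have mul_closed: "mul xs \<in> carrier G" if "set xs \<subseteq> carrier G" for xs
    using that by (induction xs) (auto simp: mul_def)
  have mul_append: "mul (xs @ ys) = mul xs \<otimes>\<^bsub>G\<^esub> mul ys"
    if "set xs \<subseteq> carrier G" "set ys \<subseteq> carrier G" for xs ys
    using that
  proof (induction xs)
    case Nil
    thus ?case using mul_closed[of ys] by (simp add: mul_def)
  next
    case (Cons x xs)
    thus ?case using mul_closed[of xs] mul_closed[of ys] by (simp add: mul_def m_assoc)
  qed
  have mul_inv: "mul (rev (map (m_inv G) xs)) = inv\<^bsub>G\<^esub> (mul xs)" if "set xs \<subseteq> carrier G" for xs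
    using that
  proof (induction xs)
    case Nil
    thus ?case by (simp add: mul_def)
  next
    case (Cons x xs)
    have "mul (rev (map (m_inv G) xs) @ [inv\<^bsub>G\<^esub> x])
            = mul (rev (map (m_inv G) xs)) \<otimes>\<^bsub>G\<^esub> mul [inv\<^bsub>G\<^esub> x]"
      using Cons.prems by (intro mul_append) auto
    thus ?case using Cons mul_closed[of xs] by (simp add: mul_def inv_mult_group)
  qed
  have W_inv: "W (rev (map (m_inv G) xs)) = W xs" if "set xs \<subseteq> carrier G" for xs
    using that by (induction xs) (auto simp: W_def w_def min.commute)
  have l_le: "l (mul xs) \<le> W xs" if "set xs \<subseteq> carrier G" for xs
    unfolding l_def by (rule Least_le) (use that in blast)
  have l_ex: "\<exists>xs. set xs \<subseteq> carrier G \<and> mul xs = g \<and> W xs = l g" if "g \<in> carrier G" for g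
    unfolding l_def
    by (rule LeastI_ex) (use that in \<open>auto intro!: exI[of _ "[g]"] simp: mul_def\<close>)
  have fin_w: "finite {g \<in> carrier G. w g \<le> n}" for n
  proof -
    have "finite {g \<in> carrier G. e g \<le> n}"
    proof (rule inj_on_finite[of e _ "{..n}"])
      show "inj_on e {g \<in> carrier G. e g \<le> n}"
        unfolding e_def by (rule inj_on_subset[OF inj_on_to_nat_on[OF assms(2)]]) auto
    qed auto
    moreover from this have "finite (m_inv G ` {g \<in> carrier G. e g \<le> n})"
      by (rule finite_imageI)
    moreover have "{g \<in> carrier G. w g \<le> n}
        \<subseteq> {g \<in> carrier G. e g \<le> n} \<union> m_inv G ` {g \<in> carrier G. e g \<le> n}"
    proof
      fix g assume g: "g \<in> {g \<in> carrier G. w g \<le> n}"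
      hence "e g \<le> n \<or> e (inv\<^bsub>G\<^esub> g) \<le> n" by (auto simp: w_def min_def split: if_splits)
      moreover have "g = inv\<^bsub>G\<^esub> (inv\<^bsub>G\<^esub> g)" using g by simp
      ultimately show "g \<in> {g \<in> carrier G. e g \<le> n} \<union> m_inv G ` {g \<in> carrier G. e g \<le> n}"
        using g inv_closed[of g] by blast
    qed
    ultimately show ?thesis by (meson finite_Un finite_subset)
  qed
  have W_len: "length xs \<le> W xs" and W_mem: "x \<in> set xs \<Longrightarrow> w x \<le> W xs" for x xs
    by (induction xs) (auto simp: W_def w_def)
  have fin_l: "finite {g \<in> carrier G. l g \<le> n}" for n
  proof (rule finite_subset)
    let ?X = "{xs. set xs \<subseteq> {g \<in> carrier G. w g \<le> n} \<and> length xs \<le> n}"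
    show "{g \<in> carrier G. l g \<le> n} \<subseteq> mul ` ?X"
    proof
      fix g assume g: "g \<in> {g \<in> carrier G. l g \<le> n}"
      then obtain xs where xs: "set xs \<subseteq> carrier G" "mul xs = g" "W xs = l g"
        using l_ex by blast
      have "xs \<in> ?X" using xs g W_len[of xs] W_mem[of _ xs] by fastforce
      thus "g \<in> mul ` ?X" using xs(2) by blast
    qed
    show "finite (mul ` ?X)" by (intro finite_imageI finite_lists_length_le fin_w)
  qed
  have l_inv_le: "l (inv\<^bsub>G\<^esub> g) \<le> l g" if g: "g \<in> carrier G" for g
  proof -
    obtain xs where xs: "set xs \<subseteq> carrier G" "mul xs = g" "W xs = l g"
      using l_ex[OF g] by blast
    have "l (mul (rev (map (m_inv G) xs))) \<le> W (rev (map (m_inv G) xs))"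
      using xs(1) by (intro l_le) auto
    thus ?thesis using mul_inv[OF xs(1)] W_inv[OF xs(1)] xs by simp
  qed
  have "proper_length_function G (\<lambda>g. real (l g))"
    unfolding proper_length_function_def
  proof (intro conjI ballI allI)
    fix g assume g: "g \<in> carrier G"
    show "0 \<le> real (l g)" by simp
    show "real (l g) = 0 \<longleftrightarrow> g = \<one>\<^bsub>G\<^esub>"
    proof
      assume "real (l g) = 0"
      then obtain xs where "set xs \<subseteq> carrier G" "mul xs = g" "W xs = 0"
        using l_ex[OF g] by auto
      thus "g = \<one>\<^bsub>G\<^esub>" using W_len[of xs] by (simp add: mul_def)
    next
      assume "g = \<one>\<^bsub>G\<^esub>"
      thus "real (l g) = 0" using l_le[of "[]"] by (simp add: mul_def W_def)
    qed
    show "real (l (inv\<^bsub>G\<^esub> g)) = real (l g)"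
      using l_inv_le[OF g] l_inv_le[of "inv\<^bsub>G\<^esub> g"] g by simp
  next
    fix g h assume g: "g \<in> carrier G" and h: "h \<in> carrier G"
    obtain xs ys where xs: "set xs \<subseteq> carrier G" "mul xs = g" "W xs = l g"
      and ys: "set ys \<subseteq> carrier G" "mul ys = h" "W ys = l h"
      using l_ex[OF g] l_ex[OF h] by blast
    have "l (mul (xs @ ys)) \<le> W (xs @ ys)" using xs(1) ys(1) by (intro l_le) auto
    hence "l (g \<otimes>\<^bsub>G\<^esub> h) \<le> l g + l h"
      using mul_append[OF xs(1) ys(1)] xs ys by (simp add: W_def)
    thus "real (l (g \<otimes>\<^bsub>G\<^esub> h)) \<le> real (l g) + real (l h)" by linarith
  next
    fix R :: real
    show "finite {g \<in> carrier G. real (l g) \<le> R}"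
      by (rule finite_subset[OF _ fin_l[of "nat \<lfloor>R\<rfloor>"]]) (auto simp: le_nat_floor)
  qed
  thus ?thesis by blast
qed

text \<open>
  By the two preceding lemmas it does not matter for countable groups which proper length
  function is chosen.
\<close>

definition has_ITAP :: "('a, 'm) monoid_scheme \<Rightarrow> bool" where
  "has_ITAP G \<longleftrightarrow>
     (\<exists>l. proper_length_function G l \<and> reduced_Cstar G = uniform_roe_fixed G l)"

section \<open>Completely bounded Fourier multipliers and the AP\<close>

text \<open>Functions on \<open>G\<close> are represented as functions on the type which vanish off the carrier.\<close>

definition coeff :: "('a, 'm) monoid_scheme \<Rightarrow> 'a ell2 \<Rightarrow> 'a ell2 \<Rightarrow> 'a \<Rightarrow> complex" where
  "coeff G \<xi> \<eta> = (\<lambda>x. if x \<in> carrier G then cinner_ell2 (left_reg G x \<xi>) \<eta> else 0)"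

definition fourier_algebra :: "('a, 'm) monoid_scheme \<Rightarrow> ('a \<Rightarrow> complex) set" where
  "fourier_algebra G = {coeff G \<xi> \<eta> | \<xi> \<eta>. \<xi> \<in> ell2_on G \<and> \<eta> \<in> ell2_on G}"

definition weak_operator_topology :: "('a ell2 \<Rightarrow>\<^sub>L 'a ell2) topology" where
  "weak_operator_topology =
     pullback_topology UNIV (\<lambda>T (\<xi>, \<eta>). cinner_ell2 (blinfun_apply T \<xi>) \<eta>) euclidean"

definition group_vN :: "('a, 'm) monoid_scheme \<Rightarrow> ('a ell2 \<Rightarrow>\<^sub>L 'a ell2) set" where
  "group_vN G = weak_operator_topology closure_of group_algebra_ops G"

definition fourier_multiplier :: "('a, 'm) monoid_scheme \<Rightarrow> ('a \<Rightarrow> complex) \<Rightarrow> bool" where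
  "fourier_multiplier G u \<longleftrightarrow>
     (\<forall>x. x \<notin> carrier G \<longrightarrow> u x = 0) \<and>
     (\<forall>v\<in>fourier_algebra G. (\<lambda>x. u x * v x) \<in> fourier_algebra G)"

text \<open>
  The operator \<open>M\<^sub>u\<close> on \<open>VN(G)\<close> is the transpose of multiplication by \<open>u\<close> on \<open>A(G)\<close> under the
  duality \<open>VN(G) = A(G)\<^sup>*\<close>, in which the pairing of \<open>T\<close> with the coefficient function of
  \<open>(\<xi>, \<eta>)\<close> is \<open>\<langle>T \<xi>, \<eta>\<rangle>\<close>.
\<close>

definition multiplier_op ::
  "('a, 'm) monoid_scheme \<Rightarrow> ('a \<Rightarrow> complex) \<Rightarrow> ('a ell2 \<Rightarrow>\<^sub>L 'a ell2) \<Rightarrow> ('a ell2 \<Rightarrow>\<^sub>L 'a ell2)" where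
  "multiplier_op G u T =
     (THE S. S \<in> group_vN G \<and>
        (\<forall>\<xi>\<in>ell2_on G. \<forall>\<eta>\<in>ell2_on G. \<forall>\<xi>'\<in>ell2_on G. \<forall>\<eta>'\<in>ell2_on G.
           coeff G \<xi>' \<eta>' = (\<lambda>x. u x * coeff G \<xi> \<eta> x) \<longrightarrow>
           cinner_ell2 (S \<xi>) \<eta> = cinner_ell2 (T \<xi>') \<eta>'))"

text \<open>Operator norm on the \<open>n\<close>-fold Hilbert space sum; entries with an index \<open>\<ge> n\<close> are ignored.\<close>

definition opmat_norm :: "nat \<Rightarrow> (nat \<Rightarrow> nat \<Rightarrow> 'a ell2 \<Rightarrow>\<^sub>L 'a ell2) \<Rightarrow> real" where
  "opmat_norm n T =
     Sup {L2_set (\<lambda>i. norm (\<Sum>j<n. T i j (\<xi> j))) {..<n} | \<xi>. L2_set (\<lambda>j. norm (\<xi> j)) {..<n} \<le> 1}"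

definition amplification_norms :: "('a, 'm) monoid_scheme \<Rightarrow> ('a \<Rightarrow> complex) \<Rightarrow> real set" where
  "amplification_norms G u =
     {opmat_norm n (\<lambda>i j. multiplier_op G u (T i j)) | n T.
        (\<forall>i<n. \<forall>j<n. T i j \<in> group_vN G) \<and> opmat_norm n T \<le> 1}"

definition cb_multipliers :: "('a, 'm) monoid_scheme \<Rightarrow> ('a \<Rightarrow> complex) set" where
  "cb_multipliers G = {u. fourier_multiplier G u \<and> bdd_above (amplification_norms G u)}"

definition cb_multiplier_norm :: "('a, 'm) monoid_scheme \<Rightarrow> ('a \<Rightarrow> complex) \<Rightarrow> real" where
  "cb_multiplier_norm G u = Sup (amplification_norms G u)"

definition ell1_on :: "('a, 'm) monoid_scheme \<Rightarrow> ('a \<Rightarrow> complex) set" where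
  "ell1_on G = {f. (\<forall>x. x \<notin> carrier G \<longrightarrow> f x = 0) \<and> (\<lambda>x. cmod (f x)) summable_on carrier G}"

definition ell1_pairing ::
  "('a, 'm) monoid_scheme \<Rightarrow> ('a \<Rightarrow> complex) \<Rightarrow> ('a \<Rightarrow> complex) \<Rightarrow> complex" where
  "ell1_pairing G f u = (\<Sum>\<^sub>\<infinity>x\<in>carrier G. f x * u x)"

definition Q_norm :: "('a, 'm) monoid_scheme \<Rightarrow> ('a \<Rightarrow> complex) \<Rightarrow> real" where
  "Q_norm G f =
     Sup {cmod (ell1_pairing G f u) | u. u \<in> cb_multipliers G \<and> cb_multiplier_norm G u \<le> 1}"

text \<open>
  Elements of the completion \<open>Q(G)\<close> of \<open>\<ell>\<^sup>1(G)\<close> are represented by Cauchy sequences.  They are not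
  identified when they have the same limit: such sequences have the same pairing with every
  completely bounded multiplier, so the topology below does not change.
\<close>

definition Q_space :: "('a, 'm) monoid_scheme \<Rightarrow> (nat \<Rightarrow> 'a \<Rightarrow> complex) set" where
  "Q_space G =
     {F. (\<forall>n. F n \<in> ell1_on G) \<and>
         (\<forall>\<epsilon>>0. \<exists>N. \<forall>m\<ge>N. \<forall>n\<ge>N. Q_norm G (\<lambda>x. F m x - F n x) < \<epsilon>)}"

definition Q_pairing ::
  "('a, 'm) monoid_scheme \<Rightarrow> (nat \<Rightarrow> 'a \<Rightarrow> complex) \<Rightarrow> ('a \<Rightarrow> complex) \<Rightarrow> complex" where
  "Q_pairing G F u = lim (\<lambda>n. ell1_pairing G (F n) u)"

definition cb_multiplier_topology :: "('a, 'm) monoid_scheme \<Rightarrow> ('a \<Rightarrow> complex) topology" where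
  "cb_multiplier_topology G =
     pullback_topology (cb_multipliers G) (\<lambda>u. \<lambda>F\<in>Q_space G. Q_pairing G F u)
       (product_topology (\<lambda>_. euclidean) (Q_space G))"

definition has_AP :: "('a, 'm) monoid_scheme \<Rightarrow> bool" where
  "has_AP G \<longleftrightarrow>
     indicator (carrier G) \<in> cb_multiplier_topology G closure_of fourier_algebra G"

end

theory Submission
  imports Defs
begin

text \<open>
  Write \<open>K = G \<times> H\<close>.  An operator in the uniform Roe algebra of \<open>K\<close> that is fixed by right
  translations has a matrix \<open>a s t\<close> which depends only on \<open>s t\<inverse>\<close>, and the question is whether it is
  a norm limit of finite combinations of left translations.

  From \<open>K\<close> to \<open>H\<close>: if \<open>T\<close> is an invariant operator in the Roe algebra of \<open>H\<close>, then \<open>1 \<otimes> T\<close> is one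
  for \<open>K\<close>, so it lies in the reduced \<open>C\<^sup>*\<close>-algebra of \<open>K\<close>.  Compression to the functions on
  \<open>{1} \<times> H\<close> maps this algebra to the reduced \<open>C\<^sup>*\<close>-algebra of \<open>H\<close> and recovers \<open>T\<close>
  (\<open>ITAP_right_factor\<close>).

  From \<open>H\<close> to \<open>K\<close>: let \<open>T\<close> be an invariant operator in the Roe algebra of \<open>K\<close>.  For \<open>u\<close> on \<open>G\<close>
  consider the Schur product \<open>M\<^sub>u T\<close>, with entries \<open>u (s\<^sub>1 t\<^sub>1\<inverse>) * a s t\<close>.  If \<open>u\<close> is the indicator
  of a single \<open>g\<close>, then by invariance \<open>M\<^sub>u T = \<lambda>(g) \<otimes> T\<^sub>g\<close>, where \<open>T\<^sub>g\<close> is a block of \<open>T\<close>; this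
  block is an invariant operator in the Roe algebra of \<open>H\<close>, so \<open>M\<^sub>u T\<close> lies in the reduced
  algebra of \<open>K\<close> by the ITAP for \<open>H\<close> (\<open>diagonal_in_reduced_Cstar\<close>).  A coefficient function
  \<open>u\<close> of \<open>(\<xi>, \<eta>)\<close> gives a kernel in Gram form, whence \<open>\<parallel>M\<^sub>u T\<parallel> \<le> \<parallel>\<xi>\<parallel> \<parallel>\<eta>\<parallel> \<parallel>T\<parallel>\<close>
  (\<open>matrix_bound_schur_coeff\<close>), and approximating \<open>\<xi>\<close> and \<open>\<eta>\<close> by finitely supported vectors shows
  that \<open>M\<^sub>u T\<close> lies in the reduced algebra for every \<open>u\<close> in the Fourier algebra
  (\<open>schur_coeff_in_reduced_Cstar\<close>).

  It remains to let \<open>u\<close> tend to \<open>1\<close>.  If \<open>T\<close> were outside the reduced algebra of \<open>K\<close>, the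
  Hahn--Banach theorem would provide a bounded functional \<open>\<Phi>\<close> that vanishes on this algebra but not
  at \<open>T\<close> (\<open>complex_separating_functional\<close>).  Choose banded operators \<open>T\<^sub>n\<close> converging to \<open>T\<close>.
  Since \<open>T\<^sub>n\<close> has finite propagation, \<open>\<Phi> (M\<^sub>u T\<^sub>n)\<close> depends on finitely many values of \<open>u\<close>, hence
  is the pairing of \<open>u\<close> with some finitely supported \<open>F\<^sub>n\<close> on \<open>G\<close>.  A completely bounded multiplier
  satisfies \<open>\<parallel>M\<^sub>u S\<parallel> \<le> \<parallel>u\<parallel>\<^sub>c\<^sub>b \<parallel>S\<parallel>\<close> (\<open>matrix_bound_schur_cb\<close>), so the sequence \<open>F\<close> is Cauchy in the
  norm of \<open>Q(G)\<close>.  The resulting element of \<open>Q(G)\<close> pairs to \<open>\<Phi> T \<noteq> 0\<close> with the constant function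
  \<open>1\<close>, and to \<open>\<Phi> (M\<^sub>u T) = 0\<close> with every \<open>u\<close> in the Fourier algebra.  This contradicts the AP.

  Operators are constructed and estimated throughout by their matrices: \<open>matrix_bound a C\<close> says
  that the matrix \<open>a\<close> has norm at most \<open>C\<close>, tested on finitely supported vectors.
\<close>

section \<open>Separation of a point from a closed subspace\<close>

definition sublinear :: "('a::real_vector \<Rightarrow> real) \<Rightarrow> bool" where
  "sublinear q \<longleftrightarrow> (\<forall>x y. q (x + y) \<le> q x + q y) \<and> (\<forall>r>0. \<forall>x. q (r *\<^sub>R x) = r * q x)"

lemma sublinearI:
  assumes add: "\<And>x y. q (x + y) \<le> q x + q y"
    and scale: "\<And>r x. r > 0 \<Longrightarrow> r * q x \<le> q (r *\<^sub>R x)"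
  shows "sublinear q"
proof -
  have "q (r *\<^sub>R x) = r * q x" if "r > 0" for r x
  proof (rule antisym)
    have "(1 / r) * q (r *\<^sub>R x) \<le> q ((1 / r) *\<^sub>R (r *\<^sub>R x))" using that by (intro scale) simp
    moreover have "(1 / r) *\<^sub>R (r *\<^sub>R x) = x" using that by simp
    ultimately show "q (r *\<^sub>R x) \<le> r * q x" using that by (simp add: field_simps)
  qed (use scale that in blast)
  then show ?thesis using add unfolding sublinear_def by blast
qed

lemma sublinear_zero: "sublinear q \<Longrightarrow> q 0 = 0"
proof -
  assume "sublinear q"
  then have "q ((2::real) *\<^sub>R 0) = 2 * q 0" unfolding sublinear_def by (metis zero_less_numeral)
  then show ?thesis by simp
qed

lemma sublinear_neg: "sublinear q \<Longrightarrow> - q (- x) \<le> q x"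
  using sublinear_zero[of q] unfolding sublinear_def by (metis add.right_inverse minus_le_iff add_le_cancel_left)

text \<open>
  The infimum of \<open>q (y + t z) - t q z\<close> over \<open>t \<ge> 0\<close> is the largest sublinear functional below \<open>q\<close>
  whose value at \<open>- z\<close> does not exceed \<open>- q z\<close>; passing to it makes \<open>q\<close> linear along \<open>z\<close>.  It serves
  twice: a minimal sublinear functional cannot be lowered in this way, hence is linear, and one such
  step ensures that the functional found in the end does not vanish at a prescribed point.
\<close>

lemma sublinear_shift:
  assumes q: "sublinear q"
  shows "\<exists>q'. sublinear q' \<and> (\<forall>y. q' y \<le> q y) \<and> q' (- z) \<le> - q z"
proof -
  have add: "q (x + y) \<le> q x + q y" for x y using q unfolding sublinear_def by blast
  have scale: "q (r *\<^sub>R x) = r * q x" if "r \<ge> 0" for r x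
    using q that sublinear_zero[OF q] unfolding sublinear_def by (cases "r = 0") auto
  define S where "S y = (\<lambda>t. q (y + t *\<^sub>R z) - t * q z) ` {0..}" for y
  define q' where "q' y = Inf (S y)" for y
  have low: "- q (- y) \<le> q (y + t *\<^sub>R z) - t * q z" if "t \<ge> 0" for y t
    using add[of "y + t *\<^sub>R z" "- y"] scale[OF that, of z] by simp
  have ne: "S y \<noteq> {}" for y unfolding S_def by auto
  have bdd: "bdd_below (S y)" for y
    unfolding S_def by (rule bdd_belowI2[of _ "- q (- y)"]) (use low in auto)
  have le: "q' y \<le> q (y + t *\<^sub>R z) - t * q z" if "t \<ge> 0" for y t
    unfolding q'_def by (rule cInf_lower[OF _ bdd]) (use that in \<open>auto simp: S_def\<close>)
  have ge: "c \<le> q' y" if "\<And>t. t \<ge> 0 \<Longrightarrow> c \<le> q (y + t *\<^sub>R z) - t * q z" for c y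
    unfolding q'_def by (rule cInf_greatest[OF ne]) (use that in \<open>auto simp: S_def\<close>)
  have "q' (x + y) \<le> q' x + q' y" for x y
  proof -
    have "q' (x + y) - (q (y + t' *\<^sub>R z) - t' * q z) \<le> q' x" if "t' \<ge> 0" for t'
    proof (rule ge)
      fix t :: real assume "t \<ge> 0"
      have "q' (x + y) \<le> q (x + y + (t + t') *\<^sub>R z) - (t + t') * q z"
        by (rule le) (use \<open>t \<ge> 0\<close> that in auto)
      moreover have "x + y + (t + t') *\<^sub>R z = (x + t *\<^sub>R z) + (y + t' *\<^sub>R z)"
        by (simp add: algebra_simps)
      ultimately show "q' (x + y) - (q (y + t' *\<^sub>R z) - t' * q z) \<le> q (x + t *\<^sub>R z) - t * q z"
        using add[of "x + t *\<^sub>R z" "y + t' *\<^sub>R z"] by (simp add: algebra_simps)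
    qed
    then have "q' (x + y) - q' x \<le> q' y"
      by (intro ge) (smt (verit))
    then show ?thesis by simp
  qed
  moreover have "r * q' x \<le> q' (r *\<^sub>R x)" if "r > 0" for r x
  proof (rule ge)
    fix t :: real assume "t \<ge> 0"
    have "r * q' x \<le> r * (q (x + (t / r) *\<^sub>R z) - t / r * q z)"
      by (rule mult_left_mono[OF le]) (use \<open>t \<ge> 0\<close> \<open>r > 0\<close> in auto)
    also have "\<dots> = q (r *\<^sub>R (x + (t / r) *\<^sub>R z)) - t * q z"
      using \<open>r > 0\<close> scale[of r "x + (t / r) *\<^sub>R z"] by (simp add: right_diff_distrib)
    finally show "r * q' x \<le> q (r *\<^sub>R x + t *\<^sub>R z) - t * q z"
      using \<open>r > 0\<close> by (simp add: scaleR_add_right)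
  qed
  ultimately have "sublinear q'" by (intro sublinearI) auto
  moreover have "q' y \<le> q y" for y using le[of 0 y] by simp
  moreover have "q' (- z) \<le> - q z" using le[of 1 "- z"] sublinear_zero[OF q] by simp
  ultimately show ?thesis by blast
qed

text \<open>
  The analytic Hahn--Banach theorem.  By Zorn's lemma there is a minimal sublinear functional
  below \<open>p\<close>, and minimality forces linearity.
\<close>

lemma linear_minorant:
  assumes p: "sublinear p"
  shows "\<exists>f. linear f \<and> (\<forall>x. f x \<le> p x)"
proof -
  define A where "A = {q. sublinear q \<and> (\<forall>x. q x \<le> p x)}"
  define P where "P q r \<longleftrightarrow> (\<forall>x. r x \<le> q x)" for q r :: "'a \<Rightarrow> real"
  have "\<exists>m\<in>A. \<forall>a\<in>A. P m a \<longrightarrow> a = m"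
  proof (rule predicate_Zorn)
    show "partial_order_on A (relation_of P A)"
      by (rule partial_order_on_relation_ofI)
        (auto simp: P_def intro: order_trans intro!: ext antisym)
  next
    fix C assume C: "C \<in> Chains (relation_of P A)"
    then have CA: "C \<subseteq> A" and tot: "\<And>q r. q \<in> C \<Longrightarrow> r \<in> C \<Longrightarrow> P q r \<or> P r q"
      unfolding Chains_def relation_of_def by auto
    show "\<exists>u\<in>A. \<forall>a\<in>C. P a u"
    proof (cases "C = {}")
      case True
      then show ?thesis using p unfolding A_def by auto
    next
      case False
      \<comment> \<open>The pointwise infimum of the chain; it is subadditive because any two members of the chain
        lie above a common one.\<close>
      define u where "u x = Inf ((\<lambda>q. q x) ` C)" for x
      have sub: "sublinear q" if "q \<in> C" for q using CA that unfolding A_def by blast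
      have bdd: "bdd_below ((\<lambda>q. q x) ` C)" for x
      proof (rule bdd_belowI2)
        fix q assume "q \<in> C"
        then have "sublinear q" "q (- x) \<le> p (- x)" using CA unfolding A_def by auto
        then show "- p (- x) \<le> q x" using sublinear_neg[of q x] by linarith
      qed
      have le: "u x \<le> q x" if "q \<in> C" for q x
        unfolding u_def by (rule cInf_lower[OF _ bdd]) (use that in auto)
      have ge: "c \<le> u x" if "\<And>q. q \<in> C \<Longrightarrow> c \<le> q x" for c x
        unfolding u_def by (rule cInf_greatest) (use False that in auto)
      have "u (x + y) \<le> u x + u y" for x y
      proof -
        have "u (x + y) - r y \<le> u x" if r: "r \<in> C" for r
        proof (rule ge)
          fix q assume q: "q \<in> C"
          obtain w where w: "w \<in> C" "\<And>z. w z \<le> q z" "\<And>z. w z \<le> r z"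
            using tot[OF q r] q r unfolding P_def by blast
          have "u (x + y) \<le> w x + w y"
            using le[OF w(1), of "x + y"] sub[OF w(1)] unfolding sublinear_def by (meson order_trans)
          then show "u (x + y) - r y \<le> q x" using w(2)[of x] w(3)[of y] by linarith
        qed
        then have "u (x + y) - u x \<le> u y" by (intro ge) (smt (verit))
        then show ?thesis by simp
      qed
      moreover have "r * u x \<le> u (r *\<^sub>R x)" if "r > 0" for r x
      proof (rule ge)
        fix q assume q: "q \<in> C"
        have "r * u x \<le> r * q x" using le[OF q, of x] that by simp
        then show "r * u x \<le> q (r *\<^sub>R x)" using sub[OF q] that unfolding sublinear_def by simp
      qed
      ultimately have "sublinear u" by (intro sublinearI) auto
      moreover have "u x \<le> p x" for x
        using False le[of _ x] CA unfolding A_def by (metis (mono_tags, lifting) all_not_in_conv mem_Collect_eq order_trans subsetD)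
      ultimately show ?thesis using le unfolding A_def P_def by auto
    qed
  qed
  then obtain m where mA: "m \<in> A" and min: "\<And>a. a \<in> A \<Longrightarrow> (\<And>x. a x \<le> m x) \<Longrightarrow> a = m"
    unfolding P_def by blast
  have m: "sublinear m" "\<And>x. m x \<le> p x" using mA unfolding A_def by auto
  have neg: "m (- z) = - m z" for z
  proof -
    obtain q where q: "sublinear q" "\<And>y. q y \<le> m y" "q (- z) \<le> - m z"
      using sublinear_shift[OF m(1), of z] by blast
    have "q \<in> A" using q(1,2) m(2) unfolding A_def by (auto intro: order_trans)
    then have "q = m" using min q(2) by blast
    then show ?thesis using q(3) sublinear_neg[OF m(1), of z] by simp
  qed
  have add: "m (x + y) \<le> m x + m y" for x y using m(1) unfolding sublinear_def by blast
  have "linear m"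
  proof (rule linearI)
    fix x y :: 'a and r :: real
    show "m (x + y) = m x + m y"
      using add[of x y] add[of "x + y" "- y"] neg[of y] by simp
    have pos: "m (r *\<^sub>R x) = r * m x" if "r > 0" for r x using m(1) that unfolding sublinear_def by blast
    show "m (r *\<^sub>R x) = r *\<^sub>R m x"
    proof (cases r "0::real" rule: linorder_cases)
      case less
      then show ?thesis using pos[of "- r" x] neg[of "r *\<^sub>R x"] by simp
    next
      case equal
      then show ?thesis using sublinear_zero[OF m(1)] by simp
    next
      case greater
      then show ?thesis using pos by simp
    qed
  qed
  then show ?thesis using m(2) by blast
qed

text \<open>
  The distance to \<open>C\<close> is sublinear, and a linear functional below it vanishes on the subspace \<open>C\<close>
  and is bounded by the norm.
\<close>

lemma separating_functional:
  fixes C :: "'a::real_normed_vector set"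
  assumes C: "subspace C" "closed C" and x: "x \<notin> C"
  shows "\<exists>f. bounded_linear f \<and> (\<forall>y\<in>C. f y = (0::real)) \<and> f x \<noteq> 0"
proof -
  define p where "p y = infdist y C" for y
  have ne: "C \<noteq> {}" using C(1) subspace_0 by blast
  have p_le: "p y \<le> norm (y - c)" if "c \<in> C" for y c
    unfolding p_def using infdist_le[OF that, of y] by (simp add: dist_norm)
  have p_ge: "b \<le> p y" if "\<And>c. c \<in> C \<Longrightarrow> b \<le> norm (y - c)" for b y
    unfolding p_def infdist_notempty[OF ne]
    by (rule cINF_greatest[OF ne]) (use that in \<open>simp add: dist_norm\<close>)
  have "p (y + z) \<le> p y + p z" for y z
  proof -
    have "p (y + z) - norm (z - d) \<le> p y" if "d \<in> C" for d
    proof (rule p_ge)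
      fix c assume "c \<in> C"
      have "p (y + z) \<le> norm ((y - c) + (z - d))"
        using p_le[OF subspace_add[OF C(1) \<open>c \<in> C\<close> \<open>d \<in> C\<close>], of "y + z"] by (simp add: algebra_simps)
      then show "p (y + z) - norm (z - d) \<le> norm (y - c)"
        using norm_triangle_ineq[of "y - c" "z - d"] by linarith
    qed
    then have "p (y + z) - p y \<le> p z" by (intro p_ge) (smt (verit))
    then show ?thesis by simp
  qed
  moreover have "r * p y \<le> p (r *\<^sub>R y)" if "r > 0" for r y
  proof (rule p_ge)
    fix c assume "c \<in> C"
    have "r * p y \<le> r * norm (y - (1 / r) *\<^sub>R c)"
      using p_le[OF subspace_scale[OF C(1) \<open>c \<in> C\<close>], of y "1 / r"] that by simp
    also have "\<dots> = norm (r *\<^sub>R (y - (1 / r) *\<^sub>R c))" using that by simp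
    also have "r *\<^sub>R (y - (1 / r) *\<^sub>R c) = r *\<^sub>R y - c" using that by (simp add: scaleR_diff_right)
    finally show "r * p y \<le> norm (r *\<^sub>R y - c)" .
  qed
  ultimately have "sublinear p" by (intro sublinearI) auto
  then obtain q where q: "sublinear q" "\<And>y. q y \<le> p y" "q (- x) \<le> - p x"
    using sublinear_shift[of p x] by blast
  then obtain f where f: "linear f" "\<And>y. f y \<le> q y" using linear_minorant by blast
  have fp: "f y \<le> p y" for y using f(2)[of y] q(2)[of y] by linarith
  have neg: "f (- y) = - f y" for y using f(1) by (rule linear_neg)
  have "\<bar>f y\<bar> \<le> norm y" for y
    using fp[of y] fp[of "- y"] p_le[OF subspace_0[OF C(1)], of y] p_le[OF subspace_0[OF C(1)], of "- y"]
      neg[of y] by simp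
  then have "bounded_linear f"
    using f(1) by (auto intro!: bounded_linear.intro bounded_linear_axioms.intro exI[of _ 1])
  moreover have "f y = 0" if "y \<in> C" for y
  proof -
    have "p y \<le> 0" "p (- y) \<le> 0" using p_le[OF that, of y] p_le[OF subspace_neg[OF C(1) that], of "- y"] by auto
    then show ?thesis using fp[of y] fp[of "- y"] neg[of y] by linarith
  qed
  moreover have "f x \<noteq> 0"
  proof -
    have "p x > 0" unfolding p_def using infdist_pos_not_in_closed[OF C(2) ne x] .
    then show ?thesis using f(2)[of "- x"] q(3) neg[of x] by linarith
  qed
  ultimately show ?thesis by blast
qed

section \<open>Truncation and norms in \<open>\<ell>\<^sup>2\<close>\<close>

lemma infsum_norm_le:
  fixes f :: "'a \<Rightarrow> 'b::real_normed_vector"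
  assumes "f summable_on A" and "\<And>F. finite F \<Longrightarrow> F \<subseteq> A \<Longrightarrow> norm (sum f F) \<le> B"
  shows "norm (infsum f A) \<le> B"
proof -
  have "((\<lambda>F. norm (sum f F)) \<longlongrightarrow> norm (infsum f A)) (finite_subsets_at_top A)"
    by (intro tendsto_norm infsum_tendsto assms)
  moreover have "eventually (\<lambda>F. norm (sum f F) \<le> B) (finite_subsets_at_top A)"
    using assms(2) by (intro eventually_finite_subsets_at_top_weakI) auto
  ultimately show ?thesis by (rule tendsto_upperbound) simp
qed

lemma has_sum_finite_sum:
  fixes f :: "'i \<Rightarrow> 'a \<Rightarrow> 'b::topological_comm_monoid_add"
  assumes "finite I" "\<And>i. i \<in> I \<Longrightarrow> (f i has_sum s i) A"
  shows "((\<lambda>x. \<Sum>i\<in>I. f i x) has_sum (\<Sum>i\<in>I. s i)) A"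
  using assms by (induction I rule: finite_induct) (auto intro: has_sum_add has_sum_0)

lemma L2_set_power2: "(L2_set f F)\<^sup>2 = (\<Sum>i\<in>F. (f i)\<^sup>2)"
  by (simp add: L2_set_def sum_nonneg)

lemma L2_set_le_iff: "B \<ge> 0 \<Longrightarrow> L2_set f F \<le> B \<longleftrightarrow> (\<Sum>i\<in>F. (f i)\<^sup>2) \<le> B\<^sup>2" for B :: real
  unfolding L2_set_power2[symmetric] by (simp add: power_mono_iff)

lemma L2_set_subset: "finite F \<Longrightarrow> E \<subseteq> F \<Longrightarrow> L2_set f E \<le> L2_set f F"
  unfolding L2_set_def by (intro real_sqrt_le_mono sum_mono2) auto

lemma L2_set_reindex: "inj_on h A \<Longrightarrow> L2_set f (h ` A) = L2_set (\<lambda>x. f (h x)) A"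
  by (simp add: L2_set_def sum.reindex)

lemma L2_set_neutral:
  assumes "finite F" "E \<subseteq> F" "\<And>i. i \<in> F - E \<Longrightarrow> f i = 0"
  shows "L2_set f F = L2_set f E"
  unfolding L2_set_def using assms by (intro arg_cong[of _ _ sqrt] sum.mono_neutral_right) auto

lemma cmod_sum_le_L2: "cmod (\<Sum>i\<in>F. f i * g i) \<le> L2_set (\<lambda>i. cmod (f i)) F * L2_set (\<lambda>i. cmod (g i)) F"
proof -
  have "cmod (\<Sum>i\<in>F. f i * g i) \<le> (\<Sum>i\<in>F. \<bar>cmod (f i)\<bar> * \<bar>cmod (g i)\<bar>)"
    by (rule order_trans[OF norm_sum]) (simp add: norm_mult)
  also have "\<dots> \<le> L2_set (\<lambda>i. cmod (f i)) F * L2_set (\<lambda>i. cmod (g i)) F" by (rule L2_set_mult_ineq)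
  finally show ?thesis .
qed

text \<open>
  Testing against \<open>d = cnj \<circ> y\<close> turns a bound for the functional into a bound for the norm.
\<close>

lemma L2_set_dual:
  assumes B: "B \<ge> 0"
    and le: "\<And>d. cmod (\<Sum>s\<in>F. y s * d s) \<le> B * L2_set (\<lambda>s. cmod (d s)) F"
  shows "L2_set (\<lambda>s. cmod (y s)) F \<le> B"
proof -
  let ?L = "L2_set (\<lambda>s. cmod (y s)) F"
  have "(\<Sum>s\<in>F. y s * cnj (y s)) = complex_of_real (?L\<^sup>2)"
    by (simp add: L2_set_power2 complex_norm_square del: of_real_power)
  then have "?L * ?L \<le> B * ?L" using le[of "\<lambda>s. cnj (y s)"] by (simp add: power2_eq_square norm_mult)
  moreover have "?L = 0 \<or> ?L > 0" using L2_set_nonneg[of "\<lambda>s. cmod (y s)" F] by linarith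
  ultimately show ?thesis using B by (metis mult_right_le_imp_le)
qed

lemma norm_ell2_power2: "(norm x)\<^sup>2 = (\<Sum>\<^sub>\<infinity>s. (cmod (coord x s))\<^sup>2)" for x :: "'a ell2"
  by (simp add: norm_ell2_def infsum_nonneg)

lemma L2_set_coord_le: "L2_set (\<lambda>s. cmod (coord x s)) F \<le> norm x"
proof (cases "finite F")
  case True
  show ?thesis
    by (subst L2_set_le_iff) (auto simp: norm_ell2_power2 True intro!: finite_sum_le_infsum coord_summable)
qed simp

lemma norm_coord_le: "cmod (coord x s) \<le> norm x"
  using L2_set_coord_le[of x "{s}"] by simp

lemma ell2_of_function:
  assumes "\<And>F. finite F \<Longrightarrow> L2_set (\<lambda>s. cmod (f s)) F \<le> B"
  shows "\<exists>x. coord x = f \<and> norm x \<le> B"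
proof -
  have B: "B \<ge> 0" using assms[of "{}"] by simp
  have *: "(\<Sum>s\<in>F. (cmod (f s))\<^sup>2) \<le> B\<^sup>2" if "finite F" for F
    using assms[OF that] by (simp add: L2_set_le_iff[OF B])
  have sm: "(\<lambda>s. (cmod (f s))\<^sup>2) summable_on UNIV"
    by (rule nonneg_bdd_above_summable_on) (use * in \<open>auto intro!: bdd_aboveI2[of _ _ "B\<^sup>2"]\<close>)
  then obtain x where x: "coord x = f" using Abs_ell2_inverse[of f] by blast
  have "(\<Sum>\<^sub>\<infinity>s. (cmod (f s))\<^sup>2) \<le> B\<^sup>2" by (rule infsum_le_finite_sums[OF sm]) (use * in auto)
  then have "(norm x)\<^sup>2 \<le> B\<^sup>2" by (simp add: norm_ell2_power2 x)
  then show ?thesis using x B by (auto simp: power_mono_iff)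
qed

lemma linear_coord: "linear (\<lambda>x. coord x s)"
  by (rule linearI) (simp_all add: plus_ell2.rep_eq scaleR_ell2.rep_eq)

lemma bounded_linear_coord: "bounded_linear (\<lambda>x. coord x s)"
  using linear_coord norm_coord_le
  by (intro bounded_linear.intro bounded_linear_axioms.intro exI[of _ 1]) auto

lemma coord_sum: "coord (sum f A) s = (\<Sum>a\<in>A. coord (f a) s)"
  by (rule linear_sum[OF linear_coord])

lemmas coord_simps = plus_ell2.rep_eq minus_ell2.rep_eq uminus_ell2.rep_eq zero_ell2.rep_eq
  scaleR_ell2.rep_eq scaleC_ell2.rep_eq coord_sum

lift_definition ket :: "'a \<Rightarrow> 'a ell2" is "\<lambda>t s. if s = t then 1 else 0"
proof -
  fix t :: 'a
  show "(\<lambda>s. (cmod (if s = t then 1 else 0))\<^sup>2) summable_on UNIV"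
    by (rule finite_nonzero_values_imp_summable_on) simp
qed

lemma norm_scaleC_ell2: "norm (scaleC_ell2 c x) = cmod c * norm x"
  by (simp add: norm_ell2_def scaleC_ell2.rep_eq norm_mult power_mult_distrib infsum_cmult_right' real_sqrt_mult)

lemma norm_finite_support:
  assumes "finite F" "\<And>s. s \<notin> F \<Longrightarrow> coord x s = 0"
  shows "norm x = L2_set (\<lambda>s. cmod (coord x s)) F"
proof -
  have "(\<Sum>\<^sub>\<infinity>s. (cmod (coord x s))\<^sup>2) = (\<Sum>\<^sub>\<infinity>s\<in>F. (cmod (coord x s))\<^sup>2)"
    by (rule infsum_cong_neutral) (use assms in auto)
  then show ?thesis using assms(1) by (simp add: norm_ell2_def L2_set_def)
qed

definition trunc :: "'a set \<Rightarrow> 'a ell2 \<Rightarrow> 'a ell2" where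
  "trunc F x = (\<Sum>t\<in>F. scaleC_ell2 (coord x t) (ket t))"

lemma coord_trunc: "finite F \<Longrightarrow> coord (trunc F x) s = (if s \<in> F then coord x s else 0)"
  by (simp add: trunc_def coord_simps ket.rep_eq if_distrib cong: if_cong)

text \<open>
  The square of the norm of the tail is the total of \<open>(cmod (coord x s))\<^sup>2\<close> minus a partial sum.
\<close>

lemma trunc_tendsto: "((\<lambda>F. trunc F x) \<longlongrightarrow> x) (finite_subsets_at_top UNIV)"
proof -
  let ?n = "\<lambda>s. (cmod (coord x s))\<^sup>2"
  have eq: "norm (trunc F x - x) = sqrt (infsum ?n UNIV - sum ?n F)" if "finite F" for F
  proof -
    have "(\<Sum>\<^sub>\<infinity>s. (cmod (coord (trunc F x - x) s))\<^sup>2)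
        = (\<Sum>\<^sub>\<infinity>s. ?n s - (if s \<in> F then ?n s else 0))"
      by (intro infsum_cong) (auto simp: coord_simps coord_trunc[OF that])
    also have "\<dots> = infsum ?n UNIV - (\<Sum>\<^sub>\<infinity>s. if s \<in> F then ?n s else 0)"
      unfolding diff_conv_add_uminus
      by (intro infsumI has_sum_add has_sum_uminusI has_sum_infsum coord_summable
          finite_nonzero_values_imp_summable_on finite_subset[OF _ that]) auto
    also have "(\<Sum>\<^sub>\<infinity>s. if s \<in> F then ?n s else 0) = infsum ?n F"
      by (rule infsum_cong_neutral) auto
    finally show ?thesis using that by (simp add: norm_ell2_def)
  qed
  have "((\<lambda>F. sqrt (infsum ?n UNIV - sum ?n F)) \<longlongrightarrow> sqrt (infsum ?n UNIV - infsum ?n UNIV))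
      (finite_subsets_at_top UNIV)"
    by (intro tendsto_intros infsum_tendsto coord_summable)
  then have "((\<lambda>F. sqrt (infsum ?n UNIV - sum ?n F)) \<longlongrightarrow> 0) (finite_subsets_at_top UNIV)"
    by simp
  then have "((\<lambda>F. norm (trunc F x - x)) \<longlongrightarrow> 0) (finite_subsets_at_top UNIV)"
    by (rule Lim_transform_eventually)
      (use eq in \<open>auto intro!: eventually_finite_subsets_at_top_weakI\<close>)
  then show ?thesis by (simp add: tendsto_norm_zero_iff LIM_zero_iff)
qed

section \<open>Bounded operators and their matrices\<close>

text \<open>
  The elements of the type of bounded operators are real-linear maps, and a matrix determines
  only a complex-linear one.
\<close>

definition complex_linear :: "('a ell2 \<Rightarrow>\<^sub>L 'b ell2) \<Rightarrow> bool" where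
  "complex_linear T \<longleftrightarrow> (\<forall>c \<xi>. T (scaleC_ell2 c \<xi>) = scaleC_ell2 c (T \<xi>))"

definition entry :: "('a ell2 \<Rightarrow>\<^sub>L 'b ell2) \<Rightarrow> 'b \<Rightarrow> 'a \<Rightarrow> complex" where
  "entry T s t = coord (T (ket t)) s"

text \<open>
  The estimate \<open>\<bar>\<langle>a c, d\<rangle>\<bar> \<le> C \<parallel>c\<parallel> \<parallel>d\<parallel>\<close> for finitely supported \<open>c\<close> and \<open>d\<close>.  The vector \<open>d\<close> enters without
  conjugation, which does not affect its norm.
\<close>

definition matrix_bound :: "('b \<Rightarrow> 'a \<Rightarrow> complex) \<Rightarrow> real \<Rightarrow> bool" where
  "matrix_bound a C \<longleftrightarrow> (\<forall>E F c d. finite E \<longrightarrow> finite F \<longrightarrow>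
     cmod (\<Sum>s\<in>F. \<Sum>t\<in>E. a s t * c t * d s)
       \<le> C * L2_set (\<lambda>t. cmod (c t)) E * L2_set (\<lambda>s. cmod (d s)) F)"

lemma matrix_boundD:
  "matrix_bound a C \<Longrightarrow> finite E \<Longrightarrow> finite F \<Longrightarrow>
     cmod (\<Sum>s\<in>F. \<Sum>t\<in>E. a s t * c t * d s)
       \<le> C * L2_set (\<lambda>t. cmod (c t)) E * L2_set (\<lambda>s. cmod (d s)) F"
  unfolding matrix_bound_def by blast

lemma matrix_bound_nonneg: "matrix_bound a C \<Longrightarrow> C \<ge> 0"
proof -
  fix s t assume "matrix_bound a C"
  from matrix_boundD[OF this, of "{t}" "{s}" "\<lambda>_. 1" "\<lambda>_. 1"] have "cmod (a s t) \<le> C" by simp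
  then show "C \<ge> 0" by (meson norm_ge_zero order_trans)
qed

lemma matrix_bound_entry: "matrix_bound a C \<Longrightarrow> cmod (a s t) \<le> C"
  using matrix_boundD[of a C "{t}" "{s}" "\<lambda>_. 1" "\<lambda>_. 1"] by simp

lemma matrix_bound_mono: "matrix_bound a C \<Longrightarrow> C \<le> D \<Longrightarrow> matrix_bound a D"
  unfolding matrix_bound_def by (meson L2_set_nonneg mult_right_mono order_trans)

lemma matrix_bound_L2D:
  assumes "matrix_bound a C" "finite E" "finite F"
  shows "L2_set (\<lambda>s. cmod (\<Sum>t\<in>E. a s t * c t)) F \<le> C * L2_set (\<lambda>t. cmod (c t)) E"
proof (rule L2_set_dual)
  show "0 \<le> C * L2_set (\<lambda>t. cmod (c t)) E" using matrix_bound_nonneg[OF assms(1)] by simp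
  show "cmod (\<Sum>s\<in>F. (\<Sum>t\<in>E. a s t * c t) * d s)
      \<le> C * L2_set (\<lambda>t. cmod (c t)) E * L2_set (\<lambda>s. cmod (d s)) F" for d
    using matrix_boundD[OF assms, of c d] by (simp add: sum_distrib_right)
qed

lemma matrix_bound_L2I:
  fixes a :: "'b \<Rightarrow> 'a \<Rightarrow> complex"
  assumes "\<And>E F c. finite E \<Longrightarrow> finite F \<Longrightarrow>
      L2_set (\<lambda>s. cmod (\<Sum>t\<in>E. a s t * c t)) F \<le> C * L2_set (\<lambda>t. cmod (c t)) E"
  shows "matrix_bound a C"
  unfolding matrix_bound_def
proof (intro allI impI)
  fix E :: "'a set" and F :: "'b set" and c :: "'a \<Rightarrow> complex" and d :: "'b \<Rightarrow> complex"
  assume fin: "finite E" "finite F"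
  have "cmod (\<Sum>s\<in>F. \<Sum>t\<in>E. a s t * c t * d s) = cmod (\<Sum>s\<in>F. (\<Sum>t\<in>E. a s t * c t) * d s)"
    by (simp add: sum_distrib_right)
  also have "\<dots> \<le> L2_set (\<lambda>s. cmod (\<Sum>t\<in>E. a s t * c t)) F * L2_set (\<lambda>s. cmod (d s)) F"
    by (rule cmod_sum_le_L2)
  also have "\<dots> \<le> C * L2_set (\<lambda>t. cmod (c t)) E * L2_set (\<lambda>s. cmod (d s)) F"
    by (intro mult_right_mono assms fin) simp
  finally show "cmod (\<Sum>s\<in>F. \<Sum>t\<in>E. a s t * c t * d s)
      \<le> C * L2_set (\<lambda>t. cmod (c t)) E * L2_set (\<lambda>s. cmod (d s)) F" .
qed

text \<open>
  Vectors extend by zero, so the estimate has to be checked only on arbitrarily large finite sets of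
  a convenient form.
\<close>

lemma matrix_bound_cofinal:
  fixes a :: "'b \<Rightarrow> 'a \<Rightarrow> complex"
  assumes "\<And>E F. finite E \<Longrightarrow> finite F \<Longrightarrow> \<exists>E' F'. finite E' \<and> finite F' \<and> E \<subseteq> E' \<and> F \<subseteq> F' \<and>
    (\<forall>c d. cmod (\<Sum>s\<in>F'. \<Sum>t\<in>E'. a s t * c t * d s)
       \<le> C * L2_set (\<lambda>t. cmod (c t)) E' * L2_set (\<lambda>s. cmod (d s)) F')"
  shows "matrix_bound a C"
  unfolding matrix_bound_def
proof (intro allI impI)
  fix E :: "'a set" and F :: "'b set" and c :: "'a \<Rightarrow> complex" and d :: "'b \<Rightarrow> complex"
  assume EF: "finite E" "finite F"
  obtain E' F' where fin: "finite E'" "finite F'" and sub: "E \<subseteq> E'" "F \<subseteq> F'"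
    and le: "\<And>c d. cmod (\<Sum>s\<in>F'. \<Sum>t\<in>E'. a s t * c t * d s)
       \<le> C * L2_set (\<lambda>t. cmod (c t)) E' * L2_set (\<lambda>s. cmod (d s)) F'"
    using assms[OF EF] by blast
  define c' where "c' t = (if t \<in> E then c t else 0)" for t
  define d' where "d' s = (if s \<in> F then d s else 0)" for s
  have "(\<Sum>s\<in>F'. \<Sum>t\<in>E'. a s t * c' t * d' s) = (\<Sum>s\<in>F. \<Sum>t\<in>E'. a s t * c' t * d' s)"
    by (rule sum.mono_neutral_right) (use fin sub in \<open>auto simp: d'_def\<close>)
  also have "\<dots> = (\<Sum>s\<in>F. \<Sum>t\<in>E. a s t * c' t * d' s)"
    by (intro sum.cong sum.mono_neutral_right) (use fin sub in \<open>auto simp: c'_def\<close>)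
  also have "\<dots> = (\<Sum>s\<in>F. \<Sum>t\<in>E. a s t * c t * d s)"
    by (intro sum.cong) (auto simp: c'_def d'_def)
  finally have eq: "(\<Sum>s\<in>F'. \<Sum>t\<in>E'. a s t * c' t * d' s) = (\<Sum>s\<in>F. \<Sum>t\<in>E. a s t * c t * d s)" .
  have "L2_set (\<lambda>t. cmod (c' t)) E' = L2_set (\<lambda>t. cmod (c' t)) E"
    by (rule L2_set_neutral) (use fin sub in \<open>auto simp: c'_def\<close>)
  moreover have "\<dots> = L2_set (\<lambda>t. cmod (c t)) E" by (rule L2_set_cong) (auto simp: c'_def)
  moreover have "L2_set (\<lambda>s. cmod (d' s)) F' = L2_set (\<lambda>s. cmod (d' s)) F"
    by (rule L2_set_neutral) (use fin sub in \<open>auto simp: d'_def\<close>)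
  moreover have "\<dots> = L2_set (\<lambda>s. cmod (d s)) F" by (rule L2_set_cong) (auto simp: d'_def)
  ultimately show "cmod (\<Sum>s\<in>F. \<Sum>t\<in>E. a s t * c t * d s)
      \<le> C * L2_set (\<lambda>t. cmod (c t)) E * L2_set (\<lambda>s. cmod (d s)) F"
    using le[of c' d'] eq by simp
qed

lemma complex_linear_algebra [simp]:
  "complex_linear 0" "complex_linear T \<Longrightarrow> complex_linear S \<Longrightarrow> complex_linear (T + S)" "complex_linear T \<Longrightarrow> complex_linear S \<Longrightarrow> complex_linear (T - S)"
  "complex_linear (scalar_op c)"
  unfolding complex_linear_def
  by (auto intro!: ell2_eqI simp: blinfun.add_left blinfun.diff_left coord_simps algebra_simps
      scalar_op.rep_eq)

lemma complex_linear_compose: "complex_linear T \<Longrightarrow> complex_linear S \<Longrightarrow> complex_linear (T o\<^sub>L S)"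
  unfolding complex_linear_def by simp

lemma complex_linear_sum: "(\<And>i. i \<in> A \<Longrightarrow> complex_linear (T i)) \<Longrightarrow> complex_linear (\<Sum>i\<in>A. T i)"
  by (induction A rule: infinite_finite_induct) auto

lemma entry_add [simp]: "entry (T + S) s t = entry T s t + entry S s t"
  and entry_diff [simp]: "entry (T - S) s t = entry T s t - entry S s t"
  and entry_zero [simp]: "entry 0 s t = 0"
  and entry_scalar [simp]: "entry (scalar_op c o\<^sub>L T) s t = c * entry T s t"
  by (simp_all add: entry_def blinfun.add_left blinfun.diff_left coord_simps scalar_op.rep_eq)

lemma entry_sum [simp]: "entry (\<Sum>i\<in>A. T i) s t = (\<Sum>i\<in>A. entry (T i) s t)"
  by (induction A rule: infinite_finite_induct) auto

lemma complex_linear_has_sum: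
  assumes "complex_linear T"
  shows "((\<lambda>t. entry T s t * coord \<xi> t) has_sum coord (T \<xi>) s) UNIV"
proof -
  have bl: "bounded_linear (\<lambda>x. coord (T x) s)"
    using bounded_linear_compose[OF bounded_linear_coord blinfun.bounded_linear_right] .
  have eq: "coord (T (trunc F \<xi>)) s = (\<Sum>t\<in>F. entry T s t * coord \<xi> t)" for F
    using assms by (simp add: trunc_def blinfun.sum_right coord_simps complex_linear_def entry_def mult.commute)
  have "((\<lambda>F. coord (T (trunc F \<xi>)) s) \<longlongrightarrow> coord (T \<xi>) s) (finite_subsets_at_top UNIV)"
    by (rule bounded_linear.tendsto[OF bl trunc_tendsto])
  then show ?thesis unfolding has_sum_def by (simp add: eq)
qed

lemma complex_linear_apply: "complex_linear T \<Longrightarrow> coord (T \<xi>) s = (\<Sum>\<^sub>\<infinity>t. entry T s t * coord \<xi> t)"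
  using complex_linear_has_sum infsumI by metis

lemma complex_linear_eqI:
  assumes "complex_linear T" "complex_linear S" "\<And>s t. entry T s t = entry S s t"
  shows "T = S"
  by (intro blinfun_eqI ell2_eqI) (simp add: complex_linear_apply assms)

lemma matrix_bound_entries:
  fixes T :: "'a ell2 \<Rightarrow>\<^sub>L 'b ell2"
  assumes "complex_linear T"
  shows "matrix_bound (entry T) (norm T)"
proof (rule matrix_bound_L2I)
  fix E F and c :: "'a \<Rightarrow> complex" assume fin: "finite (E :: 'a set)" "finite (F :: 'b set)"
  define \<xi> where "\<xi> = (\<Sum>t\<in>E. scaleC_ell2 (c t) (ket t))"
  have \<xi>: "coord \<xi> t = (if t \<in> E then c t else 0)" for t
    using fin(1) by (simp add: \<xi>_def coord_simps ket.rep_eq if_distrib cong: if_cong)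
  have "coord (T \<xi>) s = (\<Sum>t\<in>E. entry T s t * c t)" for s
    using assms by (simp add: \<xi>_def blinfun.sum_right coord_simps complex_linear_def entry_def mult.commute)
  then have "L2_set (\<lambda>s. cmod (\<Sum>t\<in>E. entry T s t * c t)) F \<le> norm (T \<xi>)"
    using L2_set_coord_le[of "T \<xi>" F] by simp
  also have "\<dots> \<le> norm T * norm \<xi>" by (rule norm_blinfun)
  also have "norm \<xi> = L2_set (\<lambda>t. cmod (c t)) E"
    by (subst norm_finite_support[OF fin(1)]) (auto simp: \<xi> intro!: L2_set_cong)
  finally show "L2_set (\<lambda>s. cmod (\<Sum>t\<in>E. entry T s t * c t)) F \<le> norm T * L2_set (\<lambda>t. cmod (c t)) E" .
qed

text \<open>
  Every row of \<open>a\<close> is square summable, so the matrix acts by absolutely convergent series; the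
  estimate passes from finite sums to these series.  Together with the converse
  \<open>matrix_bound_entries\<close> this identifies complex-linear bounded operators with bounded matrices.
\<close>

lemma operator_of_matrix_bound:
  fixes a :: "'a \<Rightarrow> 'b \<Rightarrow> complex"
  assumes a: "matrix_bound a C"
  shows "\<exists>T. complex_linear T \<and> entry T = a \<and> norm T \<le> C"
proof -
  have C: "C \<ge> 0" using matrix_bound_nonneg[OF a] .
  have row: "\<exists>x. coord x = a s \<and> norm x \<le> C" for s
  proof (rule ell2_of_function)
    fix E :: "'b set" assume "finite E"
    show "L2_set (\<lambda>t. cmod (a s t)) E \<le> C"
      by (rule L2_set_dual[OF C]) (use matrix_boundD[OF a \<open>finite E\<close>, of "{s}" _ "\<lambda>_. 1"] in simp)
  qed
  have sm: "(\<lambda>t. a s t * coord \<xi> t) summable_on UNIV" for s \<xi>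
  proof (rule abs_summable_summable)
    obtain x where "coord x = a s" using row by blast
    then show "(\<lambda>t. norm (a s t * coord \<xi> t)) summable_on UNIV"
      using square_summable_mult[OF coord_summable[of x] coord_summable[of \<xi>]] by simp
  qed
  define y where "y \<xi> s = (\<Sum>\<^sub>\<infinity>t. a s t * coord \<xi> t)" for \<xi> s
  have "\<exists>x. coord x = y \<xi> \<and> norm x \<le> C * norm \<xi>" for \<xi>
  proof (rule ell2_of_function, rule L2_set_dual)
    show "0 \<le> C * norm \<xi>" using C by simp
    fix F :: "'a set" and d :: "'a \<Rightarrow> complex" assume F: "finite F"
    let ?g = "\<lambda>t. \<Sum>s\<in>F. a s t * coord \<xi> t * d s"
    have hs: "(?g has_sum (\<Sum>s\<in>F. y \<xi> s * d s)) UNIV"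
      unfolding y_def by (intro has_sum_finite_sum has_sum_cmult_left has_sum_infsum sm F)
    have "norm (infsum ?g UNIV) \<le> C * norm \<xi> * L2_set (\<lambda>s. cmod (d s)) F"
    proof (rule infsum_norm_le)
      show "?g summable_on UNIV" using hs by (rule has_sum_imp_summable)
      fix E :: "'b set" assume "finite E"
      have "norm (\<Sum>t\<in>E. \<Sum>s\<in>F. a s t * coord \<xi> t * d s)
          \<le> C * L2_set (\<lambda>t. cmod (coord \<xi> t)) E * L2_set (\<lambda>s. cmod (d s)) F"
        by (subst sum.swap) (rule matrix_boundD[OF a \<open>finite E\<close> F])
      also have "\<dots> \<le> C * norm \<xi> * L2_set (\<lambda>s. cmod (d s)) F"
        by (intro mult_right_mono mult_left_mono L2_set_coord_le C) simp
      finally show "norm (sum ?g E) \<le> C * norm \<xi> * L2_set (\<lambda>s. cmod (d s)) F" .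
    qed
    then show "cmod (\<Sum>s\<in>F. y \<xi> s * d s) \<le> C * norm \<xi> * L2_set (\<lambda>s. cmod (d s)) F"
      using infsumI[OF hs] by simp
  qed
  then obtain f where f: "\<And>\<xi>. coord (f \<xi>) = y \<xi>" "\<And>\<xi>. norm (f \<xi>) \<le> C * norm \<xi>" by metis
  have bl: "bounded_linear f"
  proof (rule bounded_linear_intro)
    fix x z :: "'b ell2" and r :: real
    show "f (x + z) = f x + f z"
      by (rule ell2_eqI) (simp add: f coord_simps y_def infsum_add sm distrib_left)
    show "f (r *\<^sub>R x) = r *\<^sub>R f x"
      by (rule ell2_eqI) (simp add: f coord_simps y_def infsum_scaleR_right)
    show "norm (f x) \<le> norm x * C" using f(2)[of x] by (simp add: mult.commute)
  qed
  define T where "T = Blinfun f"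
  have T: "blinfun_apply T = f" unfolding T_def using bl by (rule bounded_linear_Blinfun_apply)
  have "complex_linear T"
    unfolding complex_linear_def T
  proof (intro allI ell2_eqI)
    fix c \<xi> s
    have "y (scaleC_ell2 c \<xi>) s = (\<Sum>\<^sub>\<infinity>t. c * (a s t * coord \<xi> t))"
      unfolding y_def by (intro infsum_cong) (simp add: coord_simps)
    also have "\<dots> = c * y \<xi> s" unfolding y_def by (rule infsum_cmult_right')
    finally show "coord (f (scaleC_ell2 c \<xi>)) s = coord (scaleC_ell2 c (f \<xi>)) s"
      by (simp add: f coord_simps)
  qed
  moreover have "entry T s t = a s t" for s t
  proof -
    have "y (ket t) s = (\<Sum>\<^sub>\<infinity>t'\<in>{t}. a s t)"
      unfolding y_def by (rule infsum_cong_neutral) (auto simp: ket.rep_eq)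
    then show ?thesis by (simp add: entry_def T f)
  qed
  moreover have "norm T \<le> C" by (rule norm_blinfun_bound) (use C f(2) T in auto)
  ultimately show ?thesis by blast
qed

lemma norm_le_matrix_bound:
  assumes "complex_linear T" "matrix_bound (entry T) C"
  shows "norm T \<le> C"
proof -
  obtain S where "complex_linear S" "entry S = entry T" "norm S \<le> C" using operator_of_matrix_bound[OF assms(2)] by blast
  then show ?thesis using complex_linear_eqI[of T S] assms(1) by simp
qed

lemma closed_complex_linear: "closed {T :: 'a ell2 \<Rightarrow>\<^sub>L 'b ell2. complex_linear T}"
proof -
  have "closed {T :: 'a ell2 \<Rightarrow>\<^sub>L 'b ell2. T (scaleC_ell2 c \<xi>) = scaleC_ell2 c (T \<xi>)}" for c \<xi>
    by (intro closed_Collect_eq linear_continuous_on blinfun.bounded_linear_left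
        bounded_linear_compose[OF bounded_linear_scaleC_ell2])
  then have "closed (\<Inter>c. \<Inter>\<xi>. {T :: 'a ell2 \<Rightarrow>\<^sub>L 'b ell2. T (scaleC_ell2 c \<xi>) = scaleC_ell2 c (T \<xi>)})"
    by (intro closed_INT) auto
  moreover have "(\<Inter>c. \<Inter>\<xi>. {T :: 'a ell2 \<Rightarrow>\<^sub>L 'b ell2. T (scaleC_ell2 c \<xi>) = scaleC_ell2 c (T \<xi>)})
      = {T. complex_linear T}"
    unfolding complex_linear_def by auto
  ultimately show ?thesis by simp
qed

lemma complex_linear_closure: "T \<in> closure A \<Longrightarrow> (\<And>S. S \<in> A \<Longrightarrow> complex_linear S) \<Longrightarrow> complex_linear T"
  using closure_minimal[OF _ closed_complex_linear, of A] by blast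

text \<open>
  A bounded linear operation \<open>\<Theta>\<close> on matrices induces a bounded, hence continuous, map on operators.
  Compressions and tensor products are transported to norm closures in this way.
\<close>

lemma closure_matrix_transform:
  fixes A :: "('a ell2 \<Rightarrow>\<^sub>L 'b ell2) set" and A' :: "('c ell2 \<Rightarrow>\<^sub>L 'd ell2) set"
  assumes T: "T \<in> closure A" and A: "\<And>S. S \<in> A \<Longrightarrow> complex_linear S"
    and diff: "\<And>a b. \<Theta> (\<lambda>s t. a s t - b s t) = (\<lambda>s t. \<Theta> a s t - \<Theta> b s t)"
    and bound: "\<And>a C. matrix_bound a C \<Longrightarrow> matrix_bound (\<Theta> a) (K * C)"
    and A': "\<And>S. S \<in> A \<Longrightarrow> \<exists>S'\<in>closure A'. complex_linear S' \<and> entry S' = \<Theta> (entry S)"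
  shows "\<exists>T'\<in>closure A'. complex_linear T' \<and> entry T' = \<Theta> (entry T)"
proof -
  have cT: "complex_linear T" using complex_linear_closure[OF T A] .
  obtain T' where T': "complex_linear T'" "entry T' = \<Theta> (entry T)"
    using operator_of_matrix_bound[OF bound[OF matrix_bound_entries[OF cT]]] by blast
  obtain S where S: "\<And>n. S n \<in> A" "S \<longlonglongrightarrow> T" using T unfolding closure_sequential by blast
  obtain S' where S': "\<And>n. S' n \<in> closure A'" "\<And>n. complex_linear (S' n)" "\<And>n. entry (S' n) = \<Theta> (entry (S n))"
    using A'[OF S(1)] by metis
  have le: "norm (S' n - T') \<le> K * norm (S n - T)" for n
  proof (rule norm_le_matrix_bound)
    have "entry (S n - T) = (\<lambda>s t. entry (S n) s t - entry T s t)" by (intro ext) simp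
    moreover have "entry (S' n - T') = (\<lambda>s t. entry (S' n) s t - entry T' s t)" by (intro ext) simp
    ultimately have "entry (S' n - T') = \<Theta> (entry (S n - T))" using S'(3) T'(2) diff by simp
    then show "matrix_bound (entry (S' n - T')) (K * norm (S n - T))"
      using bound[OF matrix_bound_entries, of "S n - T"] A S(1) cT by simp
  qed (use S' T' in auto)
  have "(\<lambda>n. K * norm (S n - T)) \<longlonglongrightarrow> 0"
    using tendsto_mult_left[OF tendsto_norm_zero[OF LIM_zero[OF S(2)]], of K] by simp
  then have "S' \<longlonglongrightarrow> T'"
    using le by (intro LIM_zero_cancel[of S' T'] Lim_null_comparison[of "\<lambda>n. S' n - T'"]) auto
  then have "T' \<in> closure A'" using S'(1) closed_sequentially[OF closed_closure] by metis
  then show ?thesis using T' by blast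
qed

section \<open>Operators of a group in matrix form\<close>

definition supported_on :: "'a set \<Rightarrow> ('a \<Rightarrow> 'a \<Rightarrow> complex) \<Rightarrow> bool" where
  "supported_on X a \<longleftrightarrow> (\<forall>s t. a s t \<noteq> 0 \<longrightarrow> s \<in> X \<and> t \<in> X)"

text \<open>
  For a bounded operator the entries are bounded by its norm, so for its matrix this is membership
  in \<open>banded_matrices\<close> for some radius and some bound, whichever proper length function is used.
\<close>

definition banded :: "('a, 'm) monoid_scheme \<Rightarrow> ('a \<Rightarrow> 'a \<Rightarrow> complex) \<Rightarrow> bool" where
  "banded G a \<longleftrightarrow> supported_on (carrier G) a \<and>
     (\<exists>F. finite F \<and> (\<forall>s t. a s t \<noteq> 0 \<longrightarrow> s \<otimes>\<^bsub>G\<^esub> inv\<^bsub>G\<^esub> t \<in> F))"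

definition band_ops :: "('a, 'm) monoid_scheme \<Rightarrow> ('a ell2 \<Rightarrow>\<^sub>L 'a ell2) set" where
  "band_ops G = {T. complex_linear T \<and> banded G (entry T)}"

text \<open>
  Support in the carrier belongs to invariance: conjugation with the right translation by \<open>1\<close> is
  compression to the functions on the carrier.
\<close>

definition translation_invariant :: "('a, 'm) monoid_scheme \<Rightarrow> ('a \<Rightarrow> 'a \<Rightarrow> complex) \<Rightarrow> bool" where
  "translation_invariant G a \<longleftrightarrow> supported_on (carrier G) a \<and>
     (\<forall>g\<in>carrier G. \<forall>s\<in>carrier G. \<forall>t\<in>carrier G. a (s \<otimes>\<^bsub>G\<^esub> g) (t \<otimes>\<^bsub>G\<^esub> g) = a s t)"

definition convolution_matrix :: "('a, 'm) monoid_scheme \<Rightarrow> ('a \<Rightarrow> complex) \<Rightarrow> 'a \<Rightarrow> 'a \<Rightarrow> complex" where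
  "convolution_matrix G c =
     (\<lambda>s t. if s \<in> carrier G \<and> t \<in> carrier G then c (s \<otimes>\<^bsub>G\<^esub> inv\<^bsub>G\<^esub> t) else 0)"

lemma norm_entry_le: "complex_linear T \<Longrightarrow> cmod (entry T s t) \<le> norm T"
  using matrix_bound_entry[OF matrix_bound_entries] .

text \<open>
  The balls of a proper length function are finite, and every finite set is contained in a ball, so
  finite propagation means that the set of quotients \<open>s t\<inverse>\<close> is finite.
\<close>

lemma uniform_roe_eq_closure:
  assumes "group G" and l: "proper_length_function G l"
  shows "uniform_roe G l = closure (band_ops G)"
proof -
  interpret group G by fact
  have "(\<exists>R>0. \<exists>M>0. \<exists>a\<in>banded_matrices G l R M.
           \<forall>\<xi> s. coord (blinfun_apply T \<xi>) s = (\<Sum>\<^sub>\<infinity>t\<in>carrier G. a s t * coord \<xi> t))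
        \<longleftrightarrow> T \<in> band_ops G" (is "?L \<longleftrightarrow> ?R") for T
  proof
    assume ?L
    then obtain R M a where a: "a \<in> banded_matrices G l R M"
      and T: "\<And>\<xi> s. coord (blinfun_apply T \<xi>) s = (\<Sum>\<^sub>\<infinity>t\<in>carrier G. a s t * coord \<xi> t)" by blast
    have supp: "s \<in> carrier G \<and> t \<in> carrier G" if "a s t \<noteq> 0" for s t
      using a that unfolding banded_matrices_def by blast
    have "complex_linear T"
      unfolding complex_linear_def
    proof (intro allI ell2_eqI)
      fix c \<xi> s
      have "coord (T (scaleC_ell2 c \<xi>)) s = (\<Sum>\<^sub>\<infinity>t\<in>carrier G. c * (a s t * coord \<xi> t))"
        unfolding T by (intro infsum_cong) (simp add: coord_simps)
      also have "\<dots> = c * coord (T \<xi>) s" unfolding T by (rule infsum_cmult_right')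
      finally show "coord (T (scaleC_ell2 c \<xi>)) s = coord (scaleC_ell2 c (T \<xi>)) s"
        by (simp add: coord_simps)
    qed
    moreover have "entry T = a"
    proof (intro ext)
      fix s t
      have "entry T s t = (\<Sum>\<^sub>\<infinity>t'\<in>{t}. a s t)"
        unfolding entry_def T by (rule infsum_cong_neutral) (use supp in \<open>auto simp: ket.rep_eq\<close>)
      then show "entry T s t = a s t" by simp
    qed
    moreover have "banded G a"
      unfolding banded_def supported_on_def
    proof (intro conjI exI allI impI)
      show "finite {g \<in> carrier G. l g \<le> R}" using l unfolding proper_length_function_def by blast
      fix s t assume nz: "a s t \<noteq> 0"
      then have st: "s \<in> carrier G" "t \<in> carrier G" using supp by auto
      then have "\<not> l (s \<otimes>\<^bsub>G\<^esub> inv\<^bsub>G\<^esub> t) > R"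
        using a nz unfolding banded_matrices_def by blast
      then show "s \<otimes>\<^bsub>G\<^esub> inv\<^bsub>G\<^esub> t \<in> {g \<in> carrier G. l g \<le> R}" using st by auto
    qed (use supp in auto)
    ultimately show ?R unfolding band_ops_def by simp
  next
    assume ?R
    then obtain F where T: "complex_linear T" "finite F"
      and supp: "\<And>s t. entry T s t \<noteq> 0 \<Longrightarrow> s \<in> carrier G \<and> t \<in> carrier G"
      and F: "\<And>s t. entry T s t \<noteq> 0 \<Longrightarrow> s \<otimes>\<^bsub>G\<^esub> inv\<^bsub>G\<^esub> t \<in> F"
      unfolding band_ops_def banded_def supported_on_def by blast
    define R where "R = Max (insert 1 (l ` F))"
    have R: "R \<ge> 1" "\<And>g. g \<in> F \<Longrightarrow> l g \<le> R" unfolding R_def using T(2) by auto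
    have "entry T \<in> banded_matrices G l R (norm T + 1)"
      unfolding banded_matrices_def
    proof (intro CollectI conjI ballI allI impI)
      fix s t assume "R < l (s \<otimes>\<^bsub>G\<^esub> inv\<^bsub>G\<^esub> t)"
      then show "entry T s t = 0" using F[of s t] R(2) by force
    next
      fix s t show "cmod (entry T s t) \<le> norm T + 1"
        using norm_entry_le[OF T(1), of s t] by simp
    qed (use supp in auto)
    moreover have "coord (T \<xi>) s = (\<Sum>\<^sub>\<infinity>t\<in>carrier G. entry T s t * coord \<xi> t)" for \<xi> s
      unfolding complex_linear_apply[OF T(1)] by (rule infsum_cong_neutral) (use supp in auto)
    moreover have "R > 0" "norm T + 1 > 0" using R(1) by (auto intro: add_nonneg_pos)
    ultimately show ?L by blast
  qed
  then show ?thesis unfolding uniform_roe_def by simp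
qed

lemma entry_left_reg:
  assumes "group G" "g \<in> carrier G"
  shows "entry (left_reg G g) s t =
    (if s \<in> carrier G \<and> t \<in> carrier G \<and> s \<otimes>\<^bsub>G\<^esub> inv\<^bsub>G\<^esub> t = g then 1 else 0)"
proof -
  interpret group G by fact
  have "inv\<^bsub>G\<^esub> g \<otimes>\<^bsub>G\<^esub> s = t \<longleftrightarrow> t \<in> carrier G \<and> s \<otimes>\<^bsub>G\<^esub> inv\<^bsub>G\<^esub> t = g" if "s \<in> carrier G"
    using assms(2) that by (metis inv_closed inv_solve_left inv_solve_right m_closed)
  then show ?thesis using assms by (auto simp: entry_def left_reg_apply ket.rep_eq)
qed

lemma complex_linear_left_reg: "group G \<Longrightarrow> g \<in> carrier G \<Longrightarrow> complex_linear (left_reg G g)"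
  unfolding complex_linear_def by (auto intro!: ell2_eqI simp: left_reg_apply coord_simps)

lemma complex_linear_right_reg: "group G \<Longrightarrow> g \<in> carrier G \<Longrightarrow> complex_linear (right_reg G g)"
  unfolding complex_linear_def by (auto intro!: ell2_eqI simp: right_reg_apply coord_simps)

text \<open>
  The matrix of a left translation by \<open>g\<close> is the indicator of the diagonal \<open>s t\<inverse> = g\<close>.
\<close>

lemma group_algebra_ops_iff:
  assumes "group G"
  shows "T \<in> group_algebra_ops G \<longleftrightarrow> complex_linear T \<and>
    (\<exists>c F. finite F \<and> F \<subseteq> carrier G \<and> (\<forall>g. g \<notin> F \<longrightarrow> c g = 0) \<and> entry T = convolution_matrix G c)"
proof -
  interpret group G by fact
  let ?S = "\<lambda>F c. \<Sum>g\<in>F. scalar_op (c g) o\<^sub>L left_reg G g"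
  have entries: "entry (?S F c) = convolution_matrix G (\<lambda>g. if g \<in> F then c g else 0)"
    if F: "finite F" "F \<subseteq> carrier G" for F c
  proof (intro ext)
    fix s t
    have "entry (?S F c) s t = (\<Sum>g\<in>F. if s \<in> carrier G \<and> t \<in> carrier G \<and> s \<otimes>\<^bsub>G\<^esub> inv\<^bsub>G\<^esub> t = g then c g else 0)"
      using F(2) by (auto simp: entry_left_reg[OF assms] intro!: sum.cong)
    then show "entry (?S F c) s t = convolution_matrix G (\<lambda>g. if g \<in> F then c g else 0) s t"
      using F(1) by (auto simp: convolution_matrix_def)
  qed
  have lin: "complex_linear (?S F c)" if "F \<subseteq> carrier G" for F c
    using that assms by (intro complex_linear_sum complex_linear_compose complex_linear_left_reg) auto
  show ?thesis
  proof
    assume "T \<in> group_algebra_ops G"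
    then obtain F c where F: "finite F" "F \<subseteq> carrier G" and T: "T = ?S F c"
      unfolding group_algebra_ops_def by blast
    then show "complex_linear T \<and>
      (\<exists>c F. finite F \<and> F \<subseteq> carrier G \<and> (\<forall>g. g \<notin> F \<longrightarrow> c g = 0) \<and> entry T = convolution_matrix G c)"
      using lin[OF F(2), of c] entries[OF F, of c]
      by (auto intro!: exI[of _ "\<lambda>g. if g \<in> F then c g else 0"] exI[of _ F])
  next
    assume "complex_linear T \<and>
      (\<exists>c F. finite F \<and> F \<subseteq> carrier G \<and> (\<forall>g. g \<notin> F \<longrightarrow> c g = 0) \<and> entry T = convolution_matrix G c)"
    then obtain c F where T: "complex_linear T" and F: "finite F" "F \<subseteq> carrier G"
      and c: "\<forall>g. g \<notin> F \<longrightarrow> c g = 0" and eT: "entry T = convolution_matrix G c" by blast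
    have "(\<lambda>g. if g \<in> F then c g else 0) = c" using c by auto
    then have "T = ?S F c" using entries[OF F, of c] eT by (intro complex_linear_eqI T lin F(2)) simp
    then show "T \<in> group_algebra_ops G" unfolding group_algebra_ops_def using F by blast
  qed
qed

lemma bounded_linear_entry: "bounded_linear (\<lambda>T. entry T s t)"
  unfolding entry_def
  by (rule bounded_linear_compose[OF bounded_linear_coord blinfun.bounded_linear_left])

lemma closure_in_closed: "T \<in> closure A \<Longrightarrow> closed X \<Longrightarrow> (\<And>S. S \<in> A \<Longrightarrow> S \<in> X) \<Longrightarrow> T \<in> X"
  by (meson closure_minimal subsetD subsetI)

text \<open>
  Matrix entries are continuous in the operator, so equations between entries survive in the closure.
\<close>

lemma translation_invariant_closure:
  assumes T: "T \<in> closure A" and A: "\<And>S. S \<in> A \<Longrightarrow> translation_invariant G (entry S)"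
  shows "translation_invariant G (entry T)"
proof -
  have eq: "entry T s t = entry T s' t'" if "\<And>S. S \<in> A \<Longrightarrow> entry S s t = entry S s' t'" for s t s' t'
  proof -
    have "closed {S :: 'a ell2 \<Rightarrow>\<^sub>L 'a ell2. entry S s t = entry S s' t'}"
      by (intro closed_Collect_eq linear_continuous_on bounded_linear_entry)
    from closure_in_closed[OF T this] show ?thesis using that by simp
  qed
  have zero: "entry T s t = 0" if "\<And>S. S \<in> A \<Longrightarrow> entry S s t = 0" for s t
  proof -
    have "closed {S :: 'a ell2 \<Rightarrow>\<^sub>L 'a ell2. entry S s t = 0}"
      by (intro closed_Collect_eq linear_continuous_on bounded_linear_entry continuous_on_const)
    from closure_in_closed[OF T this] show ?thesis using that by simp
  qed
  show ?thesis
    unfolding translation_invariant_def supported_on_def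
  proof (intro conjI allI impI ballI)
    fix s t assume "entry T s t \<noteq> 0"
    then obtain S where "S \<in> A" "entry S s t \<noteq> 0" using zero by blast
    then show "s \<in> carrier G" "t \<in> carrier G"
      using A unfolding translation_invariant_def supported_on_def by blast+
  qed (use A in \<open>auto intro!: eq simp: translation_invariant_def\<close>)
qed

text \<open>
  The right regular representation permutes the basis vectors, so conjugation by it translates both
  indices of the matrix.
\<close>

lemma translation_invariant_iff:
  assumes "group G" and T: "complex_linear T"
  shows "(\<forall>g\<in>carrier G. right_reg G g o\<^sub>L T o\<^sub>L right_reg G (inv\<^bsub>G\<^esub> g) = T) \<longleftrightarrow>
    translation_invariant G (entry T)"
proof -
  interpret group G by fact
  have ket: "right_reg G (inv\<^bsub>G\<^esub> g) (ket t) = (if t \<in> carrier G then ket (t \<otimes>\<^bsub>G\<^esub> g) else 0)"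
    if g: "g \<in> carrier G" for g t
  proof (rule ell2_eqI)
    fix s
    have "s \<otimes>\<^bsub>G\<^esub> inv\<^bsub>G\<^esub> g = t \<longleftrightarrow> t \<in> carrier G \<and> s = t \<otimes>\<^bsub>G\<^esub> g" if "s \<in> carrier G"
      using g that by (metis inv_closed inv_solve_right m_closed)
    then show "coord (right_reg G (inv\<^bsub>G\<^esub> g) (ket t)) s =
        coord (if t \<in> carrier G then ket (t \<otimes>\<^bsub>G\<^esub> g) else 0) s"
      using g by (auto simp: right_reg_apply[OF assms(1)] ket.rep_eq coord_simps)
  qed
  have entries: "entry (right_reg G g o\<^sub>L T o\<^sub>L right_reg G (inv\<^bsub>G\<^esub> g)) s t =
      (if s \<in> carrier G \<and> t \<in> carrier G then entry T (s \<otimes>\<^bsub>G\<^esub> g) (t \<otimes>\<^bsub>G\<^esub> g) else 0)"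
    if "g \<in> carrier G" for g s t
    using that by (auto simp: entry_def ket right_reg_apply[OF assms(1)] coord_simps)
  have lin: "complex_linear (right_reg G g o\<^sub>L T o\<^sub>L right_reg G (inv\<^bsub>G\<^esub> g))" if "g \<in> carrier G" for g
    using that by (intro complex_linear_compose complex_linear_right_reg assms) auto
  have "(right_reg G g o\<^sub>L T o\<^sub>L right_reg G (inv\<^bsub>G\<^esub> g) = T) \<longleftrightarrow>
      (\<forall>s t. (if s \<in> carrier G \<and> t \<in> carrier G then entry T (s \<otimes>\<^bsub>G\<^esub> g) (t \<otimes>\<^bsub>G\<^esub> g) else 0) = entry T s t)"
    if g: "g \<in> carrier G" for g
    using complex_linear_eqI[OF lin[OF g] T] entries[OF g] by metis
  then have "(\<forall>g\<in>carrier G. right_reg G g o\<^sub>L T o\<^sub>L right_reg G (inv\<^bsub>G\<^esub> g) = T) \<longleftrightarrow>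
      (\<forall>g\<in>carrier G. \<forall>s t. (if s \<in> carrier G \<and> t \<in> carrier G then entry T (s \<otimes>\<^bsub>G\<^esub> g) (t \<otimes>\<^bsub>G\<^esub> g) else 0)
         = entry T s t)" by auto
  also have "\<dots> \<longleftrightarrow> translation_invariant G (entry T)"
  proof
    assume *: "\<forall>g\<in>carrier G. \<forall>s t. (if s \<in> carrier G \<and> t \<in> carrier G
      then entry T (s \<otimes>\<^bsub>G\<^esub> g) (t \<otimes>\<^bsub>G\<^esub> g) else 0) = entry T s t"
    have "supported_on (carrier G) (entry T)"
      unfolding supported_on_def
    proof (intro allI impI)
      fix s t assume "entry T s t \<noteq> 0"
      then show "s \<in> carrier G \<and> t \<in> carrier G"
        using *[rule_format, OF one_closed, of s t] by (auto split: if_splits)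
    qed
    moreover have "entry T (s \<otimes>\<^bsub>G\<^esub> g) (t \<otimes>\<^bsub>G\<^esub> g) = entry T s t"
      if "g \<in> carrier G" "s \<in> carrier G" "t \<in> carrier G" for g s t
      using *[rule_format, OF that(1), of s t] that(2,3) by simp
    ultimately show "translation_invariant G (entry T)"
      unfolding translation_invariant_def by blast
  next
    assume inv: "translation_invariant G (entry T)"
    show "\<forall>g\<in>carrier G. \<forall>s t. (if s \<in> carrier G \<and> t \<in> carrier G
      then entry T (s \<otimes>\<^bsub>G\<^esub> g) (t \<otimes>\<^bsub>G\<^esub> g) else 0) = entry T s t"
    proof (intro ballI allI)
      fix g s t assume "g \<in> carrier G"
      then show "(if s \<in> carrier G \<and> t \<in> carrier G
          then entry T (s \<otimes>\<^bsub>G\<^esub> g) (t \<otimes>\<^bsub>G\<^esub> g) else 0) = entry T s t"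
        using inv unfolding translation_invariant_def supported_on_def
        by (cases "s \<in> carrier G \<and> t \<in> carrier G") (simp, metis)
    qed
  qed
  finally show ?thesis .
qed

lemma uniform_roe_fixed_eq:
  assumes "group G" "proper_length_function G l"
  shows "uniform_roe_fixed G l = {T \<in> closure (band_ops G). translation_invariant G (entry T)}"
proof -
  have "complex_linear T" if "T \<in> closure (band_ops G)" for T
    by (rule complex_linear_closure[OF that]) (simp add: band_ops_def)
  then show ?thesis
    using translation_invariant_iff[OF assms(1)]
    unfolding uniform_roe_fixed_def uniform_roe_eq_closure[OF assms] by blast
qed

text \<open>
  The easy inclusion: left translations have finite propagation and commute with right translations.
  The ITAP is therefore a question about the opposite inclusion only.
\<close>

lemma reduced_Cstar_invariant:
  assumes "group G" "T \<in> reduced_Cstar G"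
  shows "T \<in> closure (band_ops G)" "translation_invariant G (entry T)"
proof -
  interpret group G by fact
  have *: "S \<in> band_ops G \<and> translation_invariant G (entry S)" if S: "S \<in> group_algebra_ops G" for S
  proof -
    obtain c F where c: "complex_linear S" "finite F" "\<And>g. g \<notin> F \<Longrightarrow> c g = 0" "entry S = convolution_matrix G c"
      using S unfolding group_algebra_ops_iff[OF assms(1)] by blast
    have supp: "supported_on (carrier G) (entry S)"
      unfolding supported_on_def c(4) convolution_matrix_def by auto
    have "s \<otimes>\<^bsub>G\<^esub> g \<otimes>\<^bsub>G\<^esub> inv\<^bsub>G\<^esub> (t \<otimes>\<^bsub>G\<^esub> g) = s \<otimes>\<^bsub>G\<^esub> inv\<^bsub>G\<^esub> t"
      if "g \<in> carrier G" "s \<in> carrier G" "t \<in> carrier G" for g s t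
      using that by (simp add: inv_mult_group m_assoc flip: m_assoc[of g "inv\<^bsub>G\<^esub> g" "inv\<^bsub>G\<^esub> t"])
    then have "translation_invariant G (entry S)"
      using supp unfolding translation_invariant_def by (auto simp: c(4) convolution_matrix_def)
    moreover have "banded G (entry S)"
      unfolding banded_def using supp c(2,3)
      by (auto simp: c(4) convolution_matrix_def intro!: exI[of _ F] split: if_splits)
    ultimately show ?thesis using c(1) unfolding band_ops_def by simp
  qed
  then show "T \<in> closure (band_ops G)"
    using assms(2) closure_mono[of "group_algebra_ops G" "band_ops G"] unfolding reduced_Cstar_def by blast
  show "translation_invariant G (entry T)"
    using assms(2) translation_invariant_closure * unfolding reduced_Cstar_def by blast
qed

lemma has_ITAP_iff:
  assumes "group G" "countable (carrier G)"
  shows "has_ITAP G \<longleftrightarrow>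
    (\<forall>T\<in>closure (band_ops G). translation_invariant G (entry T) \<longrightarrow> T \<in> reduced_Cstar G)"
proof -
  define X where "X = {T \<in> closure (band_ops G). translation_invariant G (entry T)}"
  have X: "uniform_roe_fixed G l = X" if "proper_length_function G l" for l
    unfolding X_def by (rule uniform_roe_fixed_eq[OF assms(1) that])
  have "reduced_Cstar G \<subseteq> X"
    using reduced_Cstar_invariant[OF assms(1)] unfolding X_def by blast
  moreover have "has_ITAP G \<longleftrightarrow> reduced_Cstar G = X"
    using proper_length_function_exists[OF assms] X unfolding has_ITAP_def by auto
  ultimately have "has_ITAP G \<longleftrightarrow> X \<subseteq> reduced_Cstar G" by auto
  then show ?thesis unfolding X_def by blast
qed

section \<open>Passing between \<open>H\<close> and \<open>G \<times> H\<close>\<close>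

lemma matrix_bound_submatrix:
  fixes a :: "'b \<Rightarrow> 'a \<Rightarrow> complex" and \<sigma> :: "'d \<Rightarrow> 'b" and \<tau> :: "'c \<Rightarrow> 'a"
  assumes a: "matrix_bound a C" and inj: "inj \<sigma>" "inj \<tau>"
  shows "matrix_bound (\<lambda>s t. a (\<sigma> s) (\<tau> t)) C"
proof (rule matrix_bound_L2I)
  fix E :: "'c set" and F :: "'d set" and c :: "'c \<Rightarrow> complex"
  assume fin: "finite E" "finite F"
  define c' where "c' t = c (inv_into UNIV \<tau> t)" for t
  have c': "c' (\<tau> t) = c t" for t by (simp add: c'_def inj(2))
  have inj': "inj_on \<sigma> F" "inj_on \<tau> E" using inj by (auto intro: inj_on_subset)
  have "L2_set (\<lambda>s. cmod (\<Sum>t\<in>E. a (\<sigma> s) (\<tau> t) * c t)) F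
      = L2_set (\<lambda>s. cmod (\<Sum>t\<in>\<tau> ` E. a s t * c' t)) (\<sigma> ` F)"
    by (simp add: L2_set_reindex inj' sum.reindex c')
  also have "\<dots> \<le> C * L2_set (\<lambda>t. cmod (c' t)) (\<tau> ` E)" using fin by (intro matrix_bound_L2D a) auto
  also have "L2_set (\<lambda>t. cmod (c' t)) (\<tau> ` E) = L2_set (\<lambda>t. cmod (c t)) E"
    by (simp add: L2_set_reindex inj' c')
  finally show "L2_set (\<lambda>s. cmod (\<Sum>t\<in>E. a (\<sigma> s) (\<tau> t) * c t)) F \<le> C * L2_set (\<lambda>t. cmod (c t)) E" .
qed

text \<open>
  The matrix of \<open>V \<otimes> b\<close>, where \<open>V\<close> is the partial permutation operator that maps the basis vector
  at \<open>x \<in> X\<close> to the one at \<open>\<gamma> x\<close> and annihilates those outside of \<open>X\<close>.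
\<close>

definition shift_tensor ::
  "'a set \<Rightarrow> ('a \<Rightarrow> 'a) \<Rightarrow> ('b \<Rightarrow> 'b \<Rightarrow> complex) \<Rightarrow> 'a \<times> 'b \<Rightarrow> 'a \<times> 'b \<Rightarrow> complex" where
  "shift_tensor X \<gamma> b = (\<lambda>s t. if fst t \<in> X \<and> fst s = \<gamma> (fst t) then b (snd s) (snd t) else 0)"

text \<open>
  The matrix has one block \<open>b\<close> for each \<open>x \<in> X\<close>, and different \<open>x\<close> use different rows and different
  columns, so the Cauchy--Schwarz inequality for the sum over \<open>x\<close> gives the bound of a single block.
\<close>

lemma matrix_bound_shift_tensor:
  fixes b :: "'b \<Rightarrow> 'b \<Rightarrow> complex" and \<gamma> :: "'a \<Rightarrow> 'a"
  assumes b: "matrix_bound b C" and inj: "inj_on \<gamma> X"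
  shows "matrix_bound (shift_tensor X \<gamma> b) C"
proof (rule matrix_bound_cofinal)
  fix E F :: "('a \<times> 'b) set" assume fin: "finite E" "finite F"
  \<comment> \<open>Rectangles, with the rows large enough to contain the image of the columns under \<open>\<gamma>\<close>.\<close>
  define A B A' B' where "A = fst ` E" and "B = snd ` E"
    and "A' = fst ` F \<union> \<gamma> ` A" and "B' = snd ` F"
  have finAB: "finite A" "finite B" "finite A'" "finite B'"
    using fin by (simp_all add: A_def B_def A'_def B'_def)
  have C: "C \<ge> 0" using matrix_bound_nonneg[OF b] .
  have "cmod (\<Sum>s\<in>A' \<times> B'. \<Sum>t\<in>A \<times> B. shift_tensor X \<gamma> b s t * c t * d s)
       \<le> C * L2_set (\<lambda>t. cmod (c t)) (A \<times> B) * L2_set (\<lambda>s. cmod (d s)) (A' \<times> B')" for c d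
  proof -
    define \<alpha> where "\<alpha> x = L2_set (\<lambda>h. cmod (c (x, h))) B" for x
    define \<beta> where "\<beta> x = L2_set (\<lambda>h. cmod (d (x, h))) B'" for x
    define P where "P x x' = (\<Sum>h\<in>B'. \<Sum>h'\<in>B. b h h' * c (x, h') * d (x', h))" for x x'
    have "(\<Sum>s\<in>A' \<times> B'. \<Sum>t\<in>A \<times> B. shift_tensor X \<gamma> b s t * c t * d s)
        = (\<Sum>x'\<in>A'. \<Sum>h\<in>B'. \<Sum>x\<in>A. \<Sum>h'\<in>B.
             if x \<in> X \<and> x' = \<gamma> x then b h h' * c (x, h') * d (x', h) else 0)"
      unfolding sum.cartesian_product' by (auto simp: shift_tensor_def intro!: sum.cong)
    also have "\<dots> = (\<Sum>x'\<in>A'. \<Sum>x\<in>A. if x \<in> X \<and> x' = \<gamma> x then P x x' else 0)"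
    proof (intro sum.cong refl)
      fix x' show "(\<Sum>h\<in>B'. \<Sum>x\<in>A. \<Sum>h'\<in>B. if x \<in> X \<and> x' = \<gamma> x then b h h' * c (x, h') * d (x', h) else 0)
        = (\<Sum>x\<in>A. if x \<in> X \<and> x' = \<gamma> x then P x x' else 0)"
        by (subst sum.swap) (auto simp: P_def intro!: sum.cong)
    qed
    also have "\<dots> = (\<Sum>x\<in>A. \<Sum>x'\<in>A'. if x \<in> X \<and> x' = \<gamma> x then P x x' else 0)" by (rule sum.swap)
    also have "\<dots> = (\<Sum>x\<in>A. if x \<in> X then P x (\<gamma> x) else 0)"
    proof (intro sum.cong refl)
      fix x assume "x \<in> A"
      then have "\<gamma> x \<in> A'" by (simp add: A'_def)
      then show "(\<Sum>x'\<in>A'. if x \<in> X \<and> x' = \<gamma> x then P x x' else 0) = (if x \<in> X then P x (\<gamma> x) else 0)"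
        using finAB(3) by (cases "x \<in> X") auto
    qed
    also have "\<dots> = (\<Sum>x\<in>A \<inter> X. P x (\<gamma> x))" by (rule sum.inter_restrict[symmetric]) (rule finAB)
    finally have eq: "(\<Sum>s\<in>A' \<times> B'. \<Sum>t\<in>A \<times> B. shift_tensor X \<gamma> b s t * c t * d s)
        = (\<Sum>x\<in>A \<inter> X. P x (\<gamma> x))" .
    have "cmod (\<Sum>x\<in>A \<inter> X. P x (\<gamma> x)) \<le> (\<Sum>x\<in>A \<inter> X. C * (\<bar>\<alpha> x\<bar> * \<bar>\<beta> (\<gamma> x)\<bar>))"
    proof (rule sum_norm_le)
      fix x
      show "cmod (P x (\<gamma> x)) \<le> C * (\<bar>\<alpha> x\<bar> * \<bar>\<beta> (\<gamma> x)\<bar>)"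
        using matrix_boundD[OF b finAB(2,4), of "\<lambda>h. c (x, h)" "\<lambda>h. d (\<gamma> x, h)"]
        by (simp add: P_def \<alpha>_def \<beta>_def mult.assoc)
    qed
    also have "\<dots> \<le> C * (L2_set \<alpha> (A \<inter> X) * L2_set (\<lambda>x. \<beta> (\<gamma> x)) (A \<inter> X))"
      unfolding sum_distrib_left[symmetric] by (intro mult_left_mono L2_set_mult_ineq C)
    also have "\<dots> \<le> C * (L2_set (\<lambda>t. cmod (c t)) (A \<times> B) * L2_set (\<lambda>s. cmod (d s)) (A' \<times> B'))"
    proof (intro mult_left_mono mult_mono C)
      have nest: "L2_set (\<lambda>x. L2_set (\<lambda>h. f (x, h)) V) U = L2_set f (U \<times> V)"
        for f :: "'a \<times> 'b \<Rightarrow> real" and U V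
        by (simp add: L2_set_def sum_nonneg sum.cartesian_product)
      have "L2_set \<alpha> (A \<inter> X) \<le> L2_set \<alpha> A" using finAB(1) by (intro L2_set_subset) auto
      then show "L2_set \<alpha> (A \<inter> X) \<le> L2_set (\<lambda>t. cmod (c t)) (A \<times> B)"
        using nest[of "\<lambda>t. cmod (c t)" B A] by (simp add: \<alpha>_def[abs_def])
      have "L2_set (\<lambda>x. \<beta> (\<gamma> x)) (A \<inter> X) = L2_set \<beta> (\<gamma> ` (A \<inter> X))"
        using inj by (intro L2_set_reindex[symmetric]) (auto intro: inj_on_subset)
      also have "\<dots> \<le> L2_set \<beta> A'" using finAB(3) by (intro L2_set_subset) (auto simp: A'_def)
      finally show "L2_set (\<lambda>x. \<beta> (\<gamma> x)) (A \<inter> X) \<le> L2_set (\<lambda>s. cmod (d s)) (A' \<times> B')"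
        using nest[of "\<lambda>s. cmod (d s)" B' A'] by (simp add: \<beta>_def[abs_def])
    qed simp_all
    finally show ?thesis unfolding eq by (simp add: mult.assoc)
  qed
  moreover have "E \<subseteq> A \<times> B" "F \<subseteq> A' \<times> B'"
    unfolding A_def B_def A'_def B'_def by force+
  ultimately show "\<exists>E' F'. finite E' \<and> finite F' \<and> E \<subseteq> E' \<and> F \<subseteq> F' \<and>
    (\<forall>c d. cmod (\<Sum>s\<in>F'. \<Sum>t\<in>E'. shift_tensor X \<gamma> b s t * c t * d s)
       \<le> C * L2_set (\<lambda>t. cmod (c t)) E' * L2_set (\<lambda>s. cmod (d s)) F')"
    using finAB by (intro exI[of _ "A \<times> B"] exI[of _ "A' \<times> B'"]) blast
qed

context
  fixes G :: "('a, 'm) monoid_scheme" and H :: "('b, 'n) monoid_scheme"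
  assumes G: "group G" and H: "group H"
begin

interpretation G: group G by (rule G)
interpretation H: group H by (rule H)
interpretation K: group "G \<times>\<times> H" by (rule DirProd_group[OF G H])

lemma inv_prod: "g \<in> carrier G \<Longrightarrow> h \<in> carrier H \<Longrightarrow> inv\<^bsub>G \<times>\<times> H\<^esub> (g, h) = (inv\<^bsub>G\<^esub> g, inv\<^bsub>H\<^esub> h)"
  by (rule inv_DirProd[OF G H])

text \<open>
  The matrix \<open>entry T (x, h) (y, h')\<close> is that of the block of \<open>T\<close> which leads from the functions on
  \<open>{y} \<times> H\<close> to those on \<open>{x} \<times> H\<close>.
\<close>

lemma compress_closure:
  fixes A :: "(('a \<times> 'b) ell2 \<Rightarrow>\<^sub>L ('a \<times> 'b) ell2) set"
  assumes "T \<in> closure A" and "\<And>S. S \<in> A \<Longrightarrow> complex_linear S"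
    and A': "\<And>S S'. S \<in> A \<Longrightarrow> complex_linear S' \<Longrightarrow> entry S' = (\<lambda>h h'. entry S (x, h) (y, h')) \<Longrightarrow> S' \<in> A'"
  shows "\<exists>T'\<in>closure A'. complex_linear T' \<and> entry T' = (\<lambda>h h'. entry T (x, h) (y, h'))"
proof (rule closure_matrix_transform[where \<Theta> = "\<lambda>a h h'. a (x, h) (y, h')" and K = 1, OF assms(1,2)])
  have inj: "inj (Pair x)" "inj (Pair y)" by (auto intro: injI)
  show "matrix_bound (\<lambda>h h'. a (x, h) (y, h')) (1 * C)" if "matrix_bound a C" for a C
    using matrix_bound_submatrix[OF that inj] by simp
  fix S assume S: "S \<in> A"
  obtain S' where "complex_linear S'" "entry S' = (\<lambda>h h'. entry S (x, h) (y, h'))"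
    using operator_of_matrix_bound[OF matrix_bound_submatrix[OF matrix_bound_entries inj]] assms(2)[OF S] by blast
  then show "\<exists>S'\<in>closure A'. complex_linear S' \<and> entry S' = (\<lambda>h h'. entry S (x, h) (y, h'))"
    using A'[OF S] closure_subset by blast
qed auto

lemma shift_tensor_closure:
  assumes "T \<in> closure A" and "\<And>S. S \<in> A \<Longrightarrow> complex_linear S" and inj: "inj_on \<gamma> X"
    and A': "\<And>S S'. S \<in> A \<Longrightarrow> complex_linear S' \<Longrightarrow> entry S' = shift_tensor X \<gamma> (entry S) \<Longrightarrow> S' \<in> A'"
  shows "\<exists>T'\<in>closure A'. complex_linear T' \<and> entry T' = shift_tensor X \<gamma> (entry T)"
proof (rule closure_matrix_transform[where K = 1, OF assms(1,2)])
  show "matrix_bound (shift_tensor X \<gamma> a) (1 * C)" if "matrix_bound a C" for a C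
    using matrix_bound_shift_tensor[OF that inj] by simp
  fix S assume S: "S \<in> A"
  obtain S' where "complex_linear S'" "entry S' = shift_tensor X \<gamma> (entry S)"
    using operator_of_matrix_bound[OF matrix_bound_shift_tensor[OF matrix_bound_entries inj]] assms(2)[OF S] by blast
  then show "\<exists>S'\<in>closure A'. complex_linear S' \<and> entry S' = shift_tensor X \<gamma> (entry S)"
    using A'[OF S] closure_subset by blast
qed (auto simp: shift_tensor_def intro!: ext)

lemma compress_band:
  assumes "S \<in> band_ops (G \<times>\<times> H)" "complex_linear S'" "entry S' = (\<lambda>h h'. entry S (x, h) (y, h'))"
  shows "S' \<in> band_ops H"
proof -
  obtain F where F: "finite F"
    "\<And>s t. entry S s t \<noteq> 0 \<Longrightarrow> s \<otimes>\<^bsub>G \<times>\<times> H\<^esub> inv\<^bsub>G \<times>\<times> H\<^esub> t \<in> F"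
    "\<And>s t. entry S s t \<noteq> 0 \<Longrightarrow> s \<in> carrier G \<times> carrier H \<and> t \<in> carrier G \<times> carrier H"
    using assms(1) unfolding band_ops_def banded_def supported_on_def by auto
  have "h \<otimes>\<^bsub>H\<^esub> inv\<^bsub>H\<^esub> h' \<in> snd ` F" if "entry S (x, h) (y, h') \<noteq> 0" for h h'
    using F(2)[OF that] F(3)[OF that] by (force simp: inv_prod)
  moreover have "h \<in> carrier H \<and> h' \<in> carrier H" if "entry S (x, h) (y, h') \<noteq> 0" for h h'
    using F(3)[OF that] by simp
  ultimately show ?thesis
    using assms(2,3) F(1) unfolding band_ops_def banded_def supported_on_def by auto
qed

text \<open>
  The diagonal block at \<open>1\<close> of a left translation by \<open>(g, h)\<close> is the left translation by \<open>h\<close> if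
  \<open>g = 1\<close>, and zero otherwise.
\<close>

lemma compress_group_algebra:
  assumes "S \<in> group_algebra_ops (G \<times>\<times> H)" "complex_linear S'"
    and "entry S' = (\<lambda>h h'. entry S (\<one>\<^bsub>G\<^esub>, h) (\<one>\<^bsub>G\<^esub>, h'))"
  shows "S' \<in> group_algebra_ops H"
proof -
  obtain c F where F: "finite F" "F \<subseteq> carrier G \<times> carrier H" "\<And>g. g \<notin> F \<Longrightarrow> c g = 0"
    "entry S = convolution_matrix (G \<times>\<times> H) c"
    using assms(1) unfolding group_algebra_ops_iff[OF K.is_group] by auto
  have "entry S' = convolution_matrix H (\<lambda>h. c (\<one>\<^bsub>G\<^esub>, h))"
    unfolding assms(3) F(4) by (intro ext) (auto simp: convolution_matrix_def inv_prod)
  moreover have "c (\<one>\<^bsub>G\<^esub>, h) = 0" if "h \<notin> snd ` F" for h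
    by (rule F(3)) (use that in force)
  moreover have "snd ` F \<subseteq> carrier H" using F(2) by auto
  ultimately show ?thesis
    unfolding group_algebra_ops_iff[OF H] using assms(2) F(1)
    by (intro conjI exI[of _ "\<lambda>h. c (\<one>\<^bsub>G\<^esub>, h)"] exI[of _ "snd ` F"]) auto
qed

lemma inj_on_left_mult: "g \<in> carrier G \<Longrightarrow> inj_on (\<lambda>x. g \<otimes>\<^bsub>G\<^esub> x) (carrier G)"
  by (intro inj_onI) simp

lemma shift_tensor_band:
  assumes g: "g \<in> carrier G"
    and "S \<in> band_ops H" "complex_linear S'" "entry S' = shift_tensor (carrier G) (\<lambda>x. g \<otimes>\<^bsub>G\<^esub> x) (entry S)"
  shows "S' \<in> band_ops (G \<times>\<times> H)"
proof -
  obtain F where F: "finite F"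
    "\<And>s t. entry S s t \<noteq> 0 \<Longrightarrow> s \<otimes>\<^bsub>H\<^esub> inv\<^bsub>H\<^esub> t \<in> F"
    "\<And>s t. entry S s t \<noteq> 0 \<Longrightarrow> s \<in> carrier H \<and> t \<in> carrier H"
    using assms(2) unfolding band_ops_def banded_def supported_on_def by auto
  have supp: "s \<in> carrier (G \<times>\<times> H) \<and> t \<in> carrier (G \<times>\<times> H)" if "entry S' s t \<noteq> 0" for s t
    using that F(3) g unfolding assms(4) shift_tensor_def
    by (cases s; cases t) (auto split: if_splits)
  moreover have "s \<otimes>\<^bsub>G \<times>\<times> H\<^esub> inv\<^bsub>G \<times>\<times> H\<^esub> t \<in> {g} \<times> F" if "entry S' s t \<noteq> 0" for s t
    using that F(2) g supp[OF that] unfolding assms(4) shift_tensor_def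
    by (cases s; cases t) (auto split: if_splits simp: inv_prod G.m_assoc)
  ultimately show ?thesis
    using assms(3) F(1) unfolding band_ops_def banded_def supported_on_def
    by (auto intro!: exI[of _ "{g} \<times> F"])
qed

text \<open>
  Tensoring with the left translation by \<open>g\<close> maps the left translation by \<open>h\<close> to that by \<open>(g, h)\<close>.
\<close>

lemma shift_tensor_group_algebra:
  assumes g: "g \<in> carrier G"
    and "S \<in> group_algebra_ops H" "complex_linear S'"
    and "entry S' = shift_tensor (carrier G) (\<lambda>x. g \<otimes>\<^bsub>G\<^esub> x) (entry S)"
  shows "S' \<in> group_algebra_ops (G \<times>\<times> H)"
proof -
  obtain c F where F: "finite F" "F \<subseteq> carrier H" "\<And>g. g \<notin> F \<Longrightarrow> c g = 0"
    "entry S = convolution_matrix H c"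
    using assms(2) unfolding group_algebra_ops_iff[OF H] by auto
  define c' where "c' k = (if fst k = g then c (snd k) else 0)" for k
  have eq: "x = g \<otimes>\<^bsub>G\<^esub> y \<longleftrightarrow> x \<in> carrier G \<and> x \<otimes>\<^bsub>G\<^esub> inv\<^bsub>G\<^esub> y = g" if "y \<in> carrier G" for x y
    using g that by (metis G.inv_solve_right G.m_closed)
  have "entry S' s t = convolution_matrix (G \<times>\<times> H) c' s t" for s t
    unfolding assms(4) F(4) shift_tensor_def
    using g by (cases s; cases t) (auto simp: convolution_matrix_def inv_prod c'_def eq)
  then have "entry S' = convolution_matrix (G \<times>\<times> H) c'" by blast
  moreover have "\<forall>k. k \<notin> {g} \<times> F \<longrightarrow> c' k = 0" using F(3) by (auto simp: c'_def)
  moreover have "{g} \<times> F \<subseteq> carrier (G \<times>\<times> H)" using g F(2) by auto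
  ultimately show ?thesis
    unfolding group_algebra_ops_iff[OF K.is_group] using assms(3) F(1)
    by (intro conjI exI[of _ c'] exI[of _ "{g} \<times> F"]) auto
qed

text \<open>
  The compression of \<open>1 \<otimes> T\<close> to the functions on \<open>{1} \<times> H\<close> is \<open>T\<close> again.
\<close>

lemma ITAP_right_factor:
  assumes cG: "countable (carrier G)" and cH: "countable (carrier H)"
    and ITAP: "has_ITAP (G \<times>\<times> H)"
  shows "has_ITAP H"
  unfolding has_ITAP_iff[OF H cH]
proof (intro ballI impI)
  fix T assume T: "T \<in> closure (band_ops H)" and inv: "translation_invariant H (entry T)"
  have one: "\<one>\<^bsub>G\<^esub> \<in> carrier G" by simp
  have cT: "complex_linear T" by (rule complex_linear_closure[OF T]) (simp add: band_ops_def)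
  have "\<exists>T'\<in>closure (band_ops (G \<times>\<times> H)). complex_linear T' \<and>
      entry T' = shift_tensor (carrier G) (\<lambda>x. \<one>\<^bsub>G\<^esub> \<otimes>\<^bsub>G\<^esub> x) (entry T)"
    by (rule shift_tensor_closure[OF T _ inj_on_left_mult[OF one] shift_tensor_band[OF one]])
      (simp add: band_ops_def)
  then obtain T' where T': "T' \<in> closure (band_ops (G \<times>\<times> H))" "complex_linear T'"
    and e: "entry T' = shift_tensor (carrier G) (\<lambda>x. \<one>\<^bsub>G\<^esub> \<otimes>\<^bsub>G\<^esub> x) (entry T)"
    by blast
  have "translation_invariant (G \<times>\<times> H) (entry T')"
    using inv unfolding translation_invariant_def supported_on_def e shift_tensor_def
    by (auto split: if_splits)
  then have T'red: "T' \<in> closure (group_algebra_ops (G \<times>\<times> H))"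
    using ITAP T'(1) has_ITAP_iff[OF K.is_group] cG cH
    by (simp add: reduced_Cstar_def)
  have "\<exists>T''\<in>closure (group_algebra_ops H). complex_linear T'' \<and>
      entry T'' = (\<lambda>h h'. entry T' (\<one>\<^bsub>G\<^esub>, h) (\<one>\<^bsub>G\<^esub>, h'))"
    by (rule compress_closure[OF T'red _ compress_group_algebra])
      (simp_all add: group_algebra_ops_iff[OF K.is_group])
  then obtain T'' where T'': "T'' \<in> closure (group_algebra_ops H)" "complex_linear T''"
    and e': "entry T'' = (\<lambda>h h'. entry T' (\<one>\<^bsub>G\<^esub>, h) (\<one>\<^bsub>G\<^esub>, h'))"
    by blast
  have "T'' = T" by (rule complex_linear_eqI[OF T''(2) cT]) (simp add: e' e shift_tensor_def)
  then show "T \<in> reduced_Cstar H" using T''(1) by (simp add: reduced_Cstar_def)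
qed

text \<open>
  Invariance identifies the block of \<open>T\<close> from \<open>{x'} \<times> H\<close> to \<open>{g x'} \<times> H\<close> with the one for \<open>x' = 1\<close>, so the
  part of \<open>T\<close> on the diagonal of \<open>g\<close> is the tensor product of the left translation by \<open>g\<close> with this
  single block.  The block inherits invariance under \<open>H\<close>, and the ITAP for \<open>H\<close> applies to it.
\<close>

lemma diagonal_in_reduced_Cstar:
  assumes cG: "countable (carrier G)" and cH: "countable (carrier H)"
    and ITAP: "has_ITAP H"
    and T: "T \<in> closure (band_ops (G \<times>\<times> H))" and inv: "translation_invariant (G \<times>\<times> H) (entry T)"
    and g: "g \<in> carrier G"
  shows "\<exists>S\<in>reduced_Cstar (G \<times>\<times> H). complex_linear S \<and>
    entry S = (\<lambda>s t. if fst s \<otimes>\<^bsub>G\<^esub> inv\<^bsub>G\<^esub> (fst t) = g then entry T s t else 0)"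
proof -
  have shift: "entry T (x \<otimes>\<^bsub>G\<^esub> y, h \<otimes>\<^bsub>H\<^esub> k) (x' \<otimes>\<^bsub>G\<^esub> y, h' \<otimes>\<^bsub>H\<^esub> k) = entry T (x, h) (x', h')"
    if "x \<in> carrier G" "x' \<in> carrier G" "y \<in> carrier G" "h \<in> carrier H" "h' \<in> carrier H" "k \<in> carrier H"
    for x x' y h h' k
    using inv that unfolding translation_invariant_def
    by (metis (no_types, lifting) carrier_DirProd mem_Sigma_iff mult_DirProd)
  have supp: "s \<in> carrier G \<times> carrier H \<and> t \<in> carrier G \<times> carrier H" if "entry T s t \<noteq> 0" for s t
    using inv that unfolding translation_invariant_def supported_on_def carrier_DirProd by blast
  have "\<exists>U\<in>closure (band_ops H). complex_linear U \<and> entry U = (\<lambda>h h'. entry T (g, h) (\<one>\<^bsub>G\<^esub>, h'))"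
    by (rule compress_closure[OF T _ compress_band]) (simp_all add: band_ops_def)
  then obtain U where U: "U \<in> closure (band_ops H)" "complex_linear U"
    and eU: "entry U = (\<lambda>h h'. entry T (g, h) (\<one>\<^bsub>G\<^esub>, h'))"
    by blast
  have "translation_invariant H (entry U)"
    unfolding translation_invariant_def supported_on_def eU
  proof (intro conjI allI impI ballI)
    fix k h h' assume "k \<in> carrier H" "h \<in> carrier H" "h' \<in> carrier H"
    then show "entry T (g, h \<otimes>\<^bsub>H\<^esub> k) (\<one>\<^bsub>G\<^esub>, h' \<otimes>\<^bsub>H\<^esub> k) = entry T (g, h) (\<one>\<^bsub>G\<^esub>, h')"
      using shift[of g "\<one>\<^bsub>G\<^esub>" "\<one>\<^bsub>G\<^esub>" h h' k] g by simp
  qed (use supp in auto)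
  then have Ured: "U \<in> closure (group_algebra_ops H)"
    using ITAP U(1) has_ITAP_iff[OF H cH] by (simp add: reduced_Cstar_def)
  have "\<exists>S\<in>closure (group_algebra_ops (G \<times>\<times> H)). complex_linear S \<and>
      entry S = shift_tensor (carrier G) (\<lambda>x. g \<otimes>\<^bsub>G\<^esub> x) (entry U)"
    by (rule shift_tensor_closure[OF Ured _ inj_on_left_mult[OF g] shift_tensor_group_algebra[OF g]])
      (simp add: group_algebra_ops_iff[OF H])
  then obtain S where S: "S \<in> closure (group_algebra_ops (G \<times>\<times> H))" "complex_linear S"
    and eS: "entry S = shift_tensor (carrier G) (\<lambda>x. g \<otimes>\<^bsub>G\<^esub> x) (entry U)"
    by blast
  have "entry S (x, h) (x', h') = (if x \<otimes>\<^bsub>G\<^esub> inv\<^bsub>G\<^esub> x' = g then entry T (x, h) (x', h') else 0)"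
    for x h x' h'
  proof (cases "x' \<in> carrier G \<and> x = g \<otimes>\<^bsub>G\<^esub> x'")
    case True
    have *: "entry T (g, h) (\<one>\<^bsub>G\<^esub>, h') = entry T (g \<otimes>\<^bsub>G\<^esub> x', h) (x', h')"
    proof (cases "h \<in> carrier H \<and> h' \<in> carrier H")
      case True': True
      then show ?thesis using shift[of g "\<one>\<^bsub>G\<^esub>" x' h h' "\<one>\<^bsub>H\<^esub>"] g True by simp
    next
      case False
      then show ?thesis using supp by (metis mem_Sigma_iff)
    qed
    then show ?thesis using True g by (simp add: eS eU shift_tensor_def G.m_assoc)
  next
    case False
    have "x \<otimes>\<^bsub>G\<^esub> inv\<^bsub>G\<^esub> x' \<noteq> g" if "x \<in> carrier G" "x' \<in> carrier G"
      using False that g by (metis G.inv_solve_right)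
    then have "x \<otimes>\<^bsub>G\<^esub> inv\<^bsub>G\<^esub> x' = g \<Longrightarrow> entry T (x, h) (x', h') = 0" using supp by blast
    then show ?thesis using False by (auto simp: eS shift_tensor_def)
  qed
  then have "entry S = (\<lambda>s t. if fst s \<otimes>\<^bsub>G\<^esub> inv\<^bsub>G\<^esub> (fst t) = g then entry T s t else 0)"
    by (intro ext) (metis prod.collapse)
  then show ?thesis using S unfolding reduced_Cstar_def by blast
qed

end

section \<open>Schur multiplication by coefficient functions\<close>

lemma matrix_bound_supportedI:
  fixes a :: "'a \<Rightarrow> 'a \<Rightarrow> complex"
  assumes X: "supported_on X a" and C: "C \<ge> 0"
    and le: "\<And>Z c. finite Z \<Longrightarrow> Z \<subseteq> X \<Longrightarrow>
      L2_set (\<lambda>s. cmod (\<Sum>t\<in>Z. a s t * c t)) Z \<le> C * L2_set (\<lambda>t. cmod (c t)) Z"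
  shows "matrix_bound a C"
proof (rule matrix_bound_L2I)
  fix E F :: "'a set" and c :: "'a \<Rightarrow> complex" assume fin: "finite E" "finite F"
  have a0: "a s t = 0" if "s \<notin> X \<or> t \<notin> X" for s t
    using X that unfolding supported_on_def by blast
  \<comment> \<open>Rows and columns outside of \<open>X\<close> vanish, and \<open>c\<close> extends by zero to \<open>Z\<close>.\<close>
  define Z where "Z = (E \<union> F) \<inter> X"
  define c' where "c' t = (if t \<in> E then c t else 0)" for t
  have Z: "finite Z" "Z \<subseteq> X" using fin by (auto simp: Z_def)
  have eq: "(\<Sum>t\<in>E. a s t * c t) = (\<Sum>t\<in>Z. a s t * c' t)" for s
    using fin by (intro sum.mono_neutral_cong) (auto simp: Z_def c'_def a0)
  have "L2_set (\<lambda>s. cmod (\<Sum>t\<in>E. a s t * c t)) F = L2_set (\<lambda>s. cmod (\<Sum>t\<in>Z. a s t * c' t)) (F \<inter> X)"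
    unfolding eq using fin by (intro L2_set_neutral) (auto simp: a0)
  also have "\<dots> \<le> L2_set (\<lambda>s. cmod (\<Sum>t\<in>Z. a s t * c' t)) Z"
    using Z by (intro L2_set_subset) (auto simp: Z_def)
  also have "\<dots> \<le> C * L2_set (\<lambda>t. cmod (c' t)) Z" by (rule le[OF Z])
  also have "\<dots> \<le> C * L2_set (\<lambda>t. cmod (c' t)) (E \<union> F)"
    using fin C by (intro mult_left_mono L2_set_subset) (auto simp: Z_def)
  also have "L2_set (\<lambda>t. cmod (c' t)) (E \<union> F) = L2_set (\<lambda>t. cmod (c' t)) E"
    using fin by (intro L2_set_neutral) (auto simp: c'_def)
  also have "\<dots> = L2_set (\<lambda>t. cmod (c t)) E" by (rule L2_set_cong) (auto simp: c'_def)
  finally show "L2_set (\<lambda>s. cmod (\<Sum>t\<in>E. a s t * c t)) F \<le> C * L2_set (\<lambda>t. cmod (c t)) E" .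
qed

text \<open>
  The Schur product with the kernel \<open>u (s\<^sub>1 t\<^sub>1\<inverse>)\<close>.  On the von Neumann algebra of \<open>G \<times> H\<close> it is the
  amplification of the multiplier operator of \<open>u\<close> by the identity.
\<close>

definition schur_fst ::
  "('a, 'm) monoid_scheme \<Rightarrow> ('a \<Rightarrow> complex) \<Rightarrow> ('a \<times> 'b \<Rightarrow> 'a \<times> 'b \<Rightarrow> complex) \<Rightarrow>
    'a \<times> 'b \<Rightarrow> 'a \<times> 'b \<Rightarrow> complex" where
  "schur_fst G u a = (\<lambda>s t. u (fst s \<otimes>\<^bsub>G\<^esub> inv\<^bsub>G\<^esub> (fst t)) * a s t)"

text \<open>
  Unitarity of the left regular representation moves one factor to the right vector,
  \<open>\<langle>\<lambda>(g g'\<inverse>) \<xi>, \<eta>\<rangle> = \<langle>\<lambda>(g'\<inverse>) \<xi>, \<lambda>(g\<inverse>) \<eta>\<rangle>\<close>; this is the inner product of a vector that depends on \<open>g'\<close>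
  and one that depends on \<open>g\<close>, written out in coordinates.
\<close>

lemma coeff_has_sum:
  assumes "group G" and g: "g \<in> carrier G" "g' \<in> carrier G"
  shows "((\<lambda>q. coord \<xi> (g' \<otimes>\<^bsub>G\<^esub> q) * cnj (coord \<eta> (g \<otimes>\<^bsub>G\<^esub> q))) has_sum
    coeff G \<xi> \<eta> (g \<otimes>\<^bsub>G\<^esub> inv\<^bsub>G\<^esub> g')) (carrier G)"
proof -
  interpret group G by fact
  let ?x = "g \<otimes>\<^bsub>G\<^esub> inv\<^bsub>G\<^esub> g'"
  have x: "?x \<in> carrier G" using g by simp
  have "((\<lambda>s. coord (left_reg G ?x \<xi>) s * cnj (coord \<eta> s)) has_sum coeff G \<xi> \<eta> ?x) UNIV"
    using has_sum_infsum[OF cinner_ell2_summable] x by (simp add: coeff_def cinner_ell2.rep_eq)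
  also have "?this \<longleftrightarrow> ((\<lambda>s. coord \<xi> (inv\<^bsub>G\<^esub> ?x \<otimes>\<^bsub>G\<^esub> s) * cnj (coord \<eta> s)) has_sum coeff G \<xi> \<eta> ?x) (carrier G)"
    by (rule has_sum_cong_neutral) (auto simp: left_reg_apply[OF assms(1) x])
  also have "\<dots> \<longleftrightarrow> ((\<lambda>q. coord \<xi> (inv\<^bsub>G\<^esub> ?x \<otimes>\<^bsub>G\<^esub> (g \<otimes>\<^bsub>G\<^esub> q)) * cnj (coord \<eta> (g \<otimes>\<^bsub>G\<^esub> q)))
      has_sum coeff G \<xi> \<eta> ?x) (carrier G)"
  proof (rule has_sum_reindex_bij_betw[symmetric])
    show "bij_betw (\<lambda>q. g \<otimes>\<^bsub>G\<^esub> q) (carrier G) (carrier G)"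
      by (rule bij_betwI[where g = "\<lambda>q. inv\<^bsub>G\<^esub> g \<otimes>\<^bsub>G\<^esub> q"]) (use g in \<open>auto simp: m_assoc[symmetric]\<close>)
  qed
  also have "\<dots> \<longleftrightarrow> ?thesis"
  proof (rule has_sum_cong)
    fix q assume q: "q \<in> carrier G"
    have "inv\<^bsub>G\<^esub> ?x \<otimes>\<^bsub>G\<^esub> (g \<otimes>\<^bsub>G\<^esub> q) = g' \<otimes>\<^bsub>G\<^esub> (inv\<^bsub>G\<^esub> g \<otimes>\<^bsub>G\<^esub> (g \<otimes>\<^bsub>G\<^esub> q))"
      using g q by (simp add: inv_mult_group m_assoc)
    also have "\<dots> = g' \<otimes>\<^bsub>G\<^esub> q" using g q by (simp add: m_assoc[symmetric])
    finally show "coord \<xi> (inv\<^bsub>G\<^esub> ?x \<otimes>\<^bsub>G\<^esub> (g \<otimes>\<^bsub>G\<^esub> q)) * cnj (coord \<eta> (g \<otimes>\<^bsub>G\<^esub> q)) =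
        coord \<xi> (g' \<otimes>\<^bsub>G\<^esub> q) * cnj (coord \<eta> (g \<otimes>\<^bsub>G\<^esub> q))" by simp
  qed
  finally show ?thesis .
qed

text \<open>
  Each translate of \<open>\<xi>\<close> has norm at most \<open>\<parallel>\<xi>\<parallel>\<close>; the sums over \<open>q\<close> and \<open>t\<close> are interchanged to use this.
\<close>

lemma translated_L2_le:
  assumes "group G" and Q: "finite Q" "Q \<subseteq> carrier G" and Z: "\<And>t. t \<in> Z \<Longrightarrow> f t \<in> carrier G"
  shows "L2_set (\<lambda>q. L2_set (\<lambda>t. cmod (coord \<xi> (f t \<otimes>\<^bsub>G\<^esub> q) * c t)) Z) Q
    \<le> norm \<xi> * L2_set (\<lambda>t. cmod (c t)) Z"
proof -
  interpret group G by fact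
  have row: "(\<Sum>q\<in>Q. (cmod (coord \<xi> (f t \<otimes>\<^bsub>G\<^esub> q)))\<^sup>2) \<le> (norm \<xi>)\<^sup>2" if "t \<in> Z" for t
  proof -
    have "inj_on (\<lambda>q. f t \<otimes>\<^bsub>G\<^esub> q) (carrier G)" using Z[OF that] by (intro inj_onI) simp
    then have "inj_on (\<lambda>q. f t \<otimes>\<^bsub>G\<^esub> q) Q" using Q(2) by (rule inj_on_subset)
    then have "(\<Sum>q\<in>Q. (cmod (coord \<xi> (f t \<otimes>\<^bsub>G\<^esub> q)))\<^sup>2)
        = (L2_set (\<lambda>s. cmod (coord \<xi> s)) ((\<lambda>q. f t \<otimes>\<^bsub>G\<^esub> q) ` Q))\<^sup>2"
      by (simp add: L2_set_power2 sum.reindex)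
    also have "\<dots> \<le> (norm \<xi>)\<^sup>2" by (intro power_mono L2_set_coord_le) simp
    finally show ?thesis .
  qed
  have "(\<Sum>q\<in>Q. (L2_set (\<lambda>t. cmod (coord \<xi> (f t \<otimes>\<^bsub>G\<^esub> q) * c t)) Z)\<^sup>2)
      = (\<Sum>t\<in>Z. (\<Sum>q\<in>Q. (cmod (coord \<xi> (f t \<otimes>\<^bsub>G\<^esub> q)))\<^sup>2) * (cmod (c t))\<^sup>2)"
    unfolding L2_set_power2 norm_mult power_mult_distrib sum_distrib_right by (rule sum.swap)
  also have "\<dots> \<le> (\<Sum>t\<in>Z. (norm \<xi>)\<^sup>2 * (cmod (c t))\<^sup>2)" by (intro sum_mono mult_right_mono row) auto
  also have "\<dots> = (norm \<xi> * L2_set (\<lambda>t. cmod (c t)) Z)\<^sup>2"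
    by (simp add: L2_set_power2 power_mult_distrib sum_distrib_left)
  finally show ?thesis by (subst L2_set_le_iff) auto
qed

text \<open>
  By \<open>coeff_has_sum\<close> the kernel is an inner product \<open>\<langle>x\<^sub>t, y\<^sub>s\<rangle>\<close> with \<open>\<parallel>x\<^sub>t\<parallel> \<le> \<parallel>\<xi>\<parallel>\<close> and \<open>\<parallel>y\<^sub>s\<parallel> \<le> \<parallel>\<eta>\<parallel>\<close>.  In each
  coordinate \<open>q\<close> of this inner product the bound for \<open>a\<close> applies to the vectors \<open>x\<^sub>t(q) c\<^sub>t\<close> and
  \<open>y\<^sub>s(q) d\<^sub>s\<close>, and the Cauchy--Schwarz inequality sums the results over \<open>q\<close>.
\<close>

lemma matrix_bound_schur_coeff:
  fixes G :: "('a, 'm) monoid_scheme" and a :: "'a \<times> 'b \<Rightarrow> 'a \<times> 'b \<Rightarrow> complex"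
  assumes G: "group G" and a: "supported_on (carrier G \<times> Y) a" and bf: "matrix_bound a C"
  shows "matrix_bound (schur_fst G (coeff G \<xi> \<eta>) a) (norm \<xi> * norm \<eta> * C)"
proof (rule matrix_bound_supportedI)
  show "supported_on (carrier G \<times> Y) (schur_fst G (coeff G \<xi> \<eta>) a)"
    using a unfolding supported_on_def schur_fst_def by auto
  have C: "C \<ge> 0" using matrix_bound_nonneg[OF bf] .
  then show nn: "norm \<xi> * norm \<eta> * C \<ge> 0" by simp
  fix Z and c :: "'a \<times> 'b \<Rightarrow> complex" assume Z: "finite Z" "Z \<subseteq> carrier G \<times> Y"
  then have fst: "fst t \<in> carrier G" if "t \<in> Z" for t using that by auto
  show "L2_set (\<lambda>s. cmod (\<Sum>t\<in>Z. schur_fst G (coeff G \<xi> \<eta>) a s t * c t)) Z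
      \<le> norm \<xi> * norm \<eta> * C * L2_set (\<lambda>t. cmod (c t)) Z"
  proof (rule L2_set_dual)
    show "0 \<le> norm \<xi> * norm \<eta> * C * L2_set (\<lambda>t. cmod (c t)) Z" using nn by simp
    fix d :: "'a \<times> 'b \<Rightarrow> complex"
    define x where "x q t = coord \<xi> (fst t \<otimes>\<^bsub>G\<^esub> q) * c t" for q t
    define y where "y q s = cnj (coord \<eta> (fst s \<otimes>\<^bsub>G\<^esub> q)) * d s" for q s
    let ?f = "\<lambda>q. \<Sum>s\<in>Z. \<Sum>t\<in>Z. a s t * x q t * y q s"
    have "((\<lambda>q. coord \<xi> (fst t \<otimes>\<^bsub>G\<^esub> q) * cnj (coord \<eta> (fst s \<otimes>\<^bsub>G\<^esub> q)) * (a s t * c t * d s))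
        has_sum coeff G \<xi> \<eta> (fst s \<otimes>\<^bsub>G\<^esub> inv\<^bsub>G\<^esub> (fst t)) * (a s t * c t * d s)) (carrier G)"
      if "s \<in> Z" "t \<in> Z" for s t
      by (intro has_sum_cmult_left coeff_has_sum G fst that)
    then have "((\<lambda>q. a s t * x q t * y q s) has_sum
        schur_fst G (coeff G \<xi> \<eta>) a s t * c t * d s) (carrier G)" if "s \<in> Z" "t \<in> Z" for s t
      using that by (simp add: x_def y_def schur_fst_def mult_ac)
    then have hs: "(?f has_sum (\<Sum>s\<in>Z. \<Sum>t\<in>Z. schur_fst G (coeff G \<xi> \<eta>) a s t * c t * d s)) (carrier G)"
      by (intro has_sum_finite_sum Z(1))
    have "norm (infsum ?f (carrier G))
        \<le> norm \<xi> * norm \<eta> * C * L2_set (\<lambda>t. cmod (c t)) Z * L2_set (\<lambda>s. cmod (d s)) Z"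
    proof (rule infsum_norm_le)
      show "?f summable_on carrier G" using hs by (rule has_sum_imp_summable)
      fix Q assume Q: "finite Q" "Q \<subseteq> carrier G"
      have "norm (sum ?f Q) \<le> (\<Sum>q\<in>Q. C * (\<bar>L2_set (\<lambda>t. cmod (x q t)) Z\<bar> * \<bar>L2_set (\<lambda>s. cmod (y q s)) Z\<bar>))"
        using matrix_boundD[OF bf Z(1,1)] by (intro sum_norm_le) (simp add: mult.assoc)
      also have "\<dots> \<le> C * (L2_set (\<lambda>q. L2_set (\<lambda>t. cmod (x q t)) Z) Q * L2_set (\<lambda>q. L2_set (\<lambda>s. cmod (y q s)) Z) Q)"
        unfolding sum_distrib_left[symmetric] by (intro mult_left_mono L2_set_mult_ineq C)
      also have "\<dots> \<le> C * ((norm \<xi> * L2_set (\<lambda>t. cmod (c t)) Z) * (norm \<eta> * L2_set (\<lambda>s. cmod (d s)) Z))"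
      proof (intro mult_left_mono mult_mono C)
        show "L2_set (\<lambda>q. L2_set (\<lambda>t. cmod (x q t)) Z) Q \<le> norm \<xi> * L2_set (\<lambda>t. cmod (c t)) Z"
          unfolding x_def by (rule translated_L2_le[OF G Q fst])
        show "L2_set (\<lambda>q. L2_set (\<lambda>s. cmod (y q s)) Z) Q \<le> norm \<eta> * L2_set (\<lambda>s. cmod (d s)) Z"
          using translated_L2_le[OF G Q fst, where \<xi> = \<eta> and c = d] by (simp add: y_def norm_mult)
      qed auto
      finally show "norm (sum ?f Q)
          \<le> norm \<xi> * norm \<eta> * C * L2_set (\<lambda>t. cmod (c t)) Z * L2_set (\<lambda>s. cmod (d s)) Z"
        by (simp add: mult_ac)
    qed
    then show "cmod (\<Sum>s\<in>Z. (\<Sum>t\<in>Z. schur_fst G (coeff G \<xi> \<eta>) a s t * c t) * d s)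
        \<le> norm \<xi> * norm \<eta> * C * L2_set (\<lambda>t. cmod (c t)) Z * L2_set (\<lambda>s. cmod (d s)) Z"
      using infsumI[OF hs] by (simp add: sum_distrib_right)
  qed
qed

section \<open>Completely bounded multipliers as Schur multipliers\<close>

lemma cinner_ket: "cinner_ell2 x (ket s) = coord x s"
proof -
  have "cinner_ell2 x (ket s) = (\<Sum>\<^sub>\<infinity>r\<in>{s}. coord x s)"
    unfolding cinner_ell2.rep_eq by (rule infsum_cong_neutral) (auto simp: ket.rep_eq)
  then show ?thesis by simp
qed

lemma cinner_scaleC: "cinner_ell2 (scaleC_ell2 c x) y = c * cinner_ell2 x y"
  by (simp add: cinner_ell2.rep_eq scaleC_ell2.rep_eq mult.assoc infsum_cmult_right')

lemma cinner_ell2_add: "cinner_ell2 (x + y) z = cinner_ell2 x z + cinner_ell2 y z"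
  by (simp add: cinner_ell2.rep_eq plus_ell2.rep_eq distrib_right infsum_add cinner_ell2_summable)

lemma continuous_map_wot:
  "continuous_map weak_operator_topology euclidean (\<lambda>T. cinner_ell2 (blinfun_apply T \<xi>) \<eta>)"
proof -
  have "continuous_map euclidean euclidean (\<lambda>f :: 'a ell2 \<times> 'a ell2 \<Rightarrow> complex. f (\<xi>, \<eta>))"
    using continuous_on_product_coordinates[of "(\<xi>, \<eta>)"] by simp
  from continuous_map_pullback[OF this, of UNIV
      "\<lambda>T (\<xi>, \<eta>). cinner_ell2 (blinfun_apply (T :: 'a ell2 \<Rightarrow>\<^sub>L 'a ell2) \<xi>) \<eta>"]
  show ?thesis by (simp add: weak_operator_topology_def o_def)
qed

lemma topspace_wot: "topspace weak_operator_topology = UNIV"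
  by (simp add: weak_operator_topology_def topspace_pullback_topology)

lemma group_algebra_subset_vN: "group_algebra_ops G \<subseteq> group_vN G"
  unfolding group_vN_def by (rule closure_of_subset) (simp add: topspace_wot)

text \<open>
  The left translation by \<open>1\<close> is the projection onto the functions on the carrier.  Both sides are
  continuous in \<open>S\<close> for the weak operator topology, so it suffices to compare them on the group algebra.
\<close>

lemma group_vN_corner:
  assumes "group G" and S: "S \<in> group_vN G"
  shows "cinner_ell2 (S \<xi>) \<eta> = cinner_ell2 (S (left_reg G \<one>\<^bsub>G\<^esub> \<xi>)) (left_reg G \<one>\<^bsub>G\<^esub> \<eta>)"
proof -
  interpret group G by fact
  let ?p = "left_reg G \<one>\<^bsub>G\<^esub>"
  let ?W = "{T. cinner_ell2 (blinfun_apply T \<xi>) \<eta> = cinner_ell2 (T (?p \<xi>)) (?p \<eta>)}"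
  have p: "coord (?p x) s = (if s \<in> carrier G then coord x s else 0)" for x s
    by (simp add: left_reg_apply[OF assms(1)])
  have "closedin weak_operator_topology {T \<in> topspace weak_operator_topology.
      cinner_ell2 (blinfun_apply T \<xi>) \<eta> = cinner_ell2 (T (?p \<xi>)) (?p \<eta>)}"
    by (rule closedin_continuous_maps_eq[OF _ continuous_map_wot continuous_map_wot]) simp
  then have "closedin weak_operator_topology ?W" by (simp add: topspace_wot)
  moreover have "group_algebra_ops G \<subseteq> ?W"
  proof
    fix T assume T: "T \<in> group_algebra_ops G"
    then obtain c where c: "complex_linear T" "entry T = convolution_matrix G c"
      unfolding group_algebra_ops_iff[OF assms(1)] by blast
    have e: "entry T s t = 0" if "s \<notin> carrier G \<or> t \<notin> carrier G" for s t
      using that by (auto simp: c(2) convolution_matrix_def)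
    have z: "coord (T \<xi>) s = 0" if "s \<notin> carrier G" for s
      using that by (simp add: complex_linear_apply[OF c(1)] e)
    have "coord (T (?p \<xi>)) s = coord (T \<xi>) s" for s
    proof -
      have "entry T s t * coord (?p \<xi>) t = entry T s t * coord \<xi> t" for t
        by (cases "t \<in> carrier G") (simp_all add: e p)
      then show "coord (T (?p \<xi>)) s = coord (T \<xi>) s"
        unfolding complex_linear_apply[OF c(1)] by (intro infsum_cong)
    qed
    then have "coord (T \<xi>) s * cnj (coord \<eta> s) = coord (T (?p \<xi>)) s * cnj (coord (?p \<eta>) s)" for s
      by (cases "s \<in> carrier G") (simp_all add: p z)
    then show "T \<in> ?W" by (simp add: cinner_ell2.rep_eq)
  qed
  ultimately have "group_vN G \<subseteq> ?W" unfolding group_vN_def by (intro closure_of_minimal)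
  then show ?thesis using S by auto
qed

lemma group_vN_eqI:
  assumes G: "group G" and S: "S \<in> group_vN G" "S' \<in> group_vN G"
    and eq: "\<And>\<xi> \<eta>. \<xi> \<in> ell2_on G \<Longrightarrow> \<eta> \<in> ell2_on G \<Longrightarrow> cinner_ell2 (S \<xi>) \<eta> = cinner_ell2 (S' \<xi>) \<eta>"
  shows "S = S'"
proof -
  interpret group G by fact
  have p: "left_reg G \<one>\<^bsub>G\<^esub> \<xi> \<in> ell2_on G" for \<xi>
    by (simp add: ell2_on_def left_reg_apply[OF G])
  have "cinner_ell2 (S \<xi>) \<eta> = cinner_ell2 (S' \<xi>) \<eta>" for \<xi> \<eta>
    using group_vN_corner[OF G S(1), of \<xi> \<eta>] group_vN_corner[OF G S(2), of \<xi> \<eta>] eq[OF p p] by simp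
  from this[of _ "ket _"] show ?thesis
    unfolding cinner_ket by (intro blinfun_eqI ell2_eqI) blast
qed

text \<open>
  At most one \<open>S\<close> satisfies the defining property of the multiplier operator: since \<open>u\<close> multiplies the
  Fourier algebra into itself, the property determines all matrix coefficients of \<open>S\<close>.
\<close>

lemma multiplier_op_eqI:
  fixes G :: "('a, 'm) monoid_scheme" and S T :: "'a ell2 \<Rightarrow>\<^sub>L 'a ell2"
  assumes G: "group G" and u: "fourier_multiplier G u" and S: "S \<in> group_vN G"
    and eq: "\<And>\<xi> \<eta> \<xi>' \<eta>'. coeff G \<xi>' \<eta>' = (\<lambda>x. u x * coeff G \<xi> \<eta> x) \<Longrightarrow>
      cinner_ell2 (S \<xi>) \<eta> = cinner_ell2 (T \<xi>') \<eta>'"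
  shows "multiplier_op G u T = S"
  unfolding multiplier_op_def
proof (rule the_equality)
  show "S \<in> group_vN G \<and> (\<forall>\<xi>\<in>ell2_on G. \<forall>\<eta>\<in>ell2_on G. \<forall>\<xi>'\<in>ell2_on G. \<forall>\<eta>'\<in>ell2_on G.
           coeff G \<xi>' \<eta>' = (\<lambda>x. u x * coeff G \<xi> \<eta> x) \<longrightarrow>
           cinner_ell2 (S \<xi>) \<eta> = cinner_ell2 (T \<xi>') \<eta>')"
    using S eq by blast
  fix S' assume S': "S' \<in> group_vN G \<and> (\<forall>\<xi>\<in>ell2_on G. \<forall>\<eta>\<in>ell2_on G. \<forall>\<xi>'\<in>ell2_on G. \<forall>\<eta>'\<in>ell2_on G.
           coeff G \<xi>' \<eta>' = (\<lambda>x. u x * coeff G \<xi> \<eta> x) \<longrightarrow>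
           cinner_ell2 (S' \<xi>) \<eta> = cinner_ell2 (T \<xi>') \<eta>')"
  show "S' = S"
  proof (rule group_vN_eqI[OF G _ S])
    fix \<xi> \<eta> :: "'a ell2" assume \<xi>\<eta>: "\<xi> \<in> ell2_on G" "\<eta> \<in> ell2_on G"
    then have "coeff G \<xi> \<eta> \<in> fourier_algebra G" unfolding fourier_algebra_def by blast
    then have "(\<lambda>x. u x * coeff G \<xi> \<eta> x) \<in> fourier_algebra G"
      using u unfolding fourier_multiplier_def by blast
    then obtain \<xi>' \<eta>' where *: "\<xi>' \<in> ell2_on G" "\<eta>' \<in> ell2_on G"
      "coeff G \<xi>' \<eta>' = (\<lambda>x. u x * coeff G \<xi> \<eta> x)"
      unfolding fourier_algebra_def by (elim CollectE exE conjE) simp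
    then have "cinner_ell2 (S' \<xi>) \<eta> = cinner_ell2 (T \<xi>') \<eta>'" using S' \<xi>\<eta> by blast
    also have "\<dots> = cinner_ell2 (S \<xi>) \<eta>" using eq[OF *(3)] by simp
    finally show "cinner_ell2 (S' \<xi>) \<eta> = cinner_ell2 (S \<xi>) \<eta>" .
  qed (use S' in blast)
qed

lemma scaled_left_reg_in_group_algebra:
  "g \<in> carrier G \<Longrightarrow> scalar_op c o\<^sub>L left_reg G g \<in> group_algebra_ops G"
  unfolding group_algebra_ops_def by (auto intro!: exI[of _ "{g}"] exI[of _ "\<lambda>_. c"])

lemma multiplier_op_left_reg:
  assumes G: "group G" and u: "fourier_multiplier G u" and g: "g \<in> carrier G"
  shows "multiplier_op G u (scalar_op c o\<^sub>L left_reg G g) = scalar_op (u g * c) o\<^sub>L left_reg G g"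
proof (rule multiplier_op_eqI[OF G u])
  show "scalar_op (u g * c) o\<^sub>L left_reg G g \<in> group_vN G"
    using scaled_left_reg_in_group_algebra[OF g] group_algebra_subset_vN by blast
  fix \<xi> \<eta> \<xi>' \<eta>' assume "coeff G \<xi>' \<eta>' = (\<lambda>x. u x * coeff G \<xi> \<eta> x)"
  from fun_cong[OF this, of g] have "cinner_ell2 (left_reg G g \<xi>') \<eta>' = u g * cinner_ell2 (left_reg G g \<xi>) \<eta>"
    using g by (simp add: coeff_def)
  then show "cinner_ell2 (blinfun_apply (scalar_op (u g * c) o\<^sub>L left_reg G g) \<xi>) \<eta> =
      cinner_ell2 (blinfun_apply (scalar_op c o\<^sub>L left_reg G g) \<xi>') \<eta>'"
    by (simp add: scalar_op.rep_eq cinner_scaleC)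
qed

text \<open>
  The pairing of the von Neumann algebra with the Fourier algebra depends on the coefficient function
  only; this holds on the group algebra and passes to the weak closure.
\<close>

lemma group_vN_annihilates:
  assumes G: "group G" and T: "T \<in> group_vN G" and c0: "coeff G \<xi> \<eta> = (\<lambda>_. 0)"
  shows "cinner_ell2 (T \<xi>) \<eta> = 0"
proof -
  let ?W = "{T. cinner_ell2 (blinfun_apply T \<xi>) \<eta> = 0}"
  have "closedin weak_operator_topology {T \<in> topspace weak_operator_topology.
      cinner_ell2 (blinfun_apply T \<xi>) \<eta> = 0}"
    by (rule closedin_continuous_maps_eq[OF _ continuous_map_wot]) simp_all
  then have "closedin weak_operator_topology ?W" by (simp add: topspace_wot)
  moreover have "group_algebra_ops G \<subseteq> ?W"
  proof
    fix S assume "S \<in> group_algebra_ops G"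
    then obtain F c where F: "F \<subseteq> carrier G" and S: "S = (\<Sum>g\<in>F. scalar_op (c g) o\<^sub>L left_reg G g)"
      unfolding group_algebra_ops_def by blast
    have "cinner_ell2 (left_reg G g \<xi>) \<eta> = 0" if "g \<in> F" for g
      using fun_cong[OF c0, of g] F that by (auto simp: coeff_def split: if_splits)
    moreover have "cinner_ell2 0 \<eta> = 0" by (simp add: cinner_ell2.rep_eq coord_simps)
    ultimately have "cinner_ell2 (S \<xi>) \<eta> = 0"
      unfolding S
      by (induction F rule: infinite_finite_induct)
        (simp_all add: blinfun.sum_left blinfun.add_left cinner_ell2_add cinner_scaleC scalar_op.rep_eq)
    then show "S \<in> ?W" by simp
  qed
  ultimately have "group_vN G \<subseteq> ?W" unfolding group_vN_def by (intro closure_of_minimal)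
  then show ?thesis using T by auto
qed

lemma zero_fourier_multiplier: "fourier_multiplier G (\<lambda>_. 0)"
proof -
  have c0: "coeff G 0 0 = (\<lambda>_. 0)"
    by (auto simp: coeff_def cinner_ell2.rep_eq coord_simps)
  have "(0 :: 'a ell2) \<in> ell2_on G" by (simp add: ell2_on_def coord_simps)
  then have "(\<lambda>_. 0) \<in> fourier_algebra G" unfolding fourier_algebra_def using c0 by force
  then show ?thesis by (simp add: fourier_multiplier_def)
qed

lemma multiplier_op_zero:
  assumes G: "group G" and T: "T \<in> group_vN G"
  shows "multiplier_op G (\<lambda>_. 0) T = 0"
proof (rule multiplier_op_eqI[OF G zero_fourier_multiplier])
  have "0 \<in> group_algebra_ops G"
    unfolding group_algebra_ops_def by (auto intro!: exI[of _ "{}"])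
  then show "0 \<in> group_vN G" using group_algebra_subset_vN by blast
  fix \<xi> \<eta> \<xi>' \<eta>' assume "coeff G \<xi>' \<eta>' = (\<lambda>x. 0 * coeff G \<xi> \<eta> x)"
  then show "cinner_ell2 (blinfun_apply 0 \<xi>) \<eta> = cinner_ell2 (T \<xi>') \<eta>'"
    using group_vN_annihilates[OF G T, of \<xi>' \<eta>'] by (simp add: cinner_ell2.rep_eq coord_simps)
qed

lemma opmat_norm_set_bdd:
  "bdd_above {L2_set (\<lambda>i. norm (\<Sum>j<n. T i j (\<xi> j))) {..<n} | \<xi>. L2_set (\<lambda>j. norm (\<xi> j)) {..<n} \<le> 1}"
  for T :: "nat \<Rightarrow> nat \<Rightarrow> 'a ell2 \<Rightarrow>\<^sub>L 'a ell2"
proof (rule bdd_aboveI, clarify)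
  fix \<xi> :: "nat \<Rightarrow> 'a ell2" assume \<xi>: "L2_set (\<lambda>j. norm (\<xi> j)) {..<n} \<le> 1"
  have "norm (\<xi> j) \<le> 1" if "j < n" for j
    using member_le_L2_set[of "{..<n}" j "\<lambda>j. norm (\<xi> j)"] that \<xi> by simp
  then have "norm (T i j (\<xi> j)) \<le> norm (T i j)" if "j < n" for i j
    using norm_blinfun[of "T i j" "\<xi> j"] that
    by (meson mult_left_le norm_ge_zero order_trans)
  then have "norm (\<Sum>j<n. T i j (\<xi> j)) \<le> (\<Sum>j<n. norm (T i j))" for i
    by (intro sum_norm_le) auto
  then show "L2_set (\<lambda>i. norm (\<Sum>j<n. T i j (\<xi> j))) {..<n} \<le> (\<Sum>i<n. \<Sum>j<n. norm (T i j))"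
    by (intro order_trans[OF L2_set_le_sum] sum_mono) auto
qed

text \<open>
  The norm is defined as a supremum over the unit ball; homogeneity extends the estimate to all
  vectors.
\<close>

lemma opmat_norm_bound:
  fixes T :: "nat \<Rightarrow> nat \<Rightarrow> 'a ell2 \<Rightarrow>\<^sub>L 'a ell2"
  shows "L2_set (\<lambda>i. norm (\<Sum>j<n. T i j (\<xi> j))) {..<n} \<le> opmat_norm n T * L2_set (\<lambda>j. norm (\<xi> j)) {..<n}"
proof -
  let ?r = "L2_set (\<lambda>j. norm (\<xi> j)) {..<n}"
  show ?thesis
  proof (cases "?r = 0")
    case True
    then have "\<xi> j = 0" if "j < n" for j using that by (simp add: L2_set_eq_0_iff)
    then show ?thesis using True by (simp add: L2_set_def)
  next
    case False
    then have r: "?r > 0" using L2_set_nonneg[of "\<lambda>j. norm (\<xi> j)" "{..<n}"] by linarith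
    define \<xi>' where "\<xi>' j = (1 / ?r) *\<^sub>R \<xi> j" for j
    have "L2_set (\<lambda>j. norm (\<xi>' j)) {..<n} = 1"
      using L2_set_left_distrib[of "1 / ?r" "\<lambda>j. norm (\<xi> j)" "{..<n}"] r by (simp add: \<xi>'_def)
    then have "L2_set (\<lambda>i. norm (\<Sum>j<n. T i j (\<xi>' j))) {..<n} \<le> opmat_norm n T"
      unfolding opmat_norm_def by (intro cSup_upper opmat_norm_set_bdd) (auto intro!: exI[of _ \<xi>'])
    moreover have "norm (\<Sum>j<n. T i j (\<xi>' j)) = norm (\<Sum>j<n. T i j (\<xi> j)) * (1 / ?r)" for i
      using r by (simp add: \<xi>'_def blinfun.scaleR_right scaleR_right.sum[symmetric])
    ultimately have "L2_set (\<lambda>i. norm (\<Sum>j<n. T i j (\<xi> j))) {..<n} * (1 / ?r) \<le> opmat_norm n T"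
      using L2_set_left_distrib[of "1 / ?r" "\<lambda>i. norm (\<Sum>j<n. T i j (\<xi> j))" "{..<n}"] r by simp
    then show ?thesis using r by (simp add: field_simps)
  qed
qed

lemma opmat_norm_le:
  fixes T :: "nat \<Rightarrow> nat \<Rightarrow> 'a ell2 \<Rightarrow>\<^sub>L 'a ell2"
  assumes "\<And>\<xi>. L2_set (\<lambda>j. norm (\<xi> j)) {..<n} \<le> 1 \<Longrightarrow> L2_set (\<lambda>i. norm (\<Sum>j<n. T i j (\<xi> j))) {..<n} \<le> B"
  shows "opmat_norm n T \<le> B"
  unfolding opmat_norm_def
proof (rule cSup_least)
  show "{L2_set (\<lambda>i. norm (\<Sum>j<n. T i j (\<xi> j))) {..<n} | \<xi>. L2_set (\<lambda>j. norm (\<xi> j)) {..<n} \<le> 1} \<noteq> {}"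
    by (auto intro!: exI[of _ "\<lambda>_. 0"] simp: L2_set_def)
qed (use assms in auto)

text \<open>
  This makes the unit ball of multipliers non-empty, so that the supremum in the norm of \<open>Q(G)\<close>
  can be bounded termwise.
\<close>

lemma zero_cb_multiplier:
  fixes G :: "('a, 'm) monoid_scheme"
  assumes G: "group G"
  shows "(\<lambda>_. 0) \<in> cb_multipliers G" "cb_multiplier_norm G (\<lambda>_. 0) \<le> 1"
proof -
  have *: "r \<le> 1" if "r \<in> amplification_norms G (\<lambda>_. 0)" for r
    using that unfolding amplification_norms_def
  proof clarify
    fix n and T :: "nat \<Rightarrow> nat \<Rightarrow> 'a ell2 \<Rightarrow>\<^sub>L 'a ell2" assume "\<forall>i<n. \<forall>j<n. T i j \<in> group_vN G"
    then show "opmat_norm n (\<lambda>i j. multiplier_op G (\<lambda>_. 0) (T i j)) \<le> 1"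
      by (intro opmat_norm_le) (simp add: multiplier_op_zero[OF G] L2_set_def)
  qed
  then have "bdd_above (amplification_norms G (\<lambda>_. 0))" by (rule bdd_aboveI)
  then show "(\<lambda>_. 0) \<in> cb_multipliers G"
    unfolding cb_multipliers_def using zero_fourier_multiplier by blast
  have "opmat_norm 0 (\<lambda>i j. multiplier_op G (\<lambda>_. 0) 0) \<in> amplification_norms G (\<lambda>_. 0)"
    unfolding amplification_norms_def
    by (intro CollectI exI[of _ 0] exI[of _ "\<lambda>i j. 0"] conjI refl opmat_norm_le) auto
  then show "cb_multiplier_norm G (\<lambda>_. 0) \<le> 1"
    unfolding cb_multiplier_norm_def using * by (intro cSup_least) auto
qed

lemma norm_left_reg_le:
  assumes "group G" "g \<in> carrier G"
  shows "norm (left_reg G g \<xi>) \<le> norm \<xi>"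
proof -
  interpret group G by fact
  have inj: "inj_on (\<lambda>s. inv\<^bsub>G\<^esub> g \<otimes>\<^bsub>G\<^esub> s) (carrier G)" using assms(2) by (intro inj_onI) simp
  show ?thesis
    using pull_ell2_aux(2)[OF inj, of \<xi>] by (simp add: norm_ell2_def left_reg_apply[OF assms])
qed

text \<open>
  A scalar matrix acts on a column of vectors coordinatewise, with the same norm.
\<close>

lemma L2_norm_matrix_action:
  fixes \<eta> :: "nat \<Rightarrow> 'a ell2"
  assumes a: "\<And>c. L2_set (\<lambda>i. cmod (\<Sum>j<n. a i j * c j)) {..<n} \<le> L2_set (\<lambda>j. cmod (c j)) {..<n}"
  shows "L2_set (\<lambda>i. norm (\<Sum>j<n. scaleC_ell2 (a i j) (\<eta> j))) {..<n} \<le> L2_set (\<lambda>j. norm (\<eta> j)) {..<n}"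
proof -
  let ?y = "\<lambda>i. \<Sum>j<n. scaleC_ell2 (a i j) (\<eta> j)"
  have l: "((\<lambda>s. \<Sum>i<n. (cmod (coord (?y i) s))\<^sup>2) has_sum (\<Sum>i<n. (norm (?y i))\<^sup>2)) UNIV"
    unfolding norm_ell2_power2 by (intro has_sum_finite_sum has_sum_infsum coord_summable) simp
  have r: "((\<lambda>s. \<Sum>j<n. (cmod (coord (\<eta> j) s))\<^sup>2) has_sum (\<Sum>j<n. (norm (\<eta> j))\<^sup>2)) UNIV"
    unfolding norm_ell2_power2 by (intro has_sum_finite_sum has_sum_infsum coord_summable) simp
  have "(\<Sum>i<n. (norm (?y i))\<^sup>2) \<le> (\<Sum>j<n. (norm (\<eta> j))\<^sup>2)"
  proof (rule has_sum_mono[OF l r])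
    fix s
    have "(L2_set (\<lambda>i. cmod (\<Sum>j<n. a i j * coord (\<eta> j) s)) {..<n})\<^sup>2
        \<le> (L2_set (\<lambda>j. cmod (coord (\<eta> j) s)) {..<n})\<^sup>2"
      by (intro power_mono a) simp
    then show "(\<Sum>i<n. (cmod (coord (?y i) s))\<^sup>2) \<le> (\<Sum>j<n. (cmod (coord (\<eta> j) s))\<^sup>2)"
      by (simp add: L2_set_power2 coord_simps)
  qed
  then show ?thesis unfolding L2_set_def by (rule real_sqrt_le_mono)
qed

lemma left_reg_apply_inv:
  assumes "group G" "g \<in> carrier G" "g' \<in> carrier G"
  shows "left_reg G (g \<otimes>\<^bsub>G\<^esub> inv\<^bsub>G\<^esub> g') \<xi> = left_reg G g (left_reg G (inv\<^bsub>G\<^esub> g') \<xi>)"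
proof -
  interpret group G by fact
  show ?thesis
    using assms(2,3) by (intro ell2_eqI) (auto simp: left_reg_apply[OF assms(1)] inv_mult_group m_assoc)
qed

text \<open>
  The operator matrix equals \<open>D (a \<otimes> 1) D\<^sup>*\<close>, where \<open>D\<close> is diagonal with the left translations by \<open>g i\<close>
  as its entries.
\<close>

lemma opmat_norm_translations_le:
  assumes G: "group G" and g: "\<And>i. i < n \<Longrightarrow> g i \<in> carrier G"
    and a: "\<And>c. L2_set (\<lambda>i. cmod (\<Sum>j<n. a i j * c j)) {..<n} \<le> L2_set (\<lambda>j. cmod (c j)) {..<n}"
  shows "opmat_norm n (\<lambda>i j. scalar_op (a i j) o\<^sub>L left_reg G (g i \<otimes>\<^bsub>G\<^esub> inv\<^bsub>G\<^esub> (g j))) \<le> 1"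
proof (rule opmat_norm_le)
  interpret group G by fact
  fix \<xi> :: "nat \<Rightarrow> 'a ell2" assume \<xi>: "L2_set (\<lambda>j. norm (\<xi> j)) {..<n} \<le> 1"
  define \<eta> where "\<eta> j = left_reg G (inv\<^bsub>G\<^esub> (g j)) (\<xi> j)" for j
  have "norm (\<Sum>j<n. blinfun_apply (scalar_op (a i j) o\<^sub>L left_reg G (g i \<otimes>\<^bsub>G\<^esub> inv\<^bsub>G\<^esub> (g j))) (\<xi> j))
      \<le> norm (\<Sum>j<n. scaleC_ell2 (a i j) (\<eta> j))" if i: "i < n" for i
  proof -
    have "(\<Sum>j<n. blinfun_apply (scalar_op (a i j) o\<^sub>L left_reg G (g i \<otimes>\<^bsub>G\<^esub> inv\<^bsub>G\<^esub> (g j))) (\<xi> j))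
        = left_reg G (g i) (\<Sum>j<n. scaleC_ell2 (a i j) (\<eta> j))"
      using complex_linear_left_reg[OF G g[OF i]] g i
      by (auto simp: blinfun.sum_right complex_linear_def \<eta>_def left_reg_apply_inv[OF G] scalar_op.rep_eq intro!: sum.cong)
    then show ?thesis using norm_left_reg_le[OF G g[OF i]] by simp
  qed
  then have "L2_set (\<lambda>i. norm (\<Sum>j<n. blinfun_apply (scalar_op (a i j) o\<^sub>L left_reg G (g i \<otimes>\<^bsub>G\<^esub> inv\<^bsub>G\<^esub> (g j))) (\<xi> j))) {..<n}
      \<le> L2_set (\<lambda>i. norm (\<Sum>j<n. scaleC_ell2 (a i j) (\<eta> j))) {..<n}"
    by (intro L2_set_mono) auto
  also have "\<dots> \<le> L2_set (\<lambda>j. norm (\<eta> j)) {..<n}" by (rule L2_norm_matrix_action[OF a])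
  also have "\<dots> \<le> L2_set (\<lambda>j. norm (\<xi> j)) {..<n}"
    unfolding \<eta>_def using g by (intro L2_set_mono norm_left_reg_le[OF G]) auto
  finally show "L2_set (\<lambda>i. norm (\<Sum>j<n. blinfun_apply (scalar_op (a i j) o\<^sub>L left_reg G (g i \<otimes>\<^bsub>G\<^esub> inv\<^bsub>G\<^esub> (g j))) (\<xi> j))) {..<n} \<le> 1"
    using \<xi> by simp
qed

lemma left_reg_ket:
  assumes "group G" "g \<in> carrier G" "g' \<in> carrier G"
  shows "left_reg G (g \<otimes>\<^bsub>G\<^esub> inv\<^bsub>G\<^esub> g') (ket g') = ket g"
proof (rule ell2_eqI)
  interpret group G by fact
  fix s
  have "s \<otimes>\<^bsub>G\<^esub> inv\<^bsub>G\<^esub> g' = g \<otimes>\<^bsub>G\<^esub> inv\<^bsub>G\<^esub> g' \<longleftrightarrow> s = g" if "s \<in> carrier G"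
    using assms(2,3) that by simp
  moreover have "coord (left_reg G (g \<otimes>\<^bsub>G\<^esub> inv\<^bsub>G\<^esub> g') (ket g')) s
      = (if s \<in> carrier G \<and> s \<otimes>\<^bsub>G\<^esub> inv\<^bsub>G\<^esub> g' = g \<otimes>\<^bsub>G\<^esub> inv\<^bsub>G\<^esub> g' then 1 else 0)"
    using entry_left_reg[OF assms(1), of "g \<otimes>\<^bsub>G\<^esub> inv\<^bsub>G\<^esub> g'" s g'] assms(2,3) by (simp add: entry_def)
  ultimately show "coord (left_reg G (g \<otimes>\<^bsub>G\<^esub> inv\<^bsub>G\<^esub> g') (ket g')) s = coord (ket g) s"
    using assms(2) by (auto simp: ket.rep_eq)
qed

lemma norm_ket: "norm (ket t) = 1"
  by (subst norm_finite_support[of "{t}"]) (auto simp: ket.rep_eq)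

text \<open>
  Schur multiplication by a completely bounded multiplier is bounded by its norm.  For indices
  \<open>e 0, \<dots>, e (n - 1)\<close> in \<open>G \<times> Y\<close> with first components \<open>g i\<close>, the operator matrix with entries
  \<open>a (e i) (e j) \<lambda>(g i g j\<inverse>)\<close> has at most the norm of the scalar matrix by \<open>opmat_norm_translations_le\<close>,
  and the multiplier operator turns the scalars into the entries of the Schur product.  The \<open>g i\<close> may
  coincide, so the second components enter without any operator-valued coefficients.
\<close>

lemma matrix_bound_schur_cb:
  assumes G: "group G" and u: "u \<in> cb_multipliers G"
    and a: "supported_on (carrier G \<times> Y) a" and bf: "matrix_bound a C" and C: "C > 0"
  shows "matrix_bound (schur_fst G u a) (cb_multiplier_norm G u * C)"
proof -
  interpret group G by (rule G)
  have fm: "fourier_multiplier G u" and bdd: "bdd_above (amplification_norms G u)"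
    using u unfolding cb_multipliers_def by auto
  have main: "L2_set (\<lambda>s. cmod (\<Sum>t\<in>Z. schur_fst G u a s t * c t)) Z
      \<le> cb_multiplier_norm G u * C * L2_set (\<lambda>t. cmod (c t)) Z"
    if Z: "finite Z" "Z \<subseteq> carrier G \<times> Y" for Z c
  proof -
    obtain e where e: "bij_betw e {..<card Z} Z"
      using ex_bij_betw_nat_finite[OF Z(1)] by (auto simp: atLeast0LessThan)
    define n where "n = card Z"
    have inj: "inj_on e {..<n}" and img: "e ` {..<n} = Z" using e unfolding n_def bij_betw_def by auto
    define g where "g i = fst (e i)" for i
    have g: "g i \<in> carrier G" if "i < n" for i using that img Z(2) unfolding g_def by force
    have sumZ: "(\<Sum>t\<in>Z. f t) = (\<Sum>j<n. f (e j))" for f :: "_ \<Rightarrow> complex"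
      unfolding img[symmetric] by (simp add: sum.reindex[OF inj])
    have L2Z: "L2_set f Z = L2_set (\<lambda>j. f (e j)) {..<n}" for f
      unfolding img[symmetric] by (rule L2_set_reindex[OF inj])
    define \<alpha> where "\<alpha> i j = a (e i) (e j) / C" for i j
    have \<alpha>: "L2_set (\<lambda>i. cmod (\<Sum>j<n. \<alpha> i j * c j)) {..<n} \<le> L2_set (\<lambda>j. cmod (c j)) {..<n}" for c
    proof -
      define c' where "c' t = c (inv_into {..<n} e t)" for t
      have c': "c' (e j) = c j" if "j < n" for j using inj that by (simp add: c'_def)
      have "L2_set (\<lambda>s. cmod (\<Sum>t\<in>Z. a s t * c' t)) Z \<le> C * L2_set (\<lambda>t. cmod (c' t)) Z"
        by (rule matrix_bound_L2D[OF bf Z(1,1)])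
      then have "L2_set (\<lambda>i. cmod (\<Sum>j<n. a (e i) (e j) * c j)) {..<n} \<le> C * L2_set (\<lambda>j. cmod (c j)) {..<n}"
        unfolding sumZ L2Z by (simp add: c' cong: L2_set_cong_simp)
      then have "L2_set (\<lambda>i. cmod (\<Sum>j<n. a (e i) (e j) * c j)) {..<n} * (1 / C) \<le> L2_set (\<lambda>j. cmod (c j)) {..<n}"
        using C by (simp add: field_simps)
      moreover have "cmod (\<Sum>j<n. \<alpha> i j * c j) = cmod (\<Sum>j<n. a (e i) (e j) * c j) * (1 / C)" for i
        using C by (simp add: \<alpha>_def sum_divide_distrib[symmetric] norm_divide)
      ultimately show ?thesis
        using L2_set_left_distrib[of "1 / C" "\<lambda>i. cmod (\<Sum>j<n. a (e i) (e j) * c j)" "{..<n}"] C by simp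
    qed
    define T where "T i j = scalar_op (\<alpha> i j) o\<^sub>L left_reg G (g i \<otimes>\<^bsub>G\<^esub> inv\<^bsub>G\<^esub> (g j))" for i j
    define S where "S i j = multiplier_op G u (T i j)" for i j
    have T: "T i j \<in> group_vN G" if "i < n" "j < n" for i j
      using scaled_left_reg_in_group_algebra[of "g i \<otimes>\<^bsub>G\<^esub> inv\<^bsub>G\<^esub> (g j)" G "\<alpha> i j"] g that group_algebra_subset_vN
      unfolding T_def by fastforce
    have "opmat_norm n T \<le> 1"
      unfolding T_def by (rule opmat_norm_translations_le[OF G g \<alpha>])
    then have "opmat_norm n S \<in> amplification_norms G u"
      unfolding amplification_norms_def S_def using T by blast
    then have Sn: "opmat_norm n S \<le> cb_multiplier_norm G u"
      unfolding cb_multiplier_norm_def by (rule cSup_upper[OF _ bdd])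
    \<comment> \<open>On these vectors the translations in row \<open>i\<close> all lead to multiples of the basis vector at \<open>g i\<close>,
      so the scalar product is read off.\<close>
    define \<xi> where "\<xi> j = scaleC_ell2 (c (e j)) (ket (g j))" for j
    have S: "S i j (\<xi> j) = scaleC_ell2 (schur_fst G u a (e i) (e j) * c (e j) / C) (ket (g i))"
      if "i < n" "j < n" for i j
    proof -
      have "S i j = scalar_op (u (g i \<otimes>\<^bsub>G\<^esub> inv\<^bsub>G\<^esub> (g j)) * \<alpha> i j) o\<^sub>L left_reg G (g i \<otimes>\<^bsub>G\<^esub> inv\<^bsub>G\<^esub> (g j))"
        unfolding S_def T_def using g that by (intro multiplier_op_left_reg[OF G fm]) simp
      moreover have "left_reg G (g i \<otimes>\<^bsub>G\<^esub> inv\<^bsub>G\<^esub> (g j)) (\<xi> j) = scaleC_ell2 (c (e j)) (ket (g i))"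
        unfolding \<xi>_def using complex_linear_left_reg[OF G, of "g i \<otimes>\<^bsub>G\<^esub> inv\<^bsub>G\<^esub> (g j)"] g that
        by (simp add: complex_linear_def left_reg_ket[OF G])
      ultimately show ?thesis
        by (intro ell2_eqI) (simp add: scalar_op.rep_eq coord_simps schur_fst_def \<alpha>_def g_def)
    qed
    have "norm (\<Sum>j<n. S i j (\<xi> j)) = cmod (\<Sum>j<n. schur_fst G u a (e i) (e j) * c (e j)) * (1 / C)"
      if "i < n" for i
    proof -
      have "(\<Sum>j<n. S i j (\<xi> j)) = scaleC_ell2 ((\<Sum>j<n. schur_fst G u a (e i) (e j) * c (e j)) / C) (ket (g i))"
        using that by (intro ell2_eqI) (simp add: S coord_simps sum_distrib_right sum_divide_distrib)
      then show ?thesis using C by (simp add: norm_scaleC_ell2 norm_ket norm_divide)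
    qed
    then have "L2_set (\<lambda>i. norm (\<Sum>j<n. S i j (\<xi> j))) {..<n}
        = L2_set (\<lambda>i. cmod (\<Sum>j<n. schur_fst G u a (e i) (e j) * c (e j)) * (1 / C)) {..<n}"
      by (intro L2_set_cong) auto
    also have "\<dots> = L2_set (\<lambda>s. cmod (\<Sum>t\<in>Z. schur_fst G u a s t * c t)) Z * (1 / C)"
      unfolding sumZ L2Z using C by (intro L2_set_left_distrib[symmetric]) simp
    finally have "L2_set (\<lambda>s. cmod (\<Sum>t\<in>Z. schur_fst G u a s t * c t)) Z * (1 / C)
        \<le> opmat_norm n S * L2_set (\<lambda>j. norm (\<xi> j)) {..<n}"
      using opmat_norm_bound[of S \<xi> n] by simp
    also have "L2_set (\<lambda>j. norm (\<xi> j)) {..<n} = L2_set (\<lambda>t. cmod (c t)) Z"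
      unfolding L2Z by (simp add: \<xi>_def norm_scaleC_ell2 norm_ket)
    also have "opmat_norm n S * \<dots> \<le> cb_multiplier_norm G u * \<dots>" by (intro mult_right_mono Sn) simp
    finally show ?thesis using C by (simp add: field_simps)
  qed
  have "0 \<le> cb_multiplier_norm G u"
  proof -
    have "opmat_norm 0 (\<lambda>i j. multiplier_op G u 0) \<in> amplification_norms G u"
      unfolding amplification_norms_def
      by (intro CollectI exI[of _ 0] exI[of _ "\<lambda>i j. 0"] conjI refl opmat_norm_le) auto
    then have "opmat_norm 0 (\<lambda>i j. multiplier_op G u 0) \<le> cb_multiplier_norm G u"
      unfolding cb_multiplier_norm_def by (rule cSup_upper[OF _ bdd])
    then show ?thesis by (simp add: opmat_norm_def)
  qed
  then show ?thesis
    using C a by (intro matrix_bound_supportedI[OF _ _ main]) (auto simp: supported_on_def schur_fst_def)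
qed

section \<open>Functionals vanishing on the reduced group algebra\<close>

lemma subspace_closure:
  fixes S :: "'a::real_normed_vector set"
  assumes "subspace S"
  shows "subspace (closure S)"
  unfolding subspace_def
proof (intro conjI ballI allI)
  show "0 \<in> closure S" using subspace_0[OF assms] closure_subset by blast
next
  fix x y assume "x \<in> closure S" "y \<in> closure S"
  then obtain a b where "\<And>n. a n \<in> S" "a \<longlonglongrightarrow> x" "\<And>n. b n \<in> S" "b \<longlonglongrightarrow> y"
    unfolding closure_sequential by blast
  then show "x + y \<in> closure S"
    unfolding closure_sequential
    by (intro exI[of _ "\<lambda>n. a n + b n"]) (auto intro: tendsto_add subspace_add[OF assms])
next
  fix c x assume "x \<in> closure S"
  then obtain a where "\<And>n. a n \<in> S" "a \<longlonglongrightarrow> x" unfolding closure_sequential by blast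
  then show "c *\<^sub>R x \<in> closure S"
    unfolding closure_sequential
    by (intro exI[of _ "\<lambda>n. c *\<^sub>R a n"]) (auto intro: tendsto_intros subspace_scale[OF assms])
qed

text \<open>
  Reduces complex multiples to real ones and multiplication by \<open>\<i>\<close>, so that a real-linear functional
  can be evaluated on them.
\<close>

lemma scalar_op_compose:
  "scalar_op c o\<^sub>L S = Re c *\<^sub>R S + Im c *\<^sub>R (scalar_op \<i> o\<^sub>L S)"
  by (intro blinfun_eqI ell2_eqI)
    (simp add: scalar_op.rep_eq blinfun.add_left blinfun.scaleR_left coord_simps complex_eq_iff)

lemma bounded_linear_scalar_op: "bounded_linear (\<lambda>S. scalar_op c o\<^sub>L S)"
  by (rule bounded_bilinear.bounded_linear_right[OF bounded_bilinear_blinfun_compose])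

text \<open>
  The usual complexification \<open>f S - \<i> f (\<i> S)\<close> of a real functional \<open>f\<close>.
\<close>

lemma complex_separating_functional:
  fixes C :: "('a ell2 \<Rightarrow>\<^sub>L 'b ell2) set"
  assumes C: "subspace C" "closed C" and i: "\<And>S. S \<in> C \<Longrightarrow> scalar_op \<i> o\<^sub>L S \<in> C" and T: "T \<notin> C"
  shows "\<exists>\<Phi> :: _ \<Rightarrow> complex. bounded_linear \<Phi> \<and> (\<forall>c S. \<Phi> (scalar_op c o\<^sub>L S) = c * \<Phi> S) \<and>
    (\<forall>S\<in>C. \<Phi> S = 0) \<and> \<Phi> T \<noteq> 0"
proof -
  obtain f where f: "bounded_linear f" "\<And>S. S \<in> C \<Longrightarrow> f S = (0::real)" "f T \<noteq> 0"
    using separating_functional[OF C T] by blast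
  interpret f: bounded_linear f by fact
  define \<Phi> where "\<Phi> S = complex_of_real (f S) - \<i> * complex_of_real (f (scalar_op \<i> o\<^sub>L S))" for S
  have "bounded_linear \<Phi>"
    unfolding \<Phi>_def
    by (intro bounded_linear_sub bounded_linear_const_mult bounded_linear_compose[OF bounded_linear_of_real]
        f(1) bounded_linear_compose[OF f(1) bounded_linear_scalar_op])
  moreover have "\<Phi> (scalar_op c o\<^sub>L S) = c * \<Phi> S" for c S
  proof -
    have "scalar_op \<i> o\<^sub>L (scalar_op c o\<^sub>L S) = Re c *\<^sub>R (scalar_op \<i> o\<^sub>L S) - Im c *\<^sub>R S"
      by (intro blinfun_eqI ell2_eqI)
        (simp add: scalar_op.rep_eq blinfun.diff_left blinfun.scaleR_left coord_simps complex_eq_iff)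
    then show ?thesis
      unfolding \<Phi>_def by (subst (1) scalar_op_compose) (simp add: f.add f.diff f.scaleR complex_eq_iff)
  qed
  moreover have "\<Phi> S = 0" if "S \<in> C" for S using f(2)[OF that] f(2)[OF i[OF that]] by (simp add: \<Phi>_def)
  moreover have "\<Phi> T \<noteq> 0" using f(3) by (simp add: \<Phi>_def complex_eq_iff)
  ultimately show ?thesis by blast
qed

lemma subspace_group_algebra:
  assumes "group G"
  shows "subspace (group_algebra_ops G)"
  unfolding subspace_def
proof (intro conjI ballI allI)
  show "0 \<in> group_algebra_ops G"
    unfolding group_algebra_ops_def by (auto intro!: exI[of _ "{}"])
next
  fix S T assume "S \<in> group_algebra_ops G" "T \<in> group_algebra_ops G"
  then obtain c F d E where "complex_linear S" "complex_linear T" "finite F" "F \<subseteq> carrier G" "\<And>g. g \<notin> F \<Longrightarrow> c g = 0"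
    "entry S = convolution_matrix G c"
    "finite E" "E \<subseteq> carrier G" "\<And>g. g \<notin> E \<Longrightarrow> d g = 0" "entry T = convolution_matrix G d"
    unfolding group_algebra_ops_iff[OF assms] by blast
  then show "S + T \<in> group_algebra_ops G"
    unfolding group_algebra_ops_iff[OF assms]
    by (intro conjI exI[of _ "\<lambda>g. c g + d g"] exI[of _ "F \<union> E"])
      (auto simp: convolution_matrix_def intro!: ext)
next
  fix r S assume "S \<in> group_algebra_ops G"
  then obtain c F where S: "complex_linear S" "finite F" "F \<subseteq> carrier G" "\<And>g. g \<notin> F \<Longrightarrow> c g = 0"
    "entry S = convolution_matrix G c"
    unfolding group_algebra_ops_iff[OF assms] by blast
  have "r *\<^sub>R S = scalar_op (of_real r) o\<^sub>L S" using scalar_op_compose[of "of_real r" S] by simp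
  then show "r *\<^sub>R S \<in> group_algebra_ops G"
    unfolding group_algebra_ops_iff[OF assms] using S
    by (intro conjI exI[of _ "\<lambda>g. of_real r * c g"] exI[of _ F])
      (auto simp: convolution_matrix_def complex_linear_compose intro!: ext)
qed

lemma subspace_reduced_Cstar: "group G \<Longrightarrow> subspace (reduced_Cstar G)"
  unfolding reduced_Cstar_def by (intro subspace_closure subspace_group_algebra)

lemma closed_reduced_Cstar: "closed (reduced_Cstar G)"
  by (simp add: reduced_Cstar_def)

lemma scalar_op_reduced_Cstar:
  assumes "group G" "S \<in> reduced_Cstar G"
  shows "scalar_op c o\<^sub>L S \<in> reduced_Cstar G"
proof -
  have "scalar_op c o\<^sub>L T \<in> group_algebra_ops G" if T: "T \<in> group_algebra_ops G" for T
  proof -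
    obtain d F where "complex_linear T" "finite F" "F \<subseteq> carrier G" "\<And>g. g \<notin> F \<Longrightarrow> d g = 0"
      "entry T = convolution_matrix G d"
      using T unfolding group_algebra_ops_iff[OF assms(1)] by blast
    then show ?thesis
      unfolding group_algebra_ops_iff[OF assms(1)]
      by (intro conjI exI[of _ "\<lambda>g. c * d g"] exI[of _ F])
        (auto simp: convolution_matrix_def complex_linear_compose intro!: ext)
  qed
  then have "(\<lambda>S. scalar_op c o\<^sub>L S) ` closure (group_algebra_ops G) \<subseteq> closure (group_algebra_ops G)"
    using closure_subset
    by (intro image_closure_subset linear_continuous_on bounded_linear_scalar_op closed_closure) blast
  then show ?thesis using assms(2) unfolding reduced_Cstar_def by blast
qed

section \<open>The approximation property\<close>

lemma Q_norm_le:
  assumes "group G"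
    and "\<And>u. u \<in> cb_multipliers G \<Longrightarrow> cb_multiplier_norm G u \<le> 1 \<Longrightarrow> cmod (ell1_pairing G f u) \<le> r"
  shows "Q_norm G f \<le> r"
  unfolding Q_norm_def
proof (rule cSup_least)
  show "{cmod (ell1_pairing G f u) |u. u \<in> cb_multipliers G \<and> cb_multiplier_norm G u \<le> 1} \<noteq> {}"
    using zero_cb_multiplier[OF assms(1)] by blast
qed (use assms(2) in auto)

text \<open>
  The topology makes the pairing with \<open>F\<close> continuous, and its points are completely bounded
  multipliers, so the elements of the Fourier algebra near the constant function \<open>1\<close> are multipliers.
\<close>

lemma AP_approximation:
  assumes AP: "has_AP G" and F: "F \<in> Q_space G" and \<epsilon>: "\<epsilon> > 0"
  shows "\<exists>u\<in>fourier_algebra G. u \<in> cb_multipliers G \<and>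
      cmod (Q_pairing G F u - Q_pairing G F (indicator (carrier G))) < \<epsilon>"
proof -
  let ?X = "cb_multiplier_topology G" and ?P = "product_topology (\<lambda>_. euclidean) (Q_space G)"
  let ?one = "indicator (carrier G)"
  have top: "topspace ?X = cb_multipliers G"
    by (auto simp: cb_multiplier_topology_def topspace_pullback_topology)
  have one: "?one \<in> (?X closure_of (fourier_algebra G))" using AP unfolding has_AP_def .
  then have one': "?one \<in> cb_multipliers G" using top by (auto simp: in_closure_of)
  define B where "B = ball (Q_pairing G F ?one) \<epsilon>"
  define V where "V = {x \<in> topspace ?P. x F \<in> B}"
  have "continuous_map ?P euclidean (\<lambda>x. x F)"
    using continuous_map_product_projection[OF F] .
  then have "openin ?P V"
    unfolding V_def by (rule openin_continuous_map_preimage) (simp add: B_def)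
  moreover define W where "W = (\<lambda>u. \<lambda>F\<in>Q_space G. Q_pairing G F u) -` V \<inter> cb_multipliers G"
  ultimately have "openin ?X W"
    unfolding cb_multiplier_topology_def openin_pullback_topology by blast
  moreover have "?one \<in> W"
    using one' \<epsilon> F by (auto simp: W_def V_def B_def)
  ultimately obtain u where u: "u \<in> fourier_algebra G" "u \<in> W"
    using one unfolding in_closure_of by blast
  then show "\<exists>u\<in>fourier_algebra G. u \<in> cb_multipliers G \<and>
      cmod (Q_pairing G F u - Q_pairing G F ?one) < \<epsilon>"
    using F by (intro bexI[OF _ u(1)]) (auto simp: W_def V_def B_def dist_norm norm_minus_commute)
qed

section \<open>Schur multiplication on invariant operators of a product\<close>

text \<open>
  Point masses are coefficient functions, so extracting one diagonal of a matrix is bounded by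
  \<open>matrix_bound_schur_coeff\<close>.
\<close>

lemma coeff_ket:
  assumes "group G" "g \<in> carrier G"
  shows "coeff G (ket \<one>\<^bsub>G\<^esub>) (ket g) = (\<lambda>x. if x = g then 1 else 0)"
proof
  interpret group G by fact
  fix x
  show "coeff G (ket \<one>\<^bsub>G\<^esub>) (ket g) x = (if x = g then 1 else 0)"
    using entry_left_reg[OF assms(1), of x g "\<one>\<^bsub>G\<^esub>"] assms(2)
    by (auto simp: coeff_def cinner_ket entry_def)
qed

lemma cinner_add_right: "cinner_ell2 x (y + z) = cinner_ell2 x y + cinner_ell2 x z"
  by (simp add: cinner_ell2.rep_eq plus_ell2.rep_eq distrib_left infsum_add cinner_ell2_summable)

lemma coeff_split:
  "coeff G \<xi> \<eta> x = coeff G \<xi>' \<eta>' x + coeff G (\<xi> - \<xi>') \<eta> x + coeff G \<xi>' (\<eta> - \<eta>') x"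
proof -
  have "cinner_ell2 (left_reg G x \<xi>) \<eta>
      = cinner_ell2 (left_reg G x \<xi>') \<eta> + cinner_ell2 (left_reg G x (\<xi> - \<xi>')) \<eta>"
    unfolding cinner_ell2_add[symmetric] blinfun.add_right[symmetric] by simp
  moreover have "cinner_ell2 (left_reg G x \<xi>') \<eta>
      = cinner_ell2 (left_reg G x \<xi>') \<eta>' + cinner_ell2 (left_reg G x \<xi>') (\<eta> - \<eta>')"
    unfolding cinner_add_right[symmetric] by simp
  ultimately show ?thesis by (simp add: coeff_def)
qed

lemma coeff_finite_support:
  assumes G: "group G" and E: "finite E" and \<xi>: "\<And>s. s \<notin> E \<Longrightarrow> coord \<xi> s = 0"
    and \<eta>: "\<And>s. s \<notin> E \<Longrightarrow> coord \<eta> s = 0"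
  shows "finite {x. coeff G \<xi> \<eta> x \<noteq> 0}"
proof (rule finite_subset)
  interpret group G by (rule G)
  show "finite ((\<lambda>(s, t). s \<otimes>\<^bsub>G\<^esub> inv\<^bsub>G\<^esub> t) ` (E \<times> E))" using E by simp
  show "{x. coeff G \<xi> \<eta> x \<noteq> 0} \<subseteq> (\<lambda>(s, t). s \<otimes>\<^bsub>G\<^esub> inv\<^bsub>G\<^esub> t) ` (E \<times> E)"
  proof
    fix x assume "x \<in> {x. coeff G \<xi> \<eta> x \<noteq> 0}"
    then have x: "x \<in> carrier G" and nz: "cinner_ell2 (left_reg G x \<xi>) \<eta> \<noteq> 0"
      by (auto simp: coeff_def split: if_splits)
    have "\<exists>s. coord (left_reg G x \<xi>) s * cnj (coord \<eta> s) \<noteq> 0"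
    proof (rule ccontr)
      assume "\<nexists>s. coord (left_reg G x \<xi>) s * cnj (coord \<eta> s) \<noteq> 0"
      then have "\<forall>s. coord (left_reg G x \<xi>) s * cnj (coord \<eta> s) = 0" by blast
      then show False using nz unfolding cinner_ell2.rep_eq by (simp only: infsum_0 simp_thms)
    qed
    then obtain s where s: "coord (left_reg G x \<xi>) s * cnj (coord \<eta> s) \<noteq> 0" by blast
    then have sc: "s \<in> carrier G" and t: "inv\<^bsub>G\<^esub> x \<otimes>\<^bsub>G\<^esub> s \<in> E" "s \<in> E"
      using \<xi> \<eta> by (auto simp: left_reg_apply[OF G x] split: if_splits)
    have "s \<otimes>\<^bsub>G\<^esub> inv\<^bsub>G\<^esub> (inv\<^bsub>G\<^esub> x \<otimes>\<^bsub>G\<^esub> s) = x"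
      using x sc by (simp add: inv_mult_group m_assoc[symmetric])
    then show "x \<in> (\<lambda>(s, t). s \<otimes>\<^bsub>G\<^esub> inv\<^bsub>G\<^esub> t) ` (E \<times> E)" using t by force
  qed
qed

context
  fixes G :: "('a, 'm) monoid_scheme" and H :: "('b, 'n) monoid_scheme"
  assumes G: "group G" and H: "group H"
begin

interpretation G: group G by (rule G)
interpretation K: group "G \<times>\<times> H" by (rule DirProd_group[OF G H])

lemma supported_on_band: "S \<in> band_ops (G \<times>\<times> H) \<Longrightarrow> supported_on (carrier G \<times> carrier H) (entry S)"
  by (simp add: band_ops_def banded_def)

lemma schur_coeff_operator:
  assumes "complex_linear S" "supported_on (carrier G \<times> carrier H) (entry S)"
  shows "\<exists>U. complex_linear U \<and> entry U = schur_fst G (coeff G \<xi> \<eta>) (entry S) \<and> norm U \<le> norm \<xi> * norm \<eta> * norm S"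
  using operator_of_matrix_bound[OF matrix_bound_schur_coeff[OF G assms(2) matrix_bound_entries[OF assms(1)]]] by blast

text \<open>
  The operator whose matrix is the part of the matrix of \<open>S\<close> on the diagonal \<open>s\<^sub>1 t\<^sub>1\<inverse> = g\<close>.
\<close>

definition diagonal :: "(('a \<times> 'b) ell2 \<Rightarrow>\<^sub>L ('a \<times> 'b) ell2) \<Rightarrow> 'a \<Rightarrow> ('a \<times> 'b) ell2 \<Rightarrow>\<^sub>L ('a \<times> 'b) ell2" where
  "diagonal S g = (SOME D. complex_linear D \<and>
     entry D = (\<lambda>s t. if fst s \<otimes>\<^bsub>G\<^esub> inv\<^bsub>G\<^esub> (fst t) = g then entry S s t else 0))"

lemma diagonal_entries:
  assumes "complex_linear S" "supported_on (carrier G \<times> carrier H) (entry S)" "g \<in> carrier G"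
  shows "complex_linear (diagonal S g)"
    and "entry (diagonal S g) = (\<lambda>s t. if fst s \<otimes>\<^bsub>G\<^esub> inv\<^bsub>G\<^esub> (fst t) = g then entry S s t else 0)"
proof -
  obtain U where "complex_linear U" "entry U = schur_fst G (coeff G (ket \<one>\<^bsub>G\<^esub>) (ket g)) (entry S)"
    using schur_coeff_operator[OF assms(1,2)] by blast
  then have "complex_linear U \<and> entry U = (\<lambda>s t. if fst s \<otimes>\<^bsub>G\<^esub> inv\<^bsub>G\<^esub> (fst t) = g then entry S s t else 0)"
    by (auto simp: coeff_ket[OF G assms(3)] schur_fst_def intro!: ext)
  from someI[of "\<lambda>D. complex_linear D \<and> entry D = (\<lambda>s t. if fst s \<otimes>\<^bsub>G\<^esub> inv\<^bsub>G\<^esub> (fst t) = g then entry S s t else 0)", OF this]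
  show "complex_linear (diagonal S g)"
    "entry (diagonal S g) = (\<lambda>s t. if fst s \<otimes>\<^bsub>G\<^esub> inv\<^bsub>G\<^esub> (fst t) = g then entry S s t else 0)"
    unfolding diagonal_def by blast+
qed

lemma sum_diagonals:
  assumes S: "complex_linear S" "supported_on (carrier G \<times> carrier H) (entry S)"
    and F: "finite F" "F \<subseteq> carrier G"
    and u: "\<And>s t. entry S s t \<noteq> 0 \<Longrightarrow> fst s \<otimes>\<^bsub>G\<^esub> inv\<^bsub>G\<^esub> (fst t) \<notin> F \<Longrightarrow> u (fst s \<otimes>\<^bsub>G\<^esub> inv\<^bsub>G\<^esub> (fst t)) = 0"
  shows "complex_linear (\<Sum>g\<in>F. scalar_op (u g) o\<^sub>L diagonal S g)"
    and "entry (\<Sum>g\<in>F. scalar_op (u g) o\<^sub>L diagonal S g) = schur_fst G u (entry S)"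
proof -
  show "complex_linear (\<Sum>g\<in>F. scalar_op (u g) o\<^sub>L diagonal S g)"
    using F(2) by (intro complex_linear_sum complex_linear_compose diagonal_entries(1)[OF S]) auto
  show "entry (\<Sum>g\<in>F. scalar_op (u g) o\<^sub>L diagonal S g) = schur_fst G u (entry S)"
  proof (intro ext)
    fix s t :: "'a \<times> 'b"
    let ?x = "fst s \<otimes>\<^bsub>G\<^esub> inv\<^bsub>G\<^esub> (fst t)"
    have "entry (\<Sum>g\<in>F. scalar_op (u g) o\<^sub>L diagonal S g) s t
        = (\<Sum>g\<in>F. if ?x = g then u g * entry S s t else 0)"
      using F(2) by (auto simp: diagonal_entries(2)[OF S] intro!: sum.cong)
    also have "\<dots> = schur_fst G u (entry S) s t"
      using F(1) u[of s t] by (auto simp: schur_fst_def)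
    finally show "entry (\<Sum>g\<in>F. scalar_op (u g) o\<^sub>L diagonal S g) s t = schur_fst G u (entry S) s t" .
  qed
qed

text \<open>
  For finitely supported \<open>u\<close> the Schur product is a finite combination of diagonals.
\<close>

lemma schur_finite_support_in_reduced_Cstar:
  assumes cG: "countable (carrier G)" and cH: "countable (carrier H)" and ITAP: "has_ITAP H"
    and T: "T \<in> closure (band_ops (G \<times>\<times> H))" and inv: "translation_invariant (G \<times>\<times> H) (entry T)"
    and u: "finite {x. u x \<noteq> 0}"
    and U: "complex_linear U" "entry U = schur_fst G u (entry T)"
  shows "U \<in> reduced_Cstar (G \<times>\<times> H)"
proof -
  have cT: "complex_linear T" by (rule complex_linear_closure[OF T]) (simp add: band_ops_def)
  have supp: "supported_on (carrier G \<times> carrier H) (entry T)"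
    using inv by (simp add: translation_invariant_def)
  define F where "F = {x \<in> carrier G. u x \<noteq> 0}"
  have F: "finite F" "F \<subseteq> carrier G" using u by (auto simp: F_def)
  have u0: "u (fst s \<otimes>\<^bsub>G\<^esub> inv\<^bsub>G\<^esub> (fst t)) = 0"
    if "entry T s t \<noteq> 0" "fst s \<otimes>\<^bsub>G\<^esub> inv\<^bsub>G\<^esub> (fst t) \<notin> F" for s t
  proof -
    have "s \<in> carrier G \<times> carrier H" "t \<in> carrier G \<times> carrier H"
      using supp that(1) unfolding supported_on_def by blast+
    then show ?thesis using that(2) by (auto simp: F_def)
  qed
  have diag: "diagonal T g \<in> reduced_Cstar (G \<times>\<times> H)" if g: "g \<in> carrier G" for g
  proof -
    obtain S where S: "S \<in> reduced_Cstar (G \<times>\<times> H)" "complex_linear S"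
      "entry S = (\<lambda>s t. if fst s \<otimes>\<^bsub>G\<^esub> inv\<^bsub>G\<^esub> (fst t) = g then entry T s t else 0)"
      using diagonal_in_reduced_Cstar[OF G H cG cH ITAP T inv g] by blast
    have "diagonal T g = S"
      by (rule complex_linear_eqI[OF diagonal_entries(1)[OF cT supp g] S(2)]) (simp add: S(3) diagonal_entries(2)[OF cT supp g])
    then show ?thesis using S(1) by simp
  qed
  have "U = (\<Sum>g\<in>F. scalar_op (u g) o\<^sub>L diagonal T g)"
    using sum_diagonals[OF cT supp F, of u] u0 U by (intro complex_linear_eqI) auto
  also have "\<dots> \<in> reduced_Cstar (G \<times>\<times> H)"
    using F(2) by (intro subspace_sum[OF subspace_reduced_Cstar[OF K.is_group]]
        scalar_op_reduced_Cstar[OF K.is_group] diag) auto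
  finally show ?thesis .
qed

text \<open>
  Truncating \<open>\<xi>\<close> and \<open>\<eta>\<close> makes the coefficient function finitely supported, and the bound for Gram
  kernels controls the error in norm.
\<close>

lemma schur_coeff_in_reduced_Cstar:
  assumes cG: "countable (carrier G)" and cH: "countable (carrier H)" and ITAP: "has_ITAP H"
    and T: "T \<in> closure (band_ops (G \<times>\<times> H))" and inv: "translation_invariant (G \<times>\<times> H) (entry T)"
    and U: "complex_linear U" "entry U = schur_fst G (coeff G \<xi> \<eta>) (entry T)"
  shows "U \<in> reduced_Cstar (G \<times>\<times> H)"
proof -
  have cT: "complex_linear T" by (rule complex_linear_closure[OF T]) (simp add: band_ops_def)
  have supp: "supported_on (carrier G \<times> carrier H) (entry T)"
    using inv by (simp add: translation_invariant_def)
  let ?b = "\<lambda>E. norm (\<xi> - trunc E \<xi>) * norm \<eta> * norm T + norm (trunc E \<xi>) * norm (\<eta> - trunc E \<eta>) * norm T"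
  have "(?b \<longlongrightarrow> norm (\<xi> - \<xi>) * norm \<eta> * norm T + norm \<xi> * norm (\<eta> - \<eta>) * norm T) (finite_subsets_at_top UNIV)"
    by (intro tendsto_intros trunc_tendsto)
  then have lim: "(?b \<longlongrightarrow> 0) (finite_subsets_at_top UNIV)" by simp
  have "\<exists>V\<in>reduced_Cstar (G \<times>\<times> H). dist V U < e" if "e > 0" for e
  proof -
    have "eventually (\<lambda>E. ?b E < e \<and> finite E) (finite_subsets_at_top UNIV)"
      using order_tendstoD(2)[OF lim that]
      by (rule eventually_conj) (auto intro: eventually_finite_subsets_at_top_weakI)
    then obtain E where E: "?b E < e" "finite E"
      using eventually_happens' finite_subsets_at_top_neq_bot by blast
    obtain V where V: "complex_linear V" "entry V = schur_fst G (coeff G (trunc E \<xi>) (trunc E \<eta>)) (entry T)"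
      using schur_coeff_operator[OF cT supp] by blast
    obtain W1 where W1: "complex_linear W1" "entry W1 = schur_fst G (coeff G (\<xi> - trunc E \<xi>) \<eta>) (entry T)"
      "norm W1 \<le> norm (\<xi> - trunc E \<xi>) * norm \<eta> * norm T"
      using schur_coeff_operator[OF cT supp] by blast
    obtain W2 where W2: "complex_linear W2" "entry W2 = schur_fst G (coeff G (trunc E \<xi>) (\<eta> - trunc E \<eta>)) (entry T)"
      "norm W2 \<le> norm (trunc E \<xi>) * norm (\<eta> - trunc E \<eta>) * norm T"
      using schur_coeff_operator[OF cT supp] by blast
    have "U = V + W1 + W2"
    proof (rule complex_linear_eqI)
      fix s t
      show "entry U s t = entry (V + W1 + W2) s t"
        using coeff_split[of G \<xi> \<eta> "fst s \<otimes>\<^bsub>G\<^esub> inv\<^bsub>G\<^esub> (fst t)" "trunc E \<xi>" "trunc E \<eta>"]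
        by (simp add: U V W1 W2 schur_fst_def algebra_simps)
    qed (use U V W1 W2 in auto)
    then have "dist V U = norm (W1 + W2)" by (simp add: dist_norm norm_minus_commute add.commute)
    also have "\<dots> < e" using norm_triangle_ineq[of W1 W2] W1(3) W2(3) E(1) by linarith
    finally have "dist V U < e" .
    moreover have "V \<in> reduced_Cstar (G \<times>\<times> H)"
    proof (rule schur_finite_support_in_reduced_Cstar[OF cG cH ITAP T inv _ V])
      show "finite {x. coeff G (trunc E \<xi>) (trunc E \<eta>) x \<noteq> 0}"
        by (rule coeff_finite_support[OF G E(2)]) (simp_all add: coord_trunc[OF E(2)])
    qed
    ultimately show ?thesis by blast
  qed
  then have "U \<in> closure (reduced_Cstar (G \<times>\<times> H))" unfolding closure_approachable by blast
  then show ?thesis by (simp add: closure_closed[OF closed_reduced_Cstar])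
qed

text \<open>
  A functional that separates \<open>T\<close> from the reduced algebra yields, through its values on the diagonals
  of banded approximants of \<open>T\<close>, an element of \<open>Q(G)\<close> which pairs to zero with the Fourier algebra but not
  with the constant function \<open>1\<close>.
\<close>

lemma ITAP_product:
  assumes cG: "countable (carrier G)" and cH: "countable (carrier H)"
    and AP: "has_AP G" and ITAP: "has_ITAP H"
  shows "has_ITAP (G \<times>\<times> H)"
proof -
  let ?C = "reduced_Cstar (G \<times>\<times> H)"
  have cK: "countable (carrier (G \<times>\<times> H))" using cG cH by simp
  show ?thesis
    unfolding has_ITAP_iff[OF K.is_group cK]
  proof (intro ballI impI, rule ccontr)
    fix T assume T: "T \<in> closure (band_ops (G \<times>\<times> H))" and inv: "translation_invariant (G \<times>\<times> H) (entry T)"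
      and TC: "T \<notin> ?C"
    have cT: "complex_linear T" by (rule complex_linear_closure[OF T]) (simp add: band_ops_def)
    have supp: "supported_on (carrier G \<times> carrier H) (entry T)"
      using inv by (simp add: translation_invariant_def)
    obtain \<Phi> :: "_ \<Rightarrow> complex" where \<Phi>: "bounded_linear \<Phi>" "\<And>c S. \<Phi> (scalar_op c o\<^sub>L S) = c * \<Phi> S"
      "\<And>S. S \<in> ?C \<Longrightarrow> \<Phi> S = 0" "\<Phi> T \<noteq> 0"
      using complex_separating_functional[OF subspace_reduced_Cstar[OF K.is_group] closed_reduced_Cstar
          scalar_op_reduced_Cstar[OF K.is_group] TC] by blast
    interpret \<Phi>: bounded_linear \<Phi> by (rule \<Phi>(1))
    obtain B where B: "B > 0" "\<And>S. cmod (\<Phi> S) \<le> norm S * B" using \<Phi>.pos_bounded by blast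
    obtain Tn where Tn: "\<And>n. Tn n \<in> band_ops (G \<times>\<times> H)" "Tn \<longlonglongrightarrow> T"
      using T unfolding closure_sequential by blast
    have cTn: "complex_linear (Tn n)" for n using Tn(1) by (simp add: band_ops_def)
    \<comment> \<open>For banded \<open>S\<close>, the function \<open>f S\<close> on \<open>G\<close> is finitely supported and represents
      the map \<open>u \<mapsto> \<Phi> (M\<^sub>u S)\<close>.\<close>
    define f where "f S g = (if g \<in> carrier G then \<Phi> (diagonal S g) else 0)" for S g
    have band: "\<exists>E. finite E \<and> E \<subseteq> carrier G \<and> (\<forall>g. g \<notin> E \<longrightarrow> f S g = 0) \<and>
        (\<forall>u. \<exists>U. complex_linear U \<and> entry U = schur_fst G u (entry S) \<and> (\<Sum>g\<in>E. f S g * u g) = \<Phi> U)"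
      if S: "S \<in> band_ops (G \<times>\<times> H)" for S
    proof -
      have cS: "complex_linear S" using S by (simp add: band_ops_def)
      have suppS: "supported_on (carrier G \<times> carrier H) (entry S)" using supported_on_band[OF S] .
      obtain F where F: "finite F" "\<And>s t. entry S s t \<noteq> 0 \<Longrightarrow> s \<otimes>\<^bsub>G \<times>\<times> H\<^esub> inv\<^bsub>G \<times>\<times> H\<^esub> t \<in> F"
        using S unfolding band_ops_def banded_def by blast
      define E where "E = fst ` F \<inter> carrier G"
      have E: "finite E" "E \<subseteq> carrier G" using F(1) by (auto simp: E_def)
      have inE: "fst s \<otimes>\<^bsub>G\<^esub> inv\<^bsub>G\<^esub> (fst t) \<in> E" if "entry S s t \<noteq> 0" for s t
      proof -
        have st: "s \<in> carrier G \<times> carrier H" "t \<in> carrier G \<times> carrier H"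
          using suppS that unfolding supported_on_def by blast+
        have "fst (s \<otimes>\<^bsub>G \<times>\<times> H\<^esub> inv\<^bsub>G \<times>\<times> H\<^esub> t) \<in> fst ` F" using F(2)[OF that] by blast
        then show ?thesis using st by (cases s; cases t) (auto simp: E_def inv_prod[OF G H])
      qed
      have "f S g = 0" if "g \<notin> E" for g
      proof (cases "g \<in> carrier G")
        case True
        have "entry (diagonal S g) s t = 0" for s t
          using inE[of s t] that by (auto simp: diagonal_entries(2)[OF cS suppS True])
        then have "diagonal S g = 0" by (intro complex_linear_eqI diagonal_entries(1)[OF cS suppS True]) simp_all
        then show ?thesis by (simp add: f_def \<Phi>.zero)
      qed (simp add: f_def)
      moreover have "\<exists>U. complex_linear U \<and> entry U = schur_fst G u (entry S) \<and> (\<Sum>g\<in>E. f S g * u g) = \<Phi> U" for u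
      proof (intro exI conjI)
        show "complex_linear (\<Sum>g\<in>E. scalar_op (u g) o\<^sub>L diagonal S g)"
          "entry (\<Sum>g\<in>E. scalar_op (u g) o\<^sub>L diagonal S g) = schur_fst G u (entry S)"
          using sum_diagonals[OF cS suppS E, of u] inE by blast+
        show "(\<Sum>g\<in>E. f S g * u g) = \<Phi> (\<Sum>g\<in>E. scalar_op (u g) o\<^sub>L diagonal S g)"
          using E(2) by (auto simp: \<Phi>.sum \<Phi>(2) f_def mult.commute intro!: sum.cong)
      qed
      ultimately show ?thesis using E by blast
    qed
    define F where "F n = f (Tn n)" for n
    have "\<exists>E. \<forall>n. finite (E n) \<and> E n \<subseteq> carrier G \<and> (\<forall>g. g \<notin> E n \<longrightarrow> F n g = 0) \<and>
        (\<forall>u. \<exists>U. complex_linear U \<and> entry U = schur_fst G u (entry (Tn n)) \<and> (\<Sum>g\<in>E n. F n g * u g) = \<Phi> U)"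
      unfolding F_def using band[OF Tn(1)] by (intro choice) blast
    then obtain E where E: "\<And>n. finite (E n)" "\<And>n. E n \<subseteq> carrier G" "\<And>n g. g \<notin> E n \<Longrightarrow> F n g = 0"
      and EU: "\<And>n u. \<exists>U. complex_linear U \<and> entry U = schur_fst G u (entry (Tn n)) \<and> (\<Sum>g\<in>E n. F n g * u g) = \<Phi> U"
      by blast
    define M where "M u n = (SOME U. complex_linear U \<and> entry U = schur_fst G u (entry (Tn n)) \<and>
        (\<Sum>g\<in>E n. F n g * u g) = \<Phi> U)" for u n
    have M: "complex_linear (M u n)" "entry (M u n) = schur_fst G u (entry (Tn n))"
      "(\<Sum>g\<in>E n. F n g * u g) = \<Phi> (M u n)" for u n
      using someI_ex[OF EU[where u = u and n = n]] unfolding M_def by blast+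
    have hs: "((\<lambda>g. F n g * u g) has_sum \<Phi> (M u n)) (carrier G)" for u n
      by (rule has_sum_finite_neutralI[OF E(1,2)]) (use E(3) M(3) in auto)
    have pair: "ell1_pairing G (F n) u = \<Phi> (M u n)" for n u
      unfolding ell1_pairing_def by (rule infsumI[OF hs])
    have pair_diff: "ell1_pairing G (\<lambda>x. F m x - F n x) u = \<Phi> (M u m - M u n)" for m n u
    proof -
      have "((\<lambda>g. F m g * u g + - (F n g * u g)) has_sum \<Phi> (M u m) + - \<Phi> (M u n)) (carrier G)"
        by (intro has_sum_add has_sum_uminusI hs)
      then show ?thesis
        unfolding ell1_pairing_def by (simp add: infsumI left_diff_distrib \<Phi>.diff)
    qed
    have ell1: "F n \<in> ell1_on G" for n
    proof -
      have "(\<lambda>x. cmod (F n x)) summable_on carrier G"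
        by (rule finite_nonzero_values_imp_summable_on, rule finite_subset[OF _ E(1)[of n]]) (use E(3) in auto)
      then show ?thesis using E(2,3) by (auto simp: ell1_on_def)
    qed
    \<comment> \<open>Cauchy in the norm of \<open>Q(G)\<close>, since \<open>M\<^sub>u\<close> is contractive on operators when \<open>u\<close> is in the unit
      ball.\<close>
    have FQ: "F \<in> Q_space G"
      unfolding Q_space_def
    proof (intro CollectI conjI allI impI ell1)
      fix \<epsilon> :: real assume \<epsilon>: "\<epsilon> > 0"
      define \<delta> where "\<delta> = \<epsilon> / (2 * B)"
      have \<delta>: "\<delta> > 0" "\<delta> * B < \<epsilon>" using \<epsilon> B(1) by (auto simp: \<delta>_def)
      obtain N where N: "\<And>m n. m \<ge> N \<Longrightarrow> n \<ge> N \<Longrightarrow> norm (Tn m - Tn n) < \<delta>"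
        using CauchyD[OF LIMSEQ_imp_Cauchy[OF Tn(2)] \<delta>(1)] by blast
      have "Q_norm G (\<lambda>x. F m x - F n x) \<le> \<delta> * B" if mn: "m \<ge> N" "n \<ge> N" for m n
      proof (rule Q_norm_le[OF G])
        fix u assume u: "u \<in> cb_multipliers G" "cb_multiplier_norm G u \<le> 1"
        have d: "complex_linear (Tn m - Tn n)" using cTn by simp
        have supp_d: "supported_on (carrier G \<times> carrier H) (entry (Tn m - Tn n))"
          using supported_on_band[OF Tn(1)[of m]] supported_on_band[OF Tn(1)[of n]]
          unfolding supported_on_def entry_diff by (metis diff_self)
        have "matrix_bound (entry (Tn m - Tn n)) \<delta>"
          using matrix_bound_mono[OF matrix_bound_entries[OF d]] N[OF mn] by simp
        then have "matrix_bound (schur_fst G u (entry (Tn m - Tn n))) (cb_multiplier_norm G u * \<delta>)"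
          by (rule matrix_bound_schur_cb[OF G u(1) supp_d _ \<delta>(1)])
        moreover have "cb_multiplier_norm G u * \<delta> \<le> \<delta>" using u(2) \<delta>(1) by simp
        moreover have "schur_fst G u (entry (Tn m - Tn n)) = entry (M u m - M u n)"
          by (intro ext) (simp add: schur_fst_def M(2) right_diff_distrib)
        ultimately have "norm (M u m - M u n) \<le> \<delta>"
          using M(1) by (intro norm_le_matrix_bound) (auto intro: matrix_bound_mono)
        then have "norm (M u m - M u n) * B \<le> \<delta> * B" using B(1) by simp
        then show "cmod (ell1_pairing G (\<lambda>x. F m x - F n x) u) \<le> \<delta> * B"
          unfolding pair_diff using B(2)[of "M u m - M u n"] by linarith
      qed
      then show "\<exists>N. \<forall>m\<ge>N. \<forall>n\<ge>N. Q_norm G (\<lambda>x. F m x - F n x) < \<epsilon>"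
        using \<delta>(2) by (meson le_less_trans)
    qed
    have one: "Q_pairing G F (indicator (carrier G)) = \<Phi> T"
    proof -
      \<comment> \<open>The Schur product with the constant function \<open>1\<close> is the identity.\<close>
      have "M (indicator (carrier G)) n = Tn n" for n
      proof (rule complex_linear_eqI[OF M(1) cTn])
        fix s t
        show "entry (M (indicator (carrier G)) n) s t = entry (Tn n) s t"
        proof (cases "entry (Tn n) s t = 0")
          case False
          then have "s \<in> carrier G \<times> carrier H" "t \<in> carrier G \<times> carrier H"
            using supported_on_band[OF Tn(1)] unfolding supported_on_def by blast+
          then show ?thesis by (auto simp: M(2) schur_fst_def)
        qed (simp add: M(2) schur_fst_def)
      qed
      then show ?thesis
        unfolding Q_pairing_def pair by (simp add: limI \<Phi>.tendsto[OF Tn(2)])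
    qed
    have zero: "Q_pairing G F u = 0" if uA: "u \<in> fourier_algebra G" for u
    proof -
      obtain \<xi> \<eta> where u: "u = coeff G \<xi> \<eta>" using uA by (auto simp: fourier_algebra_def)
      obtain U where U: "complex_linear U" "entry U = schur_fst G u (entry T)"
        using schur_coeff_operator[OF cT supp] unfolding u by blast
      \<comment> \<open>\<open>M\<^sub>u T\<^sub>n\<close> converges to \<open>M\<^sub>u T\<close>, which lies in the reduced algebra.\<close>
      have le: "norm (M u n - U) \<le> norm \<xi> * norm \<eta> * norm (Tn n - T)" for n
      proof -
        have "supported_on (carrier G \<times> carrier H) (entry (Tn n - T))"
          using supported_on_band[OF Tn(1)[of n]] supp
          unfolding supported_on_def entry_diff by (metis diff_0_right)
        then obtain W where W: "complex_linear W" "entry W = schur_fst G u (entry (Tn n - T))"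
          "norm W \<le> norm \<xi> * norm \<eta> * norm (Tn n - T)"
          using schur_coeff_operator[of "Tn n - T"] cTn cT unfolding u by (metis complex_linear_algebra(3))
        have "M u n - U = W"
          using M(1) U(1) W(1) by (intro complex_linear_eqI) (auto simp: M(2) U(2) W(2) schur_fst_def right_diff_distrib)
        then show ?thesis using W(3) by simp
      qed
      have "(\<lambda>n. norm \<xi> * norm \<eta> * norm (Tn n - T)) \<longlonglongrightarrow> 0"
        using tendsto_mult_left[OF tendsto_norm_zero[OF LIM_zero[OF Tn(2)]], of "norm \<xi> * norm \<eta>"] by simp
      then have "M u \<longlonglongrightarrow> U"
        using le by (intro LIM_zero_cancel[of "M u" U] Lim_null_comparison[of "\<lambda>n. M u n - U"]) auto
      then have "(\<lambda>n. \<Phi> (M u n)) \<longlonglongrightarrow> \<Phi> U" by (rule \<Phi>.tendsto)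
      moreover have "\<Phi> U = 0"
        using \<Phi>(3) schur_coeff_in_reduced_Cstar[OF cG cH ITAP T inv U(1)] U(2) u by blast
      ultimately show ?thesis unfolding Q_pairing_def pair by (simp add: limI)
    qed
    obtain u where "u \<in> fourier_algebra G"
      "cmod (Q_pairing G F u - Q_pairing G F (indicator (carrier G))) < cmod (\<Phi> T)"
      using AP_approximation[OF AP FQ, of "cmod (\<Phi> T)"] \<Phi>(4) by auto
    then show False using zero one by simp
  qed
qed

end

theorem corollary3p19:
  fixes G :: "('a, 'm) monoid_scheme" and H :: "('b, 'n) monoid_scheme"
  assumes "group G" and "countable (carrier G)"
    and "group H" and "countable (carrier H)"
    and "has_AP G"
  shows "has_ITAP (G \<times>\<times> H) \<longleftrightarrow> has_ITAP H"
  using ITAP_right_factor[OF assms(1,3,2,4)] ITAP_product[OF assms(1,3,2,4,5)] by blast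

end
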